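(* In the setting and with the notation described in the context, suppose that $\gamma_p>\gamma_{p+1}$ and that $Q_p^T\tilde Q^{(0)}$ is invertible. Then for $k=1,2,\ldots$ the matrices $\tilde Q^{(k)}$ generated by the iteration satisfy $$\tilde Q^{(k)}=(Q_p+Q_{p,\perp}E^{(k)})(M^{(k)})^{-\frac12}U^{(k)}$$ with $$E^{(k)}=(\Gamma_p')^{k}\,Q_{p,\perp}^T\tilde Q^{(0)}(Q_p^T\tilde Q^{(0)})^{-1}\Gamma_p^{-k},\qquad M^{(k)}=I+(E^{(k)})^TE^{(k)},$$ and $U^{(k)}$ an orthogonal matrix. Furthermore, with $E^{(0)}=Q_{p,\perp}^T\tilde Q^{(0)}(Q_p^T\tilde Q^{(0)})^{-1}$, $$\|E^{(k)}\|\le\left(\frac{\gamma_{p+1}}{\gamma_p}\right)^k\|E^{(0)}\|,$$ and the distance $\epsilon^{(k)}=\mathrm{dist}(\mathrm{span}\{\tilde Q^{(k)}\},\mathrm{span}\{Q_p\})$ satisfies $$\epsilon^{(k)}=\frac{\|E^{(k)}\|}{\sqrt{1+\|E^{(k)}\|^2}}\le\left(\frac{\gamma_{p+1}}{\gamma_p}\right)^k\|E^{(0)}\|.$$ Assume in addition that $R_1^{(k)}$ and $R_2^{(k)}$ are nonsingular. Then $$\epsilon_1^{(k)}:=\mathrm{dist}(\mathrm{span}\{V_p\},\mathrm{span}\{Q_1^{(k)}\})\le\sqrt2\,\epsilon^{(k)},\qquad \epsilon_2^{(k)}:=\mathrm{dist}(\mathrm{span}\{U_p\},\mathrm{span}\{Q_2^{(k)}\})\le\sqrt2\,\epsilon^{(k)}.$$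 Let $(\tilde\sigma_i^{(k)},\tilde u_i^{(k)},\tilde v_i^{(k)})$, $i=1,\ldots,p$, be the Ritz approximations with $\tilde\sigma_1^{(k)},\ldots,\tilde\sigma_p^{(k)}$ labeled in the same order as $\sigma_1,\ldots,\sigma_p$. Then $$|\tilde\sigma_i^{(k)}-\sigma_i|\le\|A\|\left(6(\epsilon^{(k)})^2+4(\epsilon^{(k)})^4\right),\qquad i=1,2,\ldots,p.$$
   Context: $\|\cdot\|$ is the 2-norm; $\mathrm{span}\{M\}$ is the column space of $M$; for subspaces of equal dimension $\mathrm{dist}(\mathcal{S}_1,\mathcal{S}_2)=\|P_1-P_2\|$ with $P_i$ the orthogonal projectors. Matrices. $A\in\mathbb{R}^{m\times n}$, $m\ge n$, smallest singular value $\sigma_{\min}$, $[a,b]\subset[\sigma_{\min},\|A\|]$, $0<a<b$; $n_{sv}$ is the number of singular values in $[a,b]$ counted with multiplicity. $S_A=\begin{bmatrix}0 & A^T \\ A & 0\end{bmatrix}$. With an SVD $A=U\begin{pmatrix}\Sigma \\ 0\end{pmatrix}V^T$, $U=[U_n\,|\,\hat U]$ ($U_n$ has $n$ columns), the orthogonal matrix $Q=\frac1{\sqrt2}\begin{bmatrix}V & V & 0 \\ U_n & -U_n & \sqrt2\hat U\end{bmatrix}$ satisfies $Q^TS_AQ=\mathrm{diag}(\Sigma,-\Sigma,0,\ldots,0)$. $P_{S_A}=Q_{in}Q_{in}^T+\frac12Q_{ab}Q_{ab}^T$, where $Q_{in}$ (resp. $Q_{ab}$) consists of the columns of $Q$ belonging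 to eigenvalues of $S_A$ in $(a,b)$ (resp. equal to $a$ or $b$). Approximate projector. $l(x)=x/\|A\|$; $\phi_d(x)=\sum_{j=0}^d\rho_{j,d}c_jT_j(x)$ with $T_j$ the Chebyshev polynomials of the first kind, $c_0=\frac1\pi(\arccos l(a)-\arccos l(b))$, $c_j=\frac2\pi\frac{\sin(j\arccos l(a))-\sin(j\arccos l(b))}{j}$ for $j>0$, and $\rho_{j,d}=\frac{(d+2-j)\sin(\frac{\pi}{d+2})\cos(\frac{j\pi}{d+2})+\cos(\frac{\pi}{d+2})\sin(\frac{j\pi}{d+2})}{(d+2)\sin\frac{\pi}{d+2}}$. $P=\phi_d(l(S_A))$, which has eigenvector matrix $Q$ and eigenvalues $\phi_d(l(\lambda))\in[0,1]$, $\lambda$ an eigenvalue of $S_A$. Labeling and standing assumptions. The eigenvalues of $P$ are labeled $\gamma_1\ge\gamma_2\ge\cdots\ge\gamma_{m+n}$ with corresponding eigenvalues $\lambda_i$ of $S_A$ ($\gamma_i=\phi_d(l(\lambda_i))$) and eigenvectors $q_i$, the $q_i$ being a permutation of the columns of $Q$. The degree $d$ is assumed large enough that: $\|P_{S_A}-P\|<\frac14$; $\lambda_1=\sigma_1,\ldots,\lambda_{n_{sv}}=\sigma_{n_{sv}}$ are exactly the singular values in $[a,b]$, with $\sigma_1,\ldots,\sigma_r\in(a,b)$, $\sigma_{r+1},\ldots,\sigma_{n_{sv}}\in\{a,b\}$ and $1\ge\gamma_1\ge\cdots\ge\gamma_r>\frac34>\gamma_{r+1}\ge\cdots\ge\gamma_{n_{sv}}>\frac14>\gamma_{n_{sv}+1}\ge\cdots\ge\gamma_{m+n}\ge0$;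 and, for the chosen subspace dimension $p\ge n_{sv}$, $\lambda_{n_{sv}+1},\ldots,\lambda_p$ are positive, so they are singular values $\sigma_{n_{sv}+1},\ldots,\sigma_p$ of $A$. Thus $q_1,\ldots,q_p$ are among the first $n$ columns of $Q$, and $q_i=\frac1{\sqrt2}\begin{bmatrix}v_i \\ u_i\end{bmatrix}$ with $v_i,u_i$ the right and left singular vectors for $\sigma_i$, $i\le p$. Notation: $Q_p=[q_1,\ldots,q_p]$, $Q_{p,\perp}=[q_{p+1},\ldots,q_{m+n}]$, $\Gamma_p=\mathrm{diag}(\gamma_1,\ldots,\gamma_p)$, $\Gamma_p'=\mathrm{diag}(\gamma_{p+1},\ldots,\gamma_{m+n})$, $V_p=[v_1,\ldots,v_p]$, $U_p=[u_1,\ldots,u_p]$. Iteration. Start from $\tilde Q^{(0)}\in\mathbb{R}^{(m+n)\times p}$ with orthonormal columns. For $k=1,2,\ldots$: $S^{(k)}=P\tilde Q^{(k-1)}$; QR decomposition $S^{(k)}=\tilde Q^{(k)}R^{(k)}$ ($\tilde Q^{(k)}$ column orthonormal, so $\mathrm{span}\{\tilde Q^{(k)}\}=P^k\,\mathrm{span}\{\tilde Q^{(0)}\}$); $Y^{(k)}=[I_n,0]\tilde Q^{(k)}$, $Z^{(k)}=[0,I_m]\tilde Q^{(k)}$; thin QR decompositions $Y^{(k)}=Q_1^{(k)}R_1^{(k)}$, $Z^{(k)}=Q_2^{(k)}R_2^{(k)}$; $\bar A^{(k)}=(Q_2^{(k)})^TAQ_1^{(k)}$ with SVD $\bar A^{(k)}=\bar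 U^{(k)}\tilde\Sigma^{(k)}(\bar V^{(k)})^T$, $\tilde\Sigma^{(k)}=\mathrm{diag}(\tilde\sigma_1^{(k)},\ldots,\tilde\sigma_p^{(k)})$. The Ritz approximations are $(\tilde\sigma_i^{(k)},\tilde u_i^{(k)},\tilde v_i^{(k)})$ with $\tilde u_i^{(k)}=Q_2^{(k)}\bar U^{(k)}e_i$, $\tilde v_i^{(k)}=Q_1^{(k)}\bar V^{(k)}e_i$. "Labeled in the same order" means that a permutation arranging $\sigma_1,\ldots,\sigma_p$ in decreasing order also arranges $\tilde\sigma_1^{(k)},\ldots,\tilde\sigma_p^{(k)}$ in decreasing order. *)

theory Defs
  imports
    Complex_Main
    "HOL-Combinatorics.Permutations"
    "Jordan_Normal_Form.Matrix"
    "Jordan_Normal_Form.Gauss_Jordan_Elimination"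
    "Jordan_Normal_Form.VS_Connect"
begin

(* Rows, columns, singular values and eigenvalues are indexed from 0 throughout:
   the i-th object of the mathematical text is the one with index i - 1. *)

section \<open>Norm, orthogonality, inverses, square roots\<close>

definition vec2_norm :: "real vec \<Rightarrow> real" where
  "vec2_norm v = sqrt (scalar_prod v v)"

(* The supremum runs over the closed unit ball, which is nonempty even in dimension 0. *)
definition mat2_norm :: "real mat \<Rightarrow> real" where
  "mat2_norm M = (SUP v \<in> {v \<in> carrier_vec (dim_col M). vec2_norm v \<le> 1}. vec2_norm (M *\<^sub>v v))"

(* Unlike orthogonal_mat of the library, which only asks for pairwise orthogonal nonzero
   columns, this requires columns of norm 1. *)
definition orthonormal_cols :: "nat \<Rightarrow> nat \<Rightarrow> real mat \<Rightarrow> bool" where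
  "orthonormal_cols nr nc M \<longleftrightarrow> M \<in> carrier_mat nr nc \<and> transpose_mat M * M = 1\<^sub>m nc"

(* Meaningful for invertible matrices only. *)
definition mat_inv :: "real mat \<Rightarrow> real mat" where
  "mat_inv M = the (mat_inverse M)"

definition sym_psd :: "real mat \<Rightarrow> bool" where
  "sym_psd M \<longleftrightarrow> square_mat M \<and> transpose_mat M = M \<and>
     (\<forall>v \<in> carrier_vec (dim_col M). scalar_prod v (M *\<^sub>v v) \<ge> 0)"

(* The principal square root; meaningful for symmetric positive semidefinite matrices. *)
definition mat_sqrt :: "real mat \<Rightarrow> real mat" where
  "mat_sqrt M = (THE X. X \<in> carrier_mat (dim_row M) (dim_row M) \<and> sym_psd X \<and> X * X = M)"

section \<open>Subspaces and their distance\<close>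

definition column_space :: "real mat \<Rightarrow> real vec set" where
  "column_space M = vec_space.col_space (dim_row M) M"

definition orth_projector :: "nat \<Rightarrow> real vec set \<Rightarrow> real mat" where
  "orth_projector N W = (THE X. X \<in> carrier_mat N N \<and> X * X = X \<and> transpose_mat X = X \<and>
     (\<lambda>v. X *\<^sub>v v) ` carrier_vec N = W)"

definition subspace_dist :: "nat \<Rightarrow> real vec set \<Rightarrow> real vec set \<Rightarrow> real" where
  "subspace_dist N W1 W2 = mat2_norm (orth_projector N W1 - orth_projector N W2)"

section \<open>Factorizations and block matrices\<close>

(* The singular values s 0, ..., s (nc - 1) need not be sorted. *)
definition is_svd :: "nat \<Rightarrow> nat \<Rightarrow> real mat \<Rightarrow> real mat \<Rightarrow> (nat \<Rightarrow> real) \<Rightarrow> real mat \<Rightarrow> bool" where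
  "is_svd nr nc M U s V \<longleftrightarrow>
     orthonormal_cols nr nr U \<and> orthonormal_cols nc nc V \<and> (\<forall>i<nc. 0 \<le> s i) \<and>
     M = U * (mat_diag nc s @\<^sub>r 0\<^sub>m (nr - nc) nc) * transpose_mat V"

definition is_qr :: "nat \<Rightarrow> nat \<Rightarrow> real mat \<Rightarrow> real mat \<Rightarrow> real mat \<Rightarrow> bool" where
  "is_qr nr nc M X R \<longleftrightarrow>
     orthonormal_cols nr nc X \<and> R \<in> carrier_mat nc nc \<and> upper_triangular R \<and> M = X * R"

(* The row block matrix [B, C], dual to append_rows of the library. *)
definition hcat :: "real mat \<Rightarrow> real mat \<Rightarrow> real mat" where
  "hcat B C = four_block_mat B C (0\<^sub>m 0 (dim_col B)) (0\<^sub>m 0 (dim_col C))"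

definition sel_cols :: "real mat \<Rightarrow> nat list \<Rightarrow> real mat" where
  "sel_cols M js = mat_of_cols (dim_row M) (map (col M) js)"

definition aug_mat :: "nat \<Rightarrow> nat \<Rightarrow> real mat \<Rightarrow> real mat" where
  "aug_mat m n A = four_block_mat (0\<^sub>m n n) (transpose_mat A) A (0\<^sub>m m m)"

definition aug_eigvecs :: "nat \<Rightarrow> nat \<Rightarrow> real mat \<Rightarrow> real mat \<Rightarrow> real mat" where
  "aug_eigvecs m n U V =
     (let U1 = sel_cols U [0..<n]; U2 = sel_cols U [n..<m]
      in (1 / sqrt 2) \<cdot>\<^sub>m
           (hcat V (hcat V (0\<^sub>m n (m - n))) @\<^sub>r hcat U1 (hcat (- U1) (sqrt 2 \<cdot>\<^sub>m U2))))"

(* The eigenvalue of aug_mat belonging to column j of aug_eigvecs. *)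
definition aug_eigval :: "nat \<Rightarrow> (nat \<Rightarrow> real) \<Rightarrow> nat \<Rightarrow> real" where
  "aug_eigval n s j = (if j < n then s j else if j < 2 * n then - s (j - n) else 0)"

definition spectral_projector ::
  "nat \<Rightarrow> nat \<Rightarrow> real mat \<Rightarrow> (nat \<Rightarrow> real) \<Rightarrow> real mat \<Rightarrow> real \<Rightarrow> real \<Rightarrow> real mat" where
  "spectral_projector m n U s V a b =
     (let Q = aug_eigvecs m n U V;
          Qin = sel_cols Q (filter (\<lambda>j. a < aug_eigval n s j \<and> aug_eigval n s j < b) [0..<n + m]);
          Qab = sel_cols Q (filter (\<lambda>j. aug_eigval n s j = a \<or> aug_eigval n s j = b) [0..<n + m])
      in Qin * transpose_mat Qin + (1 / 2) \<cdot>\<^sub>m (Qab * transpose_mat Qab))"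

section \<open>The Chebyshev--Jackson filter\<close>

fun cheb_poly :: "nat \<Rightarrow> real poly" where
  "cheb_poly 0 = 1"
| "cheb_poly (Suc 0) = [:0, 1:]"
| "cheb_poly (Suc (Suc j)) = [:0, 2:] * cheb_poly (Suc j) - cheb_poly j"

(* x and y stand for l(a) and l(b). *)
definition step_coeff :: "real \<Rightarrow> real \<Rightarrow> nat \<Rightarrow> real" where
  "step_coeff x y j =
     (if j = 0 then (1 / pi) * (arccos x - arccos y)
      else (2 / pi) * ((sin (real j * arccos x) - sin (real j * arccos y)) / real j))"

definition jackson_factor :: "nat \<Rightarrow> nat \<Rightarrow> real" where
  "jackson_factor d j =
     ((real d + 2 - real j) * sin (pi / (real d + 2)) * cos (real j * pi / (real d + 2))
        + cos (pi / (real d + 2)) * sin (real j * pi / (real d + 2)))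
     / ((real d + 2) * sin (pi / (real d + 2)))"

definition filter_poly :: "nat \<Rightarrow> real \<Rightarrow> real \<Rightarrow> real poly" where
  "filter_poly d x y =
     (\<Sum>j\<le>d. Polynomial.smult (jackson_factor d j * step_coeff x y j) (cheb_poly j))"

(* The value of a polynomial at a square matrix. The sum is formed entrywise because
   the type of matrices of all dimensions is not an additive monoid. *)
definition mat_poly_eval :: "real poly \<Rightarrow> real mat \<Rightarrow> real mat" where
  "mat_poly_eval f M = mat (dim_row M) (dim_row M)
     (\<lambda>(i, j). \<Sum>l\<le>Polynomial.degree f. Polynomial.coeff f l * (M ^\<^sub>m l) $$ (i, j))"

section \<open>Ritz approximations\<close>

definition ritz_approx ::
  "nat \<Rightarrow> real mat \<Rightarrow> real mat \<Rightarrow> real mat \<Rightarrow>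
     (nat \<Rightarrow> real) \<Rightarrow> (nat \<Rightarrow> real vec) \<Rightarrow> (nat \<Rightarrow> real vec) \<Rightarrow> bool" where
  "ritz_approx p A Q1 Q2 st ut vt \<longleftrightarrow>
     (\<exists>Ub Vb. is_svd p p (transpose_mat Q2 * A * Q1) Ub st Vb \<and>
        (\<forall>i<p. ut i = Q2 *\<^sub>v (Ub *\<^sub>v unit_vec p i) \<and> vt i = Q1 *\<^sub>v (Vb *\<^sub>v unit_vec p i)))"

definition same_order :: "nat \<Rightarrow> (nat \<Rightarrow> real) \<Rightarrow> (nat \<Rightarrow> real) \<Rightarrow> bool" where
  "same_order p x y \<longleftrightarrow>
     (\<exists>\<tau>. \<tau> permutes {..<p} \<and>
        (\<forall>i j. i < j \<and> j < p \<longrightarrow> x (\<tau> j) \<le> x (\<tau> i) \<and> y (\<tau> j) \<le> y (\<tau> i)))"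

end

theory Submission
  imports Defs "HOL-Analysis.L2_Norm"
begin

text \<open>
  The matrix \<open>P\<close> is a polynomial in the augmented matrix and therefore has the orthonormal eigenvectors
  \<open>q\<^sub>i\<close> built from the singular vectors of \<open>A\<close> (\<open>aug_mat_eigenvector\<close>, \<open>mat_poly_eval_eigenvector\<close>). In the
  basis \<open>[Qp, Qperp]\<close> a step of the iteration multiplies the two coordinate blocks \<open>X\<close>, \<open>Y\<close> of the
  current subspace by the two diagonal blocks of eigenvalues, while the QR decomposition only changes the
  basis of the subspace. So the slope \<open>E = Y X\<^sup>-\<^sup>1\<close>, which determines the subspace, is multiplied from the left
  by the small eigenvalues and from the right by the reciprocals of the large ones
  (\<open>subspace_iteration_slope\<close>). Its norm decays like the \<open>k\<close>-th power of the ratio at the gap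
  (\<open>slope_norm_le\<close>).

  A subspace with slope \<open>E\<close> consists of the vectors \<open>Qp x + Qperp E x\<close>. Normalizing the basis
  \<open>Qp + Qperp E\<close> requires the inverse square root of its Gram matrix \<open>M = 1 + E\<^sup>T E\<close>, and any orthonormal
  basis differs from the normalized one by an orthogonal matrix (\<open>slope_representation\<close>). The slope is a
  tangent and the distance of the subspaces the corresponding sine (\<open>slope_subspace_dist\<close>). The existence of the
  square root comes from a contracting iteration (\<open>pos_def_sqrt_exists\<close>), its uniqueness from a
  trace argument (\<open>psd_sqrt_unique\<close>).

  Every distance is reduced to a residual in one direction: for subspaces of equal dimension, a bound for the
  residuals of the vectors of one subspace with respect to the other one already bounds the norm of the
  difference of the projectors (\<open>subspace_dist_le\<close>). The two blocks of the vectors \<open>q\<^sub>i\<close> are the right and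
  the left singular vectors divided by \<open>\<surd>2\<close>, so residuals of \<open>Qp\<close> project to residuals of \<open>Vp\<close> and of \<open>Up\<close>, at the
  cost of the factor \<open>\<surd>2\<close> (\<open>block_subspace_dist\<close>).

  Finally, singular values are stationary: if both singular subspaces are perturbed by \<open>\<delta>\<close>, the compressed
  matrix changes only by terms of order \<open>\<delta>\<^sup>2\<close>, because \<open>A\<close> maps the complement of the right singular
  subspace to the complement of the left one (\<open>ritz_matrix_decomposition\<close>). A min-max comparison of the
  ordered singular values turns this into a bound \<open>2 \<parallel>A\<parallel> \<delta>\<^sup>2\<close> (\<open>ritz_value_error\<close>), which is
  \<open>4 \<parallel>A\<parallel> \<epsilon>\<^sup>2\<close> for \<open>\<delta> = \<surd>2 \<epsilon>\<close>.
\<close>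

section \<open>The Euclidean norm and the operator norm\<close>

lemma vec2_norm_L2_set: "vec2_norm v = L2_set (\<lambda>i. v $ i) {0..<dim_vec v}"
  by (simp add: vec2_norm_def L2_set_def scalar_prod_def power2_eq_square)

lemma vec2_norm_ge_0 [simp]: "0 \<le> vec2_norm v"
  by (simp add: vec2_norm_L2_set)

lemma scalar_prod_self_ge_0: "0 \<le> (v :: real vec) \<bullet> v"
  by (simp add: scalar_prod_def sum_nonneg)

lemma vec2_norm_square: "(vec2_norm v)\<^sup>2 = v \<bullet> v"
  by (simp add: vec2_norm_def scalar_prod_self_ge_0)

lemma vec2_norm_zero [simp]: "vec2_norm (0\<^sub>v n) = 0"
  by (simp add: vec2_norm_def)

lemma vec2_norm_eq_0_iff: "v \<in> carrier_vec n \<Longrightarrow> vec2_norm v = 0 \<longleftrightarrow> v = 0\<^sub>v n"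
  by (auto simp: vec2_norm_L2_set L2_set_eq_0_iff)

lemma vec2_norm_smult [simp]: "vec2_norm (c \<cdot>\<^sub>v v) = \<bar>c\<bar> * vec2_norm v"
  by (simp add: vec2_norm_def real_sqrt_mult flip: mult.assoc power2_eq_square)

lemma vec2_norm_triangle:
  assumes "v \<in> carrier_vec n" "w \<in> carrier_vec n"
  shows "vec2_norm (v + w) \<le> vec2_norm v + vec2_norm w"
  using assms L2_set_triangle_ineq[of "\<lambda>i. v $ i" "\<lambda>i. w $ i" "{0..<n}"]
  by (simp add: vec2_norm_L2_set L2_set_def)

lemma vec2_norm_minus_commute:
  assumes "v \<in> carrier_vec n" "w \<in> carrier_vec n"
  shows "vec2_norm (v - w) = vec2_norm (w - v)"
  using assms by (simp add: vec2_norm_L2_set L2_set_def power2_commute)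

lemma vec2_norm_triangle_minus:
  assumes "v \<in> carrier_vec n" "w \<in> carrier_vec n"
  shows "vec2_norm v \<le> vec2_norm (v - w) + vec2_norm w"
proof -
  have "v = (v - w) + w" using assms by auto
  thus ?thesis using vec2_norm_triangle[of "v - w" n w] assms by simp
qed

lemma scalar_prod_le_vec2_norm:
  assumes "v \<in> carrier_vec n" "w \<in> carrier_vec n"
  shows "\<bar>v \<bullet> w\<bar> \<le> vec2_norm v * vec2_norm w"
proof -
  have "\<bar>v \<bullet> w\<bar> \<le> (\<Sum>i\<in>{0..<n}. \<bar>v $ i\<bar> * \<bar>w $ i\<bar>)"
    using assms by (auto simp: scalar_prod_def abs_mult intro: order_trans[OF sum_abs])
  also have "\<dots> \<le> L2_set (\<lambda>i. v $ i) {0..<n} * L2_set (\<lambda>i. w $ i) {0..<n}"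
    by (rule L2_set_mult_ineq)
  finally show ?thesis using assms by (simp add: vec2_norm_L2_set)
qed

lemma abs_index_le_vec2_norm:
  assumes "i < dim_vec v"
  shows "\<bar>v $ i\<bar> \<le> vec2_norm v"
  using member_le_L2_set[of "{0..<dim_vec v}" i "\<lambda>i. \<bar>v $ i\<bar>"] assms
  by (simp add: vec2_norm_L2_set L2_set_def)

text \<open>Bounds obtained from the Cauchy--Schwarz inequality for a vector of the form \<open>v = B\<^sup>T w\<close> come out in
  this self-referential form.\<close>

lemma vec2_norm_le_of_square_le:
  assumes "(vec2_norm v)\<^sup>2 \<le> c * vec2_norm v" "0 \<le> c"
  shows "vec2_norm v \<le> c"
proof (cases "vec2_norm v = 0")
  case False
  hence "0 < vec2_norm v" using vec2_norm_ge_0[of v] by linarith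
  thus ?thesis using assms(1) by (simp add: power2_eq_square)
qed (use assms in simp)

lemma vec2_norm_square_minus:
  assumes "v \<in> carrier_vec n" "w \<in> carrier_vec n"
  shows "(vec2_norm (v - w))\<^sup>2 = (vec2_norm v)\<^sup>2 - 2 * (v \<bullet> w) + (vec2_norm w)\<^sup>2"
  using assms comm_scalar_prod[of v n w]
  by (simp add: vec2_norm_square minus_scalar_prod_distrib[of _ n] scalar_prod_minus_distrib[of _ n])

text \<open>The sum of the row norms is a crude bound. It makes the supremum in \<open>mat2_norm\<close> a supremum of a
  bounded set; otherwise that supremum would be an arbitrary number.\<close>

lemma mult_mat_vec_bounded:
  fixes B :: "real mat"
  assumes "B \<in> carrier_mat nr nc"
  obtains C where "0 \<le> C" "\<And>v. v \<in> carrier_vec nc \<Longrightarrow> vec2_norm (B *\<^sub>v v) \<le> C * vec2_norm v"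
proof
  let ?C = "\<Sum>i\<in>{0..<nr}. vec2_norm (row B i)"
  show "0 \<le> ?C" by (simp add: sum_nonneg)
  fix v :: "real vec" assume v: "v \<in> carrier_vec nc"
  have "vec2_norm (B *\<^sub>v v) \<le> (\<Sum>i\<in>{0..<nr}. \<bar>row B i \<bullet> v\<bar>)"
    using assms L2_set_le_sum_abs[of "\<lambda>i. row B i \<bullet> v" "{0..<nr}"]
    by (simp add: vec2_norm_L2_set L2_set_def)
  also have "\<dots> \<le> (\<Sum>i\<in>{0..<nr}. vec2_norm (row B i) * vec2_norm v)"
    using assms v by (intro sum_mono scalar_prod_le_vec2_norm[of _ nc]) auto
  finally show "vec2_norm (B *\<^sub>v v) \<le> ?C * vec2_norm v" by (simp add: sum_distrib_right)
qed

lemma mat2_norm_bdd: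
  fixes B :: "real mat"
  shows "bdd_above ((\<lambda>v. vec2_norm (B *\<^sub>v v)) ` {v \<in> carrier_vec (dim_col B). vec2_norm v \<le> 1})"
proof -
  obtain C where C: "0 \<le> C"
    "\<And>v. v \<in> carrier_vec (dim_col B) \<Longrightarrow> vec2_norm (B *\<^sub>v v) \<le> C * vec2_norm v"
    using mult_mat_vec_bounded[of B "dim_row B" "dim_col B"] by auto
  show ?thesis
  proof (rule bdd_aboveI2)
    fix v :: "real vec" assume "v \<in> {v \<in> carrier_vec (dim_col B). vec2_norm v \<le> 1}"
    thus "vec2_norm (B *\<^sub>v v) \<le> C"
      using C(2)[of v] mult_left_mono[of "vec2_norm v" 1 C] C(1) by auto
  qed
qed

lemma mat2_norm_upper:
  assumes "B \<in> carrier_mat nr nc" "v \<in> carrier_vec nc"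
  shows "vec2_norm (B *\<^sub>v v) \<le> mat2_norm B * vec2_norm v"
proof (cases "vec2_norm v = 0")
  case True
  hence "v = 0\<^sub>v nc" using assms vec2_norm_eq_0_iff by blast
  hence "B *\<^sub>v v = 0\<^sub>v nr" using assms by (auto intro!: eq_vecI)
  thus ?thesis using True by simp
next
  case False
  hence pos: "0 < vec2_norm v" using vec2_norm_ge_0[of v] by linarith
  let ?w = "(1 / vec2_norm v) \<cdot>\<^sub>v v"
  have "vec2_norm (B *\<^sub>v ?w) \<le> mat2_norm B"
    unfolding mat2_norm_def using assms pos by (intro cSUP_upper mat2_norm_bdd) auto
  moreover have "B *\<^sub>v ?w = (1 / vec2_norm v) \<cdot>\<^sub>v (B *\<^sub>v v)"
    using assms by (intro mult_mat_vec) auto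
  ultimately show ?thesis using pos by (simp add: field_simps)
qed

lemma mat2_norm_ge_0: "0 \<le> mat2_norm B"
proof -
  have "vec2_norm (B *\<^sub>v 0\<^sub>v (dim_col B)) \<le> mat2_norm B"
    unfolding mat2_norm_def by (intro cSUP_upper mat2_norm_bdd) auto
  thus ?thesis using vec2_norm_ge_0 order_trans by blast
qed

lemma mat2_norm_least:
  assumes "B \<in> carrier_mat nr nc" "0 \<le> c"
    "\<And>v. v \<in> carrier_vec nc \<Longrightarrow> vec2_norm (B *\<^sub>v v) \<le> c * vec2_norm v"
  shows "mat2_norm B \<le> c"
  unfolding mat2_norm_def
proof (rule cSUP_least)
  show "{v \<in> carrier_vec (dim_col B). vec2_norm v \<le> 1} \<noteq> {}"
    using zero_carrier_vec[of "dim_col B"] vec2_norm_zero[of "dim_col B"] by fastforce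
  fix v :: "real vec" assume "v \<in> {v \<in> carrier_vec (dim_col B). vec2_norm v \<le> 1}"
  thus "vec2_norm (B *\<^sub>v v) \<le> c"
    using assms(3)[of v] mult_left_mono[of "vec2_norm v" 1 c] assms(1,2) by auto
qed

lemma scalar_prod_transpose:
  fixes B :: "real mat"
  assumes "B \<in> carrier_mat nr nc" "x \<in> carrier_vec nc" "y \<in> carrier_vec nr"
  shows "(B\<^sup>T *\<^sub>v y) \<bullet> x = y \<bullet> (B *\<^sub>v x)" "x \<bullet> (B\<^sup>T *\<^sub>v y) = (B *\<^sub>v x) \<bullet> y"
  using transpose_vec_mult_scalar[OF assms] assms
    comm_scalar_prod[of x nc "B\<^sup>T *\<^sub>v y"] comm_scalar_prod[of "B *\<^sub>v x" nr y] by auto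

section \<open>Orthonormal columns and orthogonal projectors\<close>

lemma orthonormal_colsD:
  assumes "orthonormal_cols N p X"
  shows "X \<in> carrier_mat N p" "X\<^sup>T * X = 1\<^sub>m p" "X\<^sup>T \<in> carrier_mat p N"
  using assms by (auto simp: orthonormal_cols_def)

lemma orthonormal_transpose_mult_vec:
  assumes "orthonormal_cols N p X" "v \<in> carrier_vec p"
  shows "X\<^sup>T *\<^sub>v (X *\<^sub>v v) = v"
  using orthonormal_colsD[OF assms(1)] assms(2)
  by (metis assoc_mult_mat_vec one_mult_mat_vec)

lemma vec2_norm_orthonormal:
  assumes "orthonormal_cols N p X" "v \<in> carrier_vec p"
  shows "vec2_norm (X *\<^sub>v v) = vec2_norm v"
  using scalar_prod_transpose(1)[OF orthonormal_colsD(1)[OF assms(1)] assms(2), of "X *\<^sub>v v"]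
    orthonormal_transpose_mult_vec[OF assms] orthonormal_colsD[OF assms(1)] assms
  by (simp add: vec2_norm_def)

text \<open>Orthonormal columns make \<open>X X\<^sup>T\<close> the orthogonal projector onto the column space, so a vector is the
  hypotenuse over its projection and its residual. All distances below are measured by such residuals.\<close>

lemma orthonormal_pythagoras:
  assumes X: "orthonormal_cols N p X" and v: "v \<in> carrier_vec N"
  shows "(vec2_norm (v - X *\<^sub>v (X\<^sup>T *\<^sub>v v)))\<^sup>2 = (vec2_norm v)\<^sup>2 - (vec2_norm (X\<^sup>T *\<^sub>v v))\<^sup>2"
proof -
  note XD = orthonormal_colsD[OF X]
  let ?w = "X\<^sup>T *\<^sub>v v"
  have w: "?w \<in> carrier_vec p" using XD v by auto
  have "v \<bullet> (X *\<^sub>v ?w) = ?w \<bullet> ?w" using scalar_prod_transpose(1)[OF XD(1) w v] by simp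
  thus ?thesis
    using vec2_norm_square_minus[of v N "X *\<^sub>v ?w"] v XD w vec2_norm_orthonormal[OF X w]
    by (simp add: vec2_norm_square)
qed

lemma vec2_norm_transpose_orthonormal_le:
  assumes X: "orthonormal_cols N p X" and v: "v \<in> carrier_vec N"
  shows "vec2_norm (X\<^sup>T *\<^sub>v v) \<le> vec2_norm v"
proof (rule power2_le_imp_le)
  show "(vec2_norm (X\<^sup>T *\<^sub>v v))\<^sup>2 \<le> (vec2_norm v)\<^sup>2"
    using orthonormal_pythagoras[OF X v] zero_le_power2[of "vec2_norm (v - X *\<^sub>v (X\<^sup>T *\<^sub>v v))"]
    by linarith
qed simp

lemma mult_mat_unit_vec:
  fixes B :: "real mat"
  assumes "B \<in> carrier_mat nr nc" "i < nc"
  shows "B *\<^sub>v unit_vec nc i = col B i"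
  using assms by (intro eq_vecI) auto

lemma column_space_eq:
  assumes "X \<in> carrier_mat N p"
  shows "column_space X = (\<lambda>v. X *\<^sub>v v) ` carrier_vec p"
proof -
  have dims: "dim_row X = N" "dim_col X = p" using assms by auto
  have "column_space X = {y \<in> carrier_vec N. \<exists>x\<in>carrier_vec p. X *\<^sub>v x = y}"
    using vec_space.col_space_eq[OF assms] unfolding column_space_def dims .
  moreover have "X *\<^sub>v x \<in> carrier_vec N" if "x \<in> carrier_vec p" for x
    using assms that by simp
  ultimately show ?thesis by (fastforce simp: image_iff)
qed

text \<open>A projector absorbs from the left every matrix whose range lies in its own range. Two symmetric
  projectors \<open>Y\<close>, \<open>P\<close> with equal range thus satisfy \<open>Y P = P\<close> and \<open>P Y = Y\<close>; transposing one of the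
  equations identifies them, which is the uniqueness behind the description operator.\<close>

lemma orth_projector_column_space:
  assumes X: "orthonormal_cols N p X"
  shows "orth_projector N (column_space X) = X * X\<^sup>T"
proof -
  note XD = orthonormal_colsD[OF X]
  let ?P = "X * X\<^sup>T"
  have P: "?P \<in> carrier_mat N N" using XD by auto
  have idem: "?P * ?P = ?P"
  proof -
    have "?P * ?P = X * (X\<^sup>T * X) * X\<^sup>T" using XD(1,3)
      by (smt (verit) assoc_mult_mat mult_carrier_mat)
    thus ?thesis using XD by simp
  qed
  have sym: "?P\<^sup>T = ?P" using XD by (simp add: transpose_mult[of _ N p])
  have range: "(\<lambda>v. ?P *\<^sub>v v) ` carrier_vec N = column_space X"
  proof (intro equalityI subsetI)
    fix y assume "y \<in> (\<lambda>v. ?P *\<^sub>v v) ` carrier_vec N"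
    then obtain v where v: "v \<in> carrier_vec N" "y = ?P *\<^sub>v v" by auto
    hence "y = X *\<^sub>v (X\<^sup>T *\<^sub>v v)" using XD by simp
    thus "y \<in> column_space X" unfolding column_space_eq[OF XD(1)] using XD v by auto
  next
    fix y assume "y \<in> column_space X"
    then obtain w where w: "w \<in> carrier_vec p" "y = X *\<^sub>v w"
      unfolding column_space_eq[OF XD(1)] by auto
    hence "?P *\<^sub>v y = y" using XD orthonormal_transpose_mult_vec[OF X, of w] by simp
    thus "y \<in> (\<lambda>v. ?P *\<^sub>v v) ` carrier_vec N" using w XD by (metis imageI mult_mat_vec_carrier)
  qed
  show ?thesis unfolding orth_projector_def
  proof (rule the_equality)
    show "?P \<in> carrier_mat N N \<and> ?P * ?P = ?P \<and> ?P\<^sup>T = ?P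
        \<and> (\<lambda>v. ?P *\<^sub>v v) ` carrier_vec N = column_space X"
      using P idem sym range by blast
  next
    fix Y assume Y: "Y \<in> carrier_mat N N \<and> Y * Y = Y \<and> Y\<^sup>T = Y
        \<and> (\<lambda>v. Y *\<^sub>v v) ` carrier_vec N = column_space X"
    have absorb: "B * C = C" if B: "B \<in> carrier_mat N N" "B * B = B" and C: "C \<in> carrier_mat N N"
      and sub: "(\<lambda>v. C *\<^sub>v v) ` carrier_vec N \<subseteq> (\<lambda>v. B *\<^sub>v v) ` carrier_vec N" for B C :: "real mat"
    proof (rule mat_col_eqI)
      fix i assume "i < dim_col C"
      hence i: "i < N" using C by auto
      have "col C i = C *\<^sub>v unit_vec N i" using mult_mat_unit_vec[OF C i] by simp
      then obtain v where v: "v \<in> carrier_vec N" "col C i = B *\<^sub>v v" using sub by force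
      have "col (B * C) i = B *\<^sub>v (B *\<^sub>v v)" using col_mult2[OF B(1) C i] v(2) by simp
      also have "\<dots> = (B * B) *\<^sub>v v" using B(1) v(1) by simp
      finally show "col (B * C) i = col C i" using v B by simp
    qed (use B C in auto)
    have "Y * ?P = ?P" by (rule absorb) (use Y P range in blast)+
    moreover have "?P * Y = Y" by (rule absorb) (use Y P idem range in blast)+
    moreover have "(Y * ?P)\<^sup>T = ?P * Y" using Y P sym by (simp add: transpose_mult[of _ N N])
    ultimately show "Y = ?P" using sym by simp
  qed
qed

section \<open>Inverses\<close>

lemma mat_inv_eqI:
  assumes G: "G \<in> carrier_mat n n" and H: "H \<in> carrier_mat n n" and GH: "G * H = 1\<^sub>m n"
  shows "mat_inv G = H"
proof -
  have HG: "H * G = 1\<^sub>m n" by (rule mat_mult_left_right_inverse[OF G H GH])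
  show ?thesis
  proof (cases "mat_inverse G")
    case None
    have "G \<in> Units (ring_mat TYPE(real) n ())"
      using G H GH HG by (auto simp: Units_def ring_mat_def)
    thus ?thesis using mat_inverse(1)[OF G None, of "()"] by blast
  next
    case (Some B)
    from mat_inverse(2)[OF G this] have B: "B * G = 1\<^sub>m n" "B \<in> carrier_mat n n" by auto
    have "B = B * (G * H)" using B(2) by (simp add: GH)
    also have "\<dots> = (B * G) * H" using assoc_mult_mat[OF B(2) G H] by simp
    also have "\<dots> = H" using H by (simp add: B(1))
    finally show ?thesis by (simp add: mat_inv_def Some)
  qed
qed

lemma mat_inv_invertible:
  assumes "invertible_mat G" "G \<in> carrier_mat n n"
  shows "mat_inv G \<in> carrier_mat n n" "G * mat_inv G = 1\<^sub>m n"
proof -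
  obtain H where H: "G * H = 1\<^sub>m n" "H * G = 1\<^sub>m (dim_row H)"
    using assms by (auto simp: invertible_mat_def inverts_mat_def)
  have "dim_col H = n" using arg_cong[OF H(1), of dim_col] by simp
  moreover have "dim_row H = n" using arg_cong[OF H(2), of dim_col] assms(2) by simp
  ultimately have "H \<in> carrier_mat n n" by auto
  thus "mat_inv G \<in> carrier_mat n n" "G * mat_inv G = 1\<^sub>m n"
    using mat_inv_eqI[OF assms(2) _ H(1)] H by simp_all
qed

lemma injective_square_mat_inverse:
  fixes G :: "real mat"
  assumes G: "G \<in> carrier_mat n n"
    and inj: "\<And>v. v \<in> carrier_vec n \<Longrightarrow> G *\<^sub>v v = 0\<^sub>v n \<Longrightarrow> v = 0\<^sub>v n"
  obtains H where "H \<in> carrier_mat n n" "G * H = 1\<^sub>m n" "H * G = 1\<^sub>m n"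
proof -
  have "det G \<noteq> 0" using det_0_iff_vec_prod_zero_field[OF G] inj by auto
  from det_non_zero_imp_unit[OF G this, of "()"] show ?thesis
    using that by (auto simp: Units_def ring_mat_def)
qed

section \<open>The distance of two column spaces\<close>

text \<open>The constant \<open>c\<close> bounds the squared smallest singular value from below. It is shared by \<open>G\<close> and its
  transpose because \<open>G\<close>, being square and injective, is invertible. This is where the equal dimension of two
  subspaces enters when their distance is compared with a one-sided residual.\<close>

lemma transpose_lower_bound:
  fixes G :: "real mat"
  assumes G: "G \<in> carrier_mat n n" and c: "0 < c"
    and low: "\<And>z. z \<in> carrier_vec n \<Longrightarrow> c * (vec2_norm z)\<^sup>2 \<le> (vec2_norm (G *\<^sub>v z))\<^sup>2"
    and w: "w \<in> carrier_vec n"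
  shows "c * (vec2_norm w)\<^sup>2 \<le> (vec2_norm (G\<^sup>T *\<^sub>v w))\<^sup>2"
proof -
  have "v = 0\<^sub>v n" if v: "v \<in> carrier_vec n" "G *\<^sub>v v = 0\<^sub>v n" for v
  proof -
    have "c * (vec2_norm v)\<^sup>2 \<le> 0" using low[OF v(1)] v(2) by simp
    hence "vec2_norm v = 0" using c by (simp add: mult_le_0_iff not_le)
    thus ?thesis using vec2_norm_eq_0_iff[OF v(1)] by simp
  qed
  then obtain H where H: "H \<in> carrier_mat n n" "G * H = 1\<^sub>m n"
    using injective_square_mat_inverse[OF G] by blast
  define z where "z = H *\<^sub>v w"
  have z: "z \<in> carrier_vec n" "G *\<^sub>v z = w" using H G w by (auto simp: z_def simp flip: assoc_mult_mat_vec)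
  let ?u = "G\<^sup>T *\<^sub>v w"
  have u: "?u \<in> carrier_vec n" using G w by auto
  have "(vec2_norm w)\<^sup>2 = z \<bullet> ?u"
    using scalar_prod_transpose(2)[OF G z(1) w] z(2) by (simp add: vec2_norm_square)
  also have "\<dots> \<le> vec2_norm z * vec2_norm ?u" using scalar_prod_le_vec2_norm[OF z(1) u] by simp
  finally have "((vec2_norm w)\<^sup>2)\<^sup>2 \<le> (vec2_norm z * vec2_norm ?u)\<^sup>2" by (intro power_mono) auto
  hence "c * ((vec2_norm w)\<^sup>2)\<^sup>2 \<le> (c * (vec2_norm z)\<^sup>2) * (vec2_norm ?u)\<^sup>2"
    using c by (simp add: power_mult_distrib mult.assoc)
  also have "\<dots> \<le> (vec2_norm w)\<^sup>2 * (vec2_norm ?u)\<^sup>2"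
    using low[OF z(1)] z(2) by (intro mult_right_mono) auto
  finally have "(vec2_norm w)\<^sup>2 * (c * (vec2_norm w)\<^sup>2) \<le> (vec2_norm w)\<^sup>2 * (vec2_norm ?u)\<^sup>2"
    by (simp add: power2_eq_square ac_simps)
  thus ?thesis by (cases "vec2_norm w = 0") simp_all
qed

text \<open>By the Pythagorean identity the two residuals are \<open>\<parallel>z\<parallel>\<^sup>2 - \<parallel>G z\<parallel>\<^sup>2\<close> and \<open>\<parallel>w\<parallel>\<^sup>2 - \<parallel>G\<^sup>T w\<parallel>\<^sup>2\<close> with
  \<open>G = X\<^sup>T Y\<close>. For \<open>\<delta> \<ge> 1\<close> there is nothing to prove, and for \<open>\<delta> < 1\<close> the matrix \<open>G\<close> is bounded below.\<close>

lemma orthonormal_residual_symmetric: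
  assumes X: "orthonormal_cols N p X" and Y: "orthonormal_cols N p Y" and d: "0 \<le> \<delta>"
    and res: "\<And>z. z \<in> carrier_vec p \<Longrightarrow>
      vec2_norm (Y *\<^sub>v z - X *\<^sub>v (X\<^sup>T *\<^sub>v (Y *\<^sub>v z))) \<le> \<delta> * vec2_norm z"
    and w: "w \<in> carrier_vec p"
  shows "vec2_norm (X *\<^sub>v w - Y *\<^sub>v (Y\<^sup>T *\<^sub>v (X *\<^sub>v w))) \<le> \<delta> * vec2_norm w"
proof (rule power2_le_imp_le)
  note XD = orthonormal_colsD[OF X] and YD = orthonormal_colsD[OF Y]
  have Xw: "X *\<^sub>v w \<in> carrier_vec N" using XD w by auto
  have eq: "(vec2_norm (X *\<^sub>v w - Y *\<^sub>v (Y\<^sup>T *\<^sub>v (X *\<^sub>v w))))\<^sup>2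
      = (vec2_norm w)\<^sup>2 - (vec2_norm (Y\<^sup>T *\<^sub>v (X *\<^sub>v w)))\<^sup>2"
    using orthonormal_pythagoras[OF Y Xw] vec2_norm_orthonormal[OF X w] by simp
  have "(1 - \<delta>\<^sup>2) * (vec2_norm w)\<^sup>2 \<le> (vec2_norm (Y\<^sup>T *\<^sub>v (X *\<^sub>v w)))\<^sup>2"
  proof (cases "\<delta> < 1")
    case False
    hence "1 - \<delta>\<^sup>2 \<le> 0" by simp
    thus ?thesis by (meson mult_nonpos_nonneg order_trans zero_le_power2)
  next
    case True
    \<comment> \<open>the cosines of the angles between the two subspaces are the singular values of \<open>G\<close>\<close>
    let ?G = "X\<^sup>T * Y"
    have G: "?G \<in> carrier_mat p p" using XD YD by auto
    have GT: "?G\<^sup>T *\<^sub>v w = Y\<^sup>T *\<^sub>v (X *\<^sub>v w)"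
      using XD YD w by (simp add: transpose_mult[of _ p N])
    have "(1 - \<delta>\<^sup>2) * (vec2_norm z)\<^sup>2 \<le> (vec2_norm (?G *\<^sub>v z))\<^sup>2" if z: "z \<in> carrier_vec p" for z
    proof -
      have Yz: "Y *\<^sub>v z \<in> carrier_vec N" using YD z by auto
      have "(vec2_norm z)\<^sup>2 - (vec2_norm (X\<^sup>T *\<^sub>v (Y *\<^sub>v z)))\<^sup>2 \<le> (\<delta> * vec2_norm z)\<^sup>2"
        using power_mono[OF res[OF z], of 2] orthonormal_pythagoras[OF X Yz]
          vec2_norm_orthonormal[OF Y z] by simp
      moreover have "?G *\<^sub>v z = X\<^sup>T *\<^sub>v (Y *\<^sub>v z)" using XD YD z by simp
      ultimately show ?thesis by (simp add: algebra_simps power_mult_distrib)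
    qed
    moreover have "0 < 1 - \<delta>\<^sup>2" using True d by (simp add: power_less_one_iff abs_square_less_1)
    ultimately show ?thesis using transpose_lower_bound[OF G _ _ w] GT by metis
  qed
  thus "(vec2_norm (X *\<^sub>v w - Y *\<^sub>v (Y\<^sup>T *\<^sub>v (X *\<^sub>v w))))\<^sup>2 \<le> (\<delta> * vec2_norm w)\<^sup>2"
    unfolding eq by (simp add: algebra_simps power_mult_distrib)
qed (use d in simp)

lemma subspace_dist_orthonormal:
  assumes "orthonormal_cols N p X" "orthonormal_cols N q Y"
  shows "subspace_dist N (column_space Y) (column_space X) = mat2_norm (Y * Y\<^sup>T - X * X\<^sup>T)"
  using assms by (simp add: subspace_dist_def orth_projector_column_space)

lemma projector_diff_mult_vec:
  assumes X: "orthonormal_cols N p X" and Y: "orthonormal_cols N q Y" and v: "v \<in> carrier_vec N"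
  shows "(Y * Y\<^sup>T - X * X\<^sup>T) *\<^sub>v v = Y *\<^sub>v (Y\<^sup>T *\<^sub>v v) - X *\<^sub>v (X\<^sup>T *\<^sub>v v)"
proof -
  note XD = orthonormal_colsD[OF X] and YD = orthonormal_colsD[OF Y]
  have "(Y * Y\<^sup>T - X * X\<^sup>T) *\<^sub>v v = (Y * Y\<^sup>T) *\<^sub>v v - (X * X\<^sup>T) *\<^sub>v v"
    using XD YD v by (intro minus_mult_distrib_mat_vec[of _ N N]) auto
  thus ?thesis using XD YD v by simp
qed

text \<open>The projector difference, applied to a vector of one of the two subspaces, is the residual of that
  vector with respect to the other one.\<close>

lemma residual_le_subspace_dist:
  assumes X: "orthonormal_cols N p X" and Y: "orthonormal_cols N q Y"
  shows "z \<in> carrier_vec q \<Longrightarrow> vec2_norm (Y *\<^sub>v z - X *\<^sub>v (X\<^sup>T *\<^sub>v (Y *\<^sub>v z)))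
      \<le> subspace_dist N (column_space Y) (column_space X) * vec2_norm z"
    and "z \<in> carrier_vec p \<Longrightarrow> vec2_norm (X *\<^sub>v z - Y *\<^sub>v (Y\<^sup>T *\<^sub>v (X *\<^sub>v z)))
      \<le> subspace_dist N (column_space Y) (column_space X) * vec2_norm z"
proof -
  note XD = orthonormal_colsD[OF X] and YD = orthonormal_colsD[OF Y]
  have D: "Y * Y\<^sup>T - X * X\<^sup>T \<in> carrier_mat N N" using XD YD by auto
  { assume z: "z \<in> carrier_vec q"
    have v: "Y *\<^sub>v z \<in> carrier_vec N" using YD z by auto
    show "vec2_norm (Y *\<^sub>v z - X *\<^sub>v (X\<^sup>T *\<^sub>v (Y *\<^sub>v z)))
        \<le> subspace_dist N (column_space Y) (column_space X) * vec2_norm z"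
      using mat2_norm_upper[OF D v] projector_diff_mult_vec[OF X Y v] vec2_norm_orthonormal[OF Y z]
        orthonormal_transpose_mult_vec[OF Y z] subspace_dist_orthonormal[OF X Y] by simp }
  { assume z: "z \<in> carrier_vec p"
    have v: "X *\<^sub>v z \<in> carrier_vec N" using XD z by auto
    have w: "Y *\<^sub>v (Y\<^sup>T *\<^sub>v (X *\<^sub>v z)) \<in> carrier_vec N" using XD YD z by auto
    show "vec2_norm (X *\<^sub>v z - Y *\<^sub>v (Y\<^sup>T *\<^sub>v (X *\<^sub>v z)))
        \<le> subspace_dist N (column_space Y) (column_space X) * vec2_norm z"
      using mat2_norm_upper[OF D v] projector_diff_mult_vec[OF X Y v] vec2_norm_orthonormal[OF X z]
        orthonormal_transpose_mult_vec[OF X z] subspace_dist_orthonormal[OF X Y]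
        vec2_norm_minus_commute[OF v w] by simp }
qed

text \<open>With \<open>v = X x + b\<close>, where \<open>x = X\<^sup>T v\<close>, the difference of the projectors maps \<open>v\<close> to
  \<open>Y Y\<^sup>T b - (X x - Y Y\<^sup>T X x)\<close>. The two terms are orthogonal. The second one is a residual of \<open>X x\<close>. The
  first one is bounded by duality, since \<open>b\<close> sees only the residuals of \<open>Y\<close>. Thus the two-sided
  quantity is controlled by residuals in one direction.\<close>

lemma subspace_dist_le:
  assumes X: "orthonormal_cols N p X" and Y: "orthonormal_cols N p Y" and d: "0 \<le> \<delta>"
    and res: "\<And>z. z \<in> carrier_vec p \<Longrightarrow>
      vec2_norm (Y *\<^sub>v z - X *\<^sub>v (X\<^sup>T *\<^sub>v (Y *\<^sub>v z))) \<le> \<delta> * vec2_norm z"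
  shows "subspace_dist N (column_space Y) (column_space X) \<le> \<delta>"
proof -
  note XD = orthonormal_colsD[OF X] and YD = orthonormal_colsD[OF Y]
  have D: "Y * Y\<^sup>T - X * X\<^sup>T \<in> carrier_mat N N" using XD YD by auto
  have "vec2_norm ((Y * Y\<^sup>T - X * X\<^sup>T) *\<^sub>v v) \<le> \<delta> * vec2_norm v" if v: "v \<in> carrier_vec N" for v
  proof -
    define x where "x = X\<^sup>T *\<^sub>v v"
    define b where "b = v - X *\<^sub>v x"
    define y where "y = Y\<^sup>T *\<^sub>v b"
    define f where "f = X *\<^sub>v x - Y *\<^sub>v (Y\<^sup>T *\<^sub>v (X *\<^sub>v x))"
    have x: "x \<in> carrier_vec p" and Xx: "X *\<^sub>v x \<in> carrier_vec N" using XD v by (auto simp: x_def)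
    have b: "b \<in> carrier_vec N" using v Xx by (auto simp: b_def)
    have y: "y \<in> carrier_vec p" and Yy: "Y *\<^sub>v y \<in> carrier_vec N" using YD b by (auto simp: y_def)
    have f: "f \<in> carrier_vec N" using XD YD x by (auto simp: f_def)
    have v_eq: "v = X *\<^sub>v x + b"
      unfolding b_def using v Xx XD(1) by (intro eq_vecI) (auto simp del: index_mult_mat_vec)
    have Xb: "X\<^sup>T *\<^sub>v b = 0\<^sub>v p"
    proof -
      have "X\<^sup>T *\<^sub>v b = X\<^sup>T *\<^sub>v v - X\<^sup>T *\<^sub>v (X *\<^sub>v x)"
        unfolding b_def using XD v Xx by (intro mult_minus_distrib_mat_vec) auto
      thus ?thesis using orthonormal_transpose_mult_vec[OF X x] x by (simp add: x_def)
    qed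
    have Yv: "Y\<^sup>T *\<^sub>v v = Y\<^sup>T *\<^sub>v (X *\<^sub>v x) + y"
      unfolding y_def by (subst v_eq, rule mult_add_distrib_mat_vec) (use YD Xx b in auto)
    have "(Y * Y\<^sup>T - X * X\<^sup>T) *\<^sub>v v = Y *\<^sub>v (Y\<^sup>T *\<^sub>v v) - X *\<^sub>v x"
      using projector_diff_mult_vec[OF X Y v] by (simp add: x_def)
    also have "Y *\<^sub>v (Y\<^sup>T *\<^sub>v v) = Y *\<^sub>v (Y\<^sup>T *\<^sub>v (X *\<^sub>v x)) + Y *\<^sub>v y"
      unfolding Yv by (rule mult_add_distrib_mat_vec) (use YD Xx y in auto)
    also have "\<dots> - X *\<^sub>v x = Y *\<^sub>v y - f"
    proof -
      have "a1 + a2 - a3 = a2 - (a3 - a1)"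
        if "a1 \<in> carrier_vec N" "a2 \<in> carrier_vec N" "a3 \<in> carrier_vec N" for a1 a2 a3 :: "real vec"
        using that by (intro eq_vecI) auto
      moreover have "Y *\<^sub>v (Y\<^sup>T *\<^sub>v (X *\<^sub>v x)) \<in> carrier_vec N" using YD Xx by auto
      ultimately show ?thesis unfolding f_def using Yy Xx by blast
    qed
    finally have split: "(Y * Y\<^sup>T - X * X\<^sup>T) *\<^sub>v v = Y *\<^sub>v y - f" .
    have Yf: "Y\<^sup>T *\<^sub>v f = 0\<^sub>v p"
    proof -
      have "Y\<^sup>T *\<^sub>v f = Y\<^sup>T *\<^sub>v (X *\<^sub>v x) - Y\<^sup>T *\<^sub>v (Y *\<^sub>v (Y\<^sup>T *\<^sub>v (X *\<^sub>v x)))"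
        unfolding f_def using YD Xx by (intro mult_minus_distrib_mat_vec) auto
      moreover have "Y\<^sup>T *\<^sub>v (X *\<^sub>v x) \<in> carrier_vec p" using YD Xx by auto
      ultimately show ?thesis using orthonormal_transpose_mult_vec[OF Y] by simp
    qed
    have "(Y *\<^sub>v y) \<bullet> f = 0"
      using scalar_prod_transpose(2)[OF YD(1) y f] Yf y by simp
    hence "(vec2_norm ((Y * Y\<^sup>T - X * X\<^sup>T) *\<^sub>v v))\<^sup>2 = (vec2_norm y)\<^sup>2 + (vec2_norm f)\<^sup>2"
      using vec2_norm_square_minus[OF Yy f] vec2_norm_orthonormal[OF Y y] by (simp add: split)
    moreover have "vec2_norm f \<le> \<delta> * vec2_norm x"
      unfolding f_def by (rule orthonormal_residual_symmetric[OF X Y d res x])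
    moreover have "vec2_norm y \<le> \<delta> * vec2_norm b"
    proof (rule vec2_norm_le_of_square_le)
      let ?g = "Y *\<^sub>v y - X *\<^sub>v (X\<^sup>T *\<^sub>v (Y *\<^sub>v y))"
      let ?h = "X\<^sup>T *\<^sub>v (Y *\<^sub>v y)"
      have g: "?g \<in> carrier_vec N" and h: "?h \<in> carrier_vec p" using XD Yy by auto
      have "b \<bullet> (X *\<^sub>v ?h) = 0"
        using scalar_prod_transpose(1)[OF XD(1) h b] Xb h by simp
      moreover have "(vec2_norm y)\<^sup>2 = b \<bullet> (Y *\<^sub>v y)"
        using scalar_prod_transpose(1)[OF YD(1) y b] by (simp add: y_def vec2_norm_square)
      moreover have "b \<bullet> ?g = b \<bullet> (Y *\<^sub>v y) - b \<bullet> (X *\<^sub>v ?h)"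
        using b Yy XD h by (intro scalar_prod_minus_distrib[of _ N]) auto
      ultimately have "(vec2_norm y)\<^sup>2 = b \<bullet> ?g" by simp
      also have "\<dots> \<le> vec2_norm b * vec2_norm ?g" using scalar_prod_le_vec2_norm[OF b g] by simp
      also have "\<dots> \<le> vec2_norm b * (\<delta> * vec2_norm y)" by (intro mult_left_mono res y) simp
      finally show "(vec2_norm y)\<^sup>2 \<le> (\<delta> * vec2_norm b) * vec2_norm y" by (simp add: ac_simps)
    qed (use d in simp)
    ultimately have "(vec2_norm ((Y * Y\<^sup>T - X * X\<^sup>T) *\<^sub>v v))\<^sup>2
        \<le> (\<delta> * vec2_norm b)\<^sup>2 + (\<delta> * vec2_norm x)\<^sup>2"
      using power_mono[of "vec2_norm f" _ 2] power_mono[of "vec2_norm y" _ 2] by fastforce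
    also have "\<dots> = \<delta>\<^sup>2 * ((vec2_norm b)\<^sup>2 + (vec2_norm x)\<^sup>2)"
      by (simp add: power_mult_distrib distrib_left)
    also have "\<dots> = (\<delta> * vec2_norm v)\<^sup>2"
      using orthonormal_pythagoras[OF X v] by (simp add: b_def x_def power_mult_distrib)
    finally show ?thesis by (rule power2_le_imp_le) (use d in simp)
  qed
  thus ?thesis using mat2_norm_least[OF D d] by (simp add: subspace_dist_orthonormal[OF X Y])
qed

section \<open>Algebra of the operator norm\<close>

lemma mat2_norm_mult_le:
  assumes "B \<in> carrier_mat nr n" "C \<in> carrier_mat n nc"
  shows "mat2_norm (B * C) \<le> mat2_norm B * mat2_norm C"
proof (rule mat2_norm_least)
  fix v :: "real vec" assume v: "v \<in> carrier_vec nc"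
  have "vec2_norm ((B * C) *\<^sub>v v) = vec2_norm (B *\<^sub>v (C *\<^sub>v v))" using assms v by simp
  also have "\<dots> \<le> mat2_norm B * vec2_norm (C *\<^sub>v v)"
    using assms v by (intro mat2_norm_upper) auto
  also have "\<dots> \<le> mat2_norm B * (mat2_norm C * vec2_norm v)"
    using assms v by (intro mult_left_mono mat2_norm_upper mat2_norm_ge_0) auto
  finally show "vec2_norm ((B * C) *\<^sub>v v) \<le> mat2_norm B * mat2_norm C * vec2_norm v"
    by (simp add: ac_simps)
qed (use assms mat2_norm_ge_0 in auto)

lemma mat2_norm_add_le:
  assumes "B \<in> carrier_mat nr nc" "C \<in> carrier_mat nr nc"
  shows "mat2_norm (B + C) \<le> mat2_norm B + mat2_norm C"
proof (rule mat2_norm_least)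
  fix v :: "real vec" assume v: "v \<in> carrier_vec nc"
  have "vec2_norm ((B + C) *\<^sub>v v) = vec2_norm (B *\<^sub>v v + C *\<^sub>v v)"
    using assms v by (simp add: add_mult_distrib_mat_vec)
  also have "\<dots> \<le> vec2_norm (B *\<^sub>v v) + vec2_norm (C *\<^sub>v v)"
    using assms v by (intro vec2_norm_triangle[of _ nr]) auto
  also have "\<dots> \<le> mat2_norm B * vec2_norm v + mat2_norm C * vec2_norm v"
    using assms v by (intro add_mono mat2_norm_upper) auto
  finally show "vec2_norm ((B + C) *\<^sub>v v) \<le> (mat2_norm B + mat2_norm C) * vec2_norm v"
    by (simp add: algebra_simps)
qed (use assms mat2_norm_ge_0 in auto)

lemma smult_mat_mult_vec:
  fixes B :: "real mat"
  assumes "B \<in> carrier_mat nr nc" "v \<in> carrier_vec nc"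
  shows "(c \<cdot>\<^sub>m B) *\<^sub>v v = c \<cdot>\<^sub>v (B *\<^sub>v v)"
  using assms by (intro eq_vecI) auto

lemma mat2_norm_smult_le:
  assumes "B \<in> carrier_mat nr nc"
  shows "mat2_norm (c \<cdot>\<^sub>m B) \<le> \<bar>c\<bar> * mat2_norm B"
proof (rule mat2_norm_least)
  fix v :: "real vec" assume v: "v \<in> carrier_vec nc"
  have "vec2_norm ((c \<cdot>\<^sub>m B) *\<^sub>v v) = \<bar>c\<bar> * vec2_norm (B *\<^sub>v v)"
    using smult_mat_mult_vec[OF assms v] by simp
  also have "\<dots> \<le> \<bar>c\<bar> * (mat2_norm B * vec2_norm v)"
    by (intro mult_left_mono mat2_norm_upper[OF assms v]) auto
  finally show "vec2_norm ((c \<cdot>\<^sub>m B) *\<^sub>v v) \<le> \<bar>c\<bar> * mat2_norm B * vec2_norm v"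
    by (simp add: ac_simps)
qed (use assms mat2_norm_ge_0 in auto)

lemma vec2_norm_unit_vec: "i < n \<Longrightarrow> vec2_norm (unit_vec n i) = 1"
  by (simp add: vec2_norm_def)

lemma abs_entry_le_mat2_norm:
  assumes "B \<in> carrier_mat nr nc" "i < nr" "j < nc"
  shows "\<bar>B $$ (i, j)\<bar> \<le> mat2_norm B"
proof -
  have "\<bar>B $$ (i, j)\<bar> = \<bar>(B *\<^sub>v unit_vec nc j) $ i\<bar>"
    using assms mult_mat_unit_vec[OF assms(1,3)] by simp
  also have "\<dots> \<le> vec2_norm (B *\<^sub>v unit_vec nc j)"
    using assms by (intro abs_index_le_vec2_norm) auto
  also have "\<dots> \<le> mat2_norm B"
    using mat2_norm_upper[OF assms(1), of "unit_vec nc j"] assms by (simp add: vec2_norm_unit_vec)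
  finally show ?thesis .
qed

lemma symmetric_mat_entry:
  assumes "M \<in> carrier_mat n n" "M\<^sup>T = M" "i < n" "j < n"
  shows "M $$ (j, i) = M $$ (i, j)"
  using assms by (metis carrier_matD index_transpose_mat(1))

section \<open>The square root of a positive definite matrix\<close>

text \<open>The iteration \<open>Y\<^sub>k\<^sub>+\<^sub>1 = (B + Y\<^sub>k\<^sup>2) / 2\<close> converges if \<open>B\<close> has norm below 1, and its limit \<open>L\<close> satisfies
  \<open>2 L = B + L\<^sup>2\<close>, that is \<open>(1 - L)\<^sup>2 = 1 - B\<close>. This produces square roots without diagonalizing a
  symmetric matrix.\<close>

fun sqrt_iter :: "nat \<Rightarrow> real mat \<Rightarrow> nat \<Rightarrow> real mat" where
  "sqrt_iter n B 0 = 0\<^sub>m n n"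
| "sqrt_iter n B (Suc k) = (1 / 2) \<cdot>\<^sub>m (B + sqrt_iter n B k * sqrt_iter n B k)"

lemma sqrt_iter_carrier [simp]:
  "B \<in> carrier_mat n n \<Longrightarrow> sqrt_iter n B k \<in> carrier_mat n n"
  by (induction k) auto

lemma sqrt_iter_symmetric:
  assumes "B \<in> carrier_mat n n" "B\<^sup>T = B"
  shows "(sqrt_iter n B k)\<^sup>T = sqrt_iter n B k"
proof (induction k)
  case (Suc k)
  let ?Y = "sqrt_iter n B k"
  have Y: "?Y \<in> carrier_mat n n" using assms by simp
  have "((1 / 2) \<cdot>\<^sub>m (B + ?Y * ?Y))\<^sup>T = (1 / 2) \<cdot>\<^sub>m (B + ?Y * ?Y)\<^sup>T" by auto
  also have "(B + ?Y * ?Y)\<^sup>T = B\<^sup>T + ?Y\<^sup>T * ?Y\<^sup>T"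
    using transpose_add[OF assms(1) mult_carrier_mat[OF Y Y]] transpose_mult[OF Y Y] by simp
  finally show ?case using Suc assms by simp
qed simp

text \<open>The bound \<open>y\<close> satisfies \<open>(\<parallel>B\<parallel> + y\<^sup>2) / 2 \<le> y\<close>, so the iterates cannot get past it.\<close>

lemma sqrt_iter_norm_le:
  assumes B: "B \<in> carrier_mat n n" "mat2_norm B \<le> 2 * y - y\<^sup>2" and y: "0 \<le> y"
  shows "mat2_norm (sqrt_iter n B k) \<le> y"
proof (induction k)
  case 0
  have "0\<^sub>m n n *\<^sub>v v = 0\<^sub>v n" if "v \<in> carrier_vec n" for v :: "real vec"
    using that by (intro eq_vecI) auto
  thus ?case using y by (intro mat2_norm_least[of _ n n]) auto
next
  case (Suc k)
  let ?Y = "sqrt_iter n B k"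
  have Y: "?Y \<in> carrier_mat n n" using B by simp
  have YY: "?Y * ?Y \<in> carrier_mat n n" by (rule mult_carrier_mat[OF Y Y])
  have "mat2_norm ((1 / 2) \<cdot>\<^sub>m (B + ?Y * ?Y)) \<le> 1 / 2 * mat2_norm (B + ?Y * ?Y)"
    using mat2_norm_smult_le[OF add_carrier_mat[OF YY, of B], of "1 / 2"] by simp
  also have "mat2_norm (B + ?Y * ?Y) \<le> mat2_norm B + mat2_norm (?Y * ?Y)"
    by (rule mat2_norm_add_le[OF B(1) YY])
  also have "mat2_norm (?Y * ?Y) \<le> mat2_norm ?Y * mat2_norm ?Y" by (rule mat2_norm_mult_le[OF Y Y])
  also have "\<dots> \<le> y * y" by (intro mult_mono Suc.IH mat2_norm_ge_0 y)
  finally show ?case using B by (simp add: power2_eq_square)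
qed

text \<open>Consecutive differences satisfy \<open>2 D\<^sub>k\<^sub>+\<^sub>1 = Y\<^sub>k\<^sub>+\<^sub>1 D\<^sub>k + D\<^sub>k Y\<^sub>k\<close>, which holds without commutativity. As
  the iterates have norm at most \<open>y\<close>, each step contracts by the factor \<open>y\<close>.\<close>

lemma sqrt_iter_step_norm_le:
  assumes B: "B \<in> carrier_mat n n" "mat2_norm B \<le> 2 * y - y\<^sup>2" and y: "0 \<le> y"
  shows "mat2_norm (sqrt_iter n B (Suc k) - sqrt_iter n B k) \<le> y ^ k * y"
proof (induction k)
  case 0
  have "sqrt_iter n B (Suc 0) - sqrt_iter n B 0 = sqrt_iter n B (Suc 0)"
    using sqrt_iter_carrier[OF B(1), of "Suc 0"] by (auto simp del: sqrt_iter.simps(2))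
  thus ?case using sqrt_iter_norm_le[OF B y, of "Suc 0"] by simp
next
  case (Suc k)
  define Y where "Y = sqrt_iter n B k"
  define Z where "Z = sqrt_iter n B (Suc k)"
  have c: "Y \<in> carrier_mat n n" "Z \<in> carrier_mat n n"
    unfolding Y_def Z_def by (rule sqrt_iter_carrier[OF B(1)])+
  have D: "Z - Y \<in> carrier_mat n n" using c by auto
  have IH: "mat2_norm (Z - Y) \<le> y ^ k * y" using Suc by (simp only: Y_def Z_def)
  have bY: "mat2_norm Y \<le> y" and bZ: "mat2_norm Z \<le> y"
    unfolding Y_def Z_def by (rule sqrt_iter_norm_le[OF B y])+
  have Z_eq: "Z = (1 / 2) \<cdot>\<^sub>m (B + Y * Y)" by (simp add: Z_def Y_def)
  have "sqrt_iter n B (Suc (Suc k)) - Z = (1 / 2) \<cdot>\<^sub>m (B + Z * Z) - (1 / 2) \<cdot>\<^sub>m (B + Y * Y)"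
    using Z_eq by (simp add: Z_def)
  also have "\<dots> = (1 / 2) \<cdot>\<^sub>m (Z * (Z - Y) + (Z - Y) * Y)"
  proof -
    have expand: "Z * (Z - Y) = Z * Z - Z * Y" "(Z - Y) * Y = Z * Y - Y * Y"
      using c by (auto intro: mult_minus_distrib_mat minus_mult_distrib_mat)
    have products: "Z * Z \<in> carrier_mat n n" "Z * Y \<in> carrier_mat n n" "Y * Y \<in> carrier_mat n n"
      using c by auto
    have "(1 / 2) \<cdot>\<^sub>m (B + S) - (1 / 2) \<cdot>\<^sub>m (B + T) = (1 / 2) \<cdot>\<^sub>m ((S - R) + (R - T))"
      if "S \<in> carrier_mat n n" "R \<in> carrier_mat n n" "T \<in> carrier_mat n n" for R S T :: "real mat"
      using that B by (intro eq_matI) (auto simp: field_simps)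
    from this[OF products(1,2,3)] show ?thesis by (simp only: expand)
  qed
  finally have eq: "sqrt_iter n B (Suc (Suc k)) - Z = (1 / 2) \<cdot>\<^sub>m (Z * (Z - Y) + (Z - Y) * Y)" .
  have "mat2_norm ((1 / 2) \<cdot>\<^sub>m (Z * (Z - Y) + (Z - Y) * Y))
      \<le> 1 / 2 * mat2_norm (Z * (Z - Y) + (Z - Y) * Y)"
    using mat2_norm_smult_le[of "Z * (Z - Y) + (Z - Y) * Y" n n "1 / 2"]
      add_carrier_mat[OF mult_carrier_mat[OF D c(1)]] by simp
  also have "mat2_norm (Z * (Z - Y) + (Z - Y) * Y) \<le> mat2_norm (Z * (Z - Y)) + mat2_norm ((Z - Y) * Y)"
    using c by (intro mat2_norm_add_le) auto
  also have "mat2_norm (Z * (Z - Y)) \<le> mat2_norm Z * mat2_norm (Z - Y)" by (rule mat2_norm_mult_le[OF c(2) D])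
  also have "\<dots> \<le> y * (y ^ k * y)" by (intro mult_mono bZ IH mat2_norm_ge_0 y)
  also have "mat2_norm ((Z - Y) * Y) \<le> mat2_norm (Z - Y) * mat2_norm Y" by (rule mat2_norm_mult_le[OF D c(1)])
  also have "\<dots> \<le> (y ^ k * y) * y" by (intro mult_mono bY IH mat2_norm_ge_0) (use y in simp)
  finally have "mat2_norm (sqrt_iter n B (Suc (Suc k)) - Z) \<le> y ^ Suc k * y"
    unfolding eq by (simp add: ac_simps)
  thus ?case unfolding Z_def .
qed

lemma sqrt_iter_convergent:
  assumes B: "B \<in> carrier_mat n n" "mat2_norm B \<le> 2 * y - y\<^sup>2" and y: "0 \<le> y" "y < 1"
    and ij: "i < n" "j < n"
  shows "convergent (\<lambda>k. sqrt_iter n B k $$ (i, j))"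
proof -
  let ?f = "\<lambda>k. sqrt_iter n B k $$ (i, j)"
  have step: "norm (?f (Suc k) - ?f k) \<le> y ^ k * y" for k
  proof -
    have c: "sqrt_iter n B (Suc k) \<in> carrier_mat n n" "sqrt_iter n B k \<in> carrier_mat n n"
      using B sqrt_iter_carrier by blast+
    hence "\<bar>?f (Suc k) - ?f k\<bar> = \<bar>(sqrt_iter n B (Suc k) - sqrt_iter n B k) $$ (i, j)\<bar>"
      using ij by (simp del: sqrt_iter.simps)
    also have "\<dots> \<le> mat2_norm (sqrt_iter n B (Suc k) - sqrt_iter n B k)"
      using c ij by (intro abs_entry_le_mat2_norm[of _ n n]) auto
    also have "\<dots> \<le> y ^ k * y" by (rule sqrt_iter_step_norm_le[OF B y(1)])
    finally show ?thesis by simp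
  qed
  have "summable (\<lambda>k. y ^ k * y)" using y by (intro summable_mult2 summable_geometric) simp
  hence "summable (\<lambda>k. ?f (Suc k) - ?f k)" 
    by (rule summable_comparison_test'[where N = 0]) (rule step)
  hence "(\<lambda>m. (\<Sum>k<m. ?f (Suc k) - ?f k)) \<longlonglongrightarrow> (\<Sum>k. ?f (Suc k) - ?f k)" by (rule summable_LIMSEQ)
  hence "(\<lambda>m. ?f m - ?f 0) \<longlonglongrightarrow> (\<Sum>k. ?f (Suc k) - ?f k)"
    by (simp only: sum_lessThan_telescope[of ?f])
  hence "(\<lambda>m. (?f m - ?f 0) + ?f 0) \<longlonglongrightarrow> (\<Sum>k. ?f (Suc k) - ?f k) + ?f 0"
    by (intro tendsto_add tendsto_const)
  thus ?thesis by (auto intro: convergentI)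
qed

text \<open>The limit of the iteration. The last property makes \<open>1 - L\<close> positive semidefinite, so it selects the
  principal root among the square roots of \<open>1 - B\<close>.\<close>

lemma quadratic_fixed_point:
  assumes B: "B \<in> carrier_mat n n" "B\<^sup>T = B" "mat2_norm B \<le> \<beta>" and beta: "0 \<le> \<beta>" "\<beta> < 1"
  obtains L where "L \<in> carrier_mat n n" "L\<^sup>T = L" "2 \<cdot>\<^sub>m L = B + L * L"
    "\<And>v. v \<in> carrier_vec n \<Longrightarrow> v \<bullet> (L *\<^sub>v v) \<le> v \<bullet> v"
proof -
  \<comment> \<open>the smaller root of \<open>2 y = \<beta> + y\<^sup>2\<close>\<close>
  define y where "y = 1 - sqrt (1 - \<beta>)"
  have y: "0 \<le> y" "y < 1" and yb: "\<beta> = 2 * y - y\<^sup>2"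
    using beta by (auto simp: y_def power2_diff)
  have By: "mat2_norm B \<le> 2 * y - y\<^sup>2" using B(3) yb by simp
  let ?Y = "sqrt_iter n B"
  have Y: "?Y k \<in> carrier_mat n n" for k using B by simp
  define L where "L = mat n n (\<lambda>(i, j). lim (\<lambda>k. ?Y k $$ (i, j)))"
  have L: "L \<in> carrier_mat n n" by (simp add: L_def)
  have lim: "(\<lambda>k. ?Y k $$ (i, j)) \<longlonglongrightarrow> L $$ (i, j)" if "i < n" "j < n" for i j
    using sqrt_iter_convergent[OF B(1) By y that] that by (simp add: L_def convergent_LIMSEQ_iff)
  have sym: "L\<^sup>T = L"
  proof (rule eq_matI)
    fix i j assume "i < dim_row L" "j < dim_col L"
    hence ij: "i < n" "j < n" using L by auto
    have "?Y k $$ (j, i) = ?Y k $$ (i, j)" for k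
      by (rule symmetric_mat_entry[OF Y sqrt_iter_symmetric[OF B(1,2)] ij])
    thus "L\<^sup>T $$ (i, j) = L $$ (i, j)" using L ij by (simp add: L_def)
  qed (use L in auto)
  have fix_eq: "2 \<cdot>\<^sub>m L = B + L * L"
  proof (rule eq_matI)
    fix i j assume "i < dim_row (B + L * L)" "j < dim_col (B + L * L)"
    hence ij: "i < n" "j < n" using L by auto
    have entry: "(X * X) $$ (i, j) = (\<Sum>l\<in>{0..<n}. X $$ (i, l) * X $$ (l, j))"
      if "X \<in> carrier_mat n n" for X :: "real mat"
      using that ij by (simp add: scalar_prod_def)
    have "?Y (Suc k) $$ (i, j)
        = 1 / 2 * (B $$ (i, j) + (\<Sum>l\<in>{0..<n}. ?Y k $$ (i, l) * ?Y k $$ (l, j)))" for k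
      using B(1) ij entry[OF Y[of k]] carrier_matD[OF Y[of k]] by (simp del: index_mult_mat(1))
    hence seq: "(\<lambda>k. ?Y (Suc k) $$ (i, j))
        = (\<lambda>k. 1 / 2 * (B $$ (i, j) + (\<Sum>l\<in>{0..<n}. ?Y k $$ (i, l) * ?Y k $$ (l, j))))"
      by (rule ext)
    have "(\<lambda>k. 1 / 2 * (B $$ (i, j) + (\<Sum>l\<in>{0..<n}. ?Y k $$ (i, l) * ?Y k $$ (l, j))))
        \<longlonglongrightarrow> 1 / 2 * (B $$ (i, j) + (\<Sum>l\<in>{0..<n}. L $$ (i, l) * L $$ (l, j)))"
      using ij by (intro tendsto_intros lim) auto
    from LIMSEQ_unique[OF LIMSEQ_Suc[OF lim[OF ij]] this[folded seq]]
    have "L $$ (i, j) = 1 / 2 * (B $$ (i, j) + (\<Sum>l\<in>{0..<n}. L $$ (i, l) * L $$ (l, j)))" .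
    thus "(2 \<cdot>\<^sub>m L) $$ (i, j) = (B + L * L) $$ (i, j)"
      using B(1) L ij entry[OF L] by simp
  qed (use B L in auto)
  have "v \<bullet> (L *\<^sub>v v) \<le> v \<bullet> v" if v: "v \<in> carrier_vec n" for v
  proof -
    have form: "v \<bullet> (X *\<^sub>v v) = (\<Sum>i\<in>{0..<n}. v $ i * (\<Sum>j\<in>{0..<n}. X $$ (i, j) * v $ j))"
      if "X \<in> carrier_mat n n" for X :: "real mat"
      using that v by (simp add: scalar_prod_def)
    have "(\<lambda>k. v \<bullet> (?Y k *\<^sub>v v)) \<longlonglongrightarrow> v \<bullet> (L *\<^sub>v v)"
      unfolding form[OF Y] form[OF L] by (intro tendsto_intros lim) auto
    moreover have "v \<bullet> (?Y k *\<^sub>v v) \<le> v \<bullet> v" for k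
    proof -
      have "v \<bullet> (?Y k *\<^sub>v v) \<le> vec2_norm v * vec2_norm (?Y k *\<^sub>v v)"
        using scalar_prod_le_vec2_norm[of v n "?Y k *\<^sub>v v"] v Y[of k] by auto
      also have "\<dots> \<le> vec2_norm v * (mat2_norm (?Y k) * vec2_norm v)"
        by (intro mult_left_mono mat2_norm_upper[OF Y v]) simp
      also have "mat2_norm (?Y k) * vec2_norm v \<le> 1 * vec2_norm v"
        using sqrt_iter_norm_le[OF B(1) By y(1), of k] y by (intro mult_right_mono) auto
      hence "vec2_norm v * (mat2_norm (?Y k) * vec2_norm v) \<le> vec2_norm v * (1 * vec2_norm v)"
        by (intro mult_left_mono) auto
      finally show ?thesis by (simp flip: vec2_norm_square power2_eq_square)
    qed
    ultimately show ?thesis using LIMSEQ_le_const2 by blast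
  qed
  with L sym fix_eq show ?thesis using that by blast
qed

text \<open>For \<open>c \<ge> 1\<close> with \<open>\<parallel>M\<parallel> \<le> c\<close> write \<open>M = c\<^sup>2 (1 - B)\<close>. Expanding \<open>\<parallel>B v\<parallel>\<^sup>2\<close> and using \<open>v \<bullet> M v \<ge> v \<bullet> v\<close> gives
  \<open>\<parallel>B v\<parallel>\<^sup>2 \<le> (1 - 1 / c\<^sup>2) \<parallel>v\<parallel>\<^sup>2\<close>, so that the iteration applies to \<open>B\<close>.\<close>

lemma pos_def_sqrt_exists:
  assumes M: "M \<in> carrier_mat n n" "M\<^sup>T = M"
    and low: "\<And>v. v \<in> carrier_vec n \<Longrightarrow> v \<bullet> v \<le> v \<bullet> (M *\<^sub>v v)"
  obtains X where "X \<in> carrier_mat n n" "sym_psd X" "X * X = M"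
proof -
  define c where "c = max 1 (mat2_norm M)"
  have c: "1 \<le> c" "mat2_norm M \<le> c" by (auto simp: c_def)
  define B where "B = 1\<^sub>m n - (1 / c\<^sup>2) \<cdot>\<^sub>m M"
  have B: "B \<in> carrier_mat n n" unfolding B_def by (rule minus_carrier_mat) (use M in auto)
  have Bsym: "B\<^sup>T = B"
  proof (rule eq_matI)
    fix i j assume "i < dim_row B" "j < dim_col B"
    hence ij: "i < n" "j < n" using B by auto
    have "M $$ (j, i) = M $$ (i, j)"
      using symmetric_mat_entry[OF M ij] .
    thus "B\<^sup>T $$ (i, j) = B $$ (i, j)" using M ij by (simp add: B_def)
  qed (use B in auto)
  define \<beta> where "\<beta> = sqrt (1 - 1 / c\<^sup>2)"
  have beta: "0 \<le> \<beta>" "\<beta> < 1" "\<beta>\<^sup>2 = 1 - 1 / c\<^sup>2" using c by (auto simp: \<beta>_def)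
  have "mat2_norm B \<le> \<beta>"
  proof (rule mat2_norm_least[OF B beta(1)])
    fix v :: "real vec" assume v: "v \<in> carrier_vec n"
    let ?w = "M *\<^sub>v v"
    have w: "?w \<in> carrier_vec n" using M v by auto
    have "B *\<^sub>v v = 1\<^sub>m n *\<^sub>v v - ((1 / c\<^sup>2) \<cdot>\<^sub>m M) *\<^sub>v v"
      unfolding B_def using M v by (intro minus_mult_distrib_mat_vec[of _ n n]) auto
    also have "\<dots> = v - (1 / c\<^sup>2) \<cdot>\<^sub>v ?w" using smult_mat_mult_vec[OF M(1) v] v by simp
    finally have Bv: "B *\<^sub>v v = v - (1 / c\<^sup>2) \<cdot>\<^sub>v ?w" .
    have "(vec2_norm (B *\<^sub>v v))\<^sup>2
        = (vec2_norm v)\<^sup>2 - 2 / c\<^sup>2 * (v \<bullet> ?w) + (vec2_norm ?w)\<^sup>2 / c ^ 4"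
      unfolding Bv using vec2_norm_square_minus[of v n "(1 / c\<^sup>2) \<cdot>\<^sub>v ?w"] v w
      by (simp add: power_divide power_mult_distrib flip: power_mult)
    also have "\<dots> \<le> (vec2_norm v)\<^sup>2 - 2 / c\<^sup>2 * (vec2_norm v)\<^sup>2 + (c * vec2_norm v)\<^sup>2 / c ^ 4"
    proof -
      have "vec2_norm ?w \<le> c * vec2_norm v"
        using mat2_norm_upper[OF M(1) v] mult_right_mono[OF c(2), of "vec2_norm v"] by simp
      hence "(vec2_norm ?w)\<^sup>2 / c ^ 4 \<le> (c * vec2_norm v)\<^sup>2 / c ^ 4"
        by (intro divide_right_mono power_mono) auto
      moreover have "2 / c\<^sup>2 * (vec2_norm v)\<^sup>2 \<le> 2 / c\<^sup>2 * (v \<bullet> ?w)"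
        using low[OF v] by (intro mult_left_mono) (auto simp: vec2_norm_square)
      ultimately show ?thesis by linarith
    qed
    also have "(c * vec2_norm v)\<^sup>2 / c ^ 4 = (vec2_norm v)\<^sup>2 / c\<^sup>2"
      using c by (simp add: power_mult_distrib power4_eq_xxxx power2_eq_square)
    also have "(vec2_norm v)\<^sup>2 - 2 / c\<^sup>2 * (vec2_norm v)\<^sup>2 + (vec2_norm v)\<^sup>2 / c\<^sup>2
        = (\<beta> * vec2_norm v)\<^sup>2"
      by (simp add: power_mult_distrib beta(3) algebra_simps diff_divide_distrib)
    finally show "vec2_norm (B *\<^sub>v v) \<le> \<beta> * vec2_norm v"
      by (rule power2_le_imp_le) (use beta in simp)
  qed
  then obtain L where L: "L \<in> carrier_mat n n" "L\<^sup>T = L" "2 \<cdot>\<^sub>m L = B + L * L"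
    "\<And>v. v \<in> carrier_vec n \<Longrightarrow> v \<bullet> (L *\<^sub>v v) \<le> v \<bullet> v"
    using quadratic_fixed_point[OF B Bsym _ beta(1,2)] by blast
  let ?K = "1\<^sub>m n - L"
  define X where "X = c \<cdot>\<^sub>m ?K"
  have K: "?K \<in> carrier_mat n n" using L by auto
  have X: "X \<in> carrier_mat n n" using K by (simp add: X_def)
  have "?K * ?K = 1\<^sub>m n - L - (L - L * L)"
    using L(1) K minus_mult_distrib_mat[of "1\<^sub>m n" n n L ?K n] mult_minus_distrib_mat[of L n n "1\<^sub>m n" n L]
    by simp
  also have "\<dots> = (1 / c\<^sup>2) \<cdot>\<^sub>m M"
  proof (rule eq_matI)
    fix i j assume "i < dim_row ((1 / c\<^sup>2) \<cdot>\<^sub>m M)" "j < dim_col ((1 / c\<^sup>2) \<cdot>\<^sub>m M)"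
    hence ij: "i < n" "j < n" using M by auto
    have "2 * L $$ (i, j) = B $$ (i, j) + (L * L) $$ (i, j)"
      using arg_cong[OF L(3), of "\<lambda>X. X $$ (i, j)"] L(1) B ij by (simp del: index_mult_mat(1))
    moreover have "B $$ (i, j) = 1\<^sub>m n $$ (i, j) - 1 / c\<^sup>2 * M $$ (i, j)"
      using M ij by (simp add: B_def)
    ultimately show "(1\<^sub>m n - L - (L - L * L)) $$ (i, j) = ((1 / c\<^sup>2) \<cdot>\<^sub>m M) $$ (i, j)"
      using L(1) M(1) ij by (simp del: index_mult_mat(1) index_one_mat(1))
  qed (use L M in auto)
  finally have KK: "?K * ?K = (1 / c\<^sup>2) \<cdot>\<^sub>m M" .
  have "X * X = c \<cdot>\<^sub>m (c \<cdot>\<^sub>m (?K * ?K))"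
    unfolding X_def using K mult_smult_distrib[of "c \<cdot>\<^sub>m ?K" n n ?K n c] mult_smult_assoc_mat[OF K K, of c]
    by simp
  also have "\<dots> = M" unfolding KK using c M by (intro eq_matI) (auto simp: power2_eq_square)
  finally have "X * X = M" .
  moreover have "sym_psd X" unfolding sym_psd_def
  proof (intro conjI ballI)
    show "square_mat X" using X by auto
    have "L $$ (j, i) = L $$ (i, j)" if "i < n" "j < n" for i j
      using symmetric_mat_entry[OF L(1,2) that] .
    thus "X\<^sup>T = X" using L(1) by (intro eq_matI) (auto simp: X_def)
    fix v :: "real vec" assume "v \<in> carrier_vec (dim_col X)"
    hence v: "v \<in> carrier_vec n" using X by auto
    have Lv: "L *\<^sub>v v \<in> carrier_vec n" using L v by auto
    have "X *\<^sub>v v = c \<cdot>\<^sub>v (v - L *\<^sub>v v)"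
      using smult_mat_mult_vec[OF K v, of c] minus_mult_distrib_mat_vec[of "1\<^sub>m n" n n L v] L v
      by (simp add: X_def)
    hence "v \<bullet> (X *\<^sub>v v) = c * (v \<bullet> v - v \<bullet> (L *\<^sub>v v))"
      using v Lv scalar_prod_minus_distrib[OF v v Lv] by simp
    thus "0 \<le> v \<bullet> (X *\<^sub>v v)" using L(4)[OF v] c by simp
  qed
  ultimately show ?thesis using that X by blast
qed

lemma sym_psdD:
  assumes "sym_psd X" "X \<in> carrier_mat n n"
  shows "X\<^sup>T = X" "v \<in> carrier_vec n \<Longrightarrow> 0 \<le> v \<bullet> (X *\<^sub>v v)"
  using assms by (auto simp: sym_psd_def)

text \<open>A vector on which the nonnegative form vanishes minimizes the form, so the gradient \<open>2 X v\<close> vanishes there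
  as well; otherwise the form at \<open>v - t X v\<close> would be negative for small \<open>t > 0\<close>.\<close>

lemma psd_form_zero_imp_kernel:
  assumes X: "X \<in> carrier_mat n n" "sym_psd X" and v: "v \<in> carrier_vec n"
    and zero: "v \<bullet> (X *\<^sub>v v) = 0"
  shows "X *\<^sub>v v = 0\<^sub>v n"
proof -
  note sym = sym_psdD(1)[OF X(2,1)]
  let ?w = "X *\<^sub>v v"
  have w: "?w \<in> carrier_vec n" and Xw: "X *\<^sub>v ?w \<in> carrier_vec n" using X v by auto
  define a where "a = ?w \<bullet> ?w"
  define b where "b = ?w \<bullet> (X *\<^sub>v ?w)"
  have ab: "0 \<le> a" "0 \<le> b"
    using scalar_prod_self_ge_0 sym_psdD(2)[OF X(2,1) w] by (auto simp: a_def b_def)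
  \<comment> \<open>close to the minimizer \<open>a / b\<close> of \<open>t\<^sup>2 b - 2 t a\<close>, and defined for \<open>b = 0\<close> too\<close>
  define t where "t = a / (b + 1)"
  have tw: "t \<cdot>\<^sub>v ?w \<in> carrier_vec n" using w by auto
  have "v \<bullet> (X *\<^sub>v ?w) = a"
    using scalar_prod_transpose(1)[OF X(1) w v] sym by (simp add: a_def)
  moreover have "X *\<^sub>v (v - t \<cdot>\<^sub>v ?w) = ?w - t \<cdot>\<^sub>v (X *\<^sub>v ?w)"
    using mult_minus_distrib_mat_vec[OF X(1) v tw] mult_mat_vec[OF X(1) w] by simp
  ultimately have "(v - t \<cdot>\<^sub>v ?w) \<bullet> (X *\<^sub>v (v - t \<cdot>\<^sub>v ?w)) = t\<^sup>2 * b - 2 * t * a"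
    using v w Xw tw zero
    by (simp add: minus_scalar_prod_distrib[of _ n] scalar_prod_minus_distrib[of _ n] a_def b_def
        power2_eq_square algebra_simps)
  moreover have "0 \<le> (v - t \<cdot>\<^sub>v ?w) \<bullet> (X *\<^sub>v (v - t \<cdot>\<^sub>v ?w))"
    using v tw by (intro sym_psdD(2)[OF X(2,1)]) auto
  ultimately have "2 * t * a \<le> t * (t * b)" by (simp add: power2_eq_square)
  moreover have "t * b \<le> a" unfolding t_def using ab by (simp add: field_simps)
  moreover have "0 \<le> t" using ab by (simp add: t_def)
  ultimately have "2 * t * a \<le> t * a" by (meson mult_left_mono order_trans)
  hence "t * a \<le> 0" by linarith
  hence "a = 0" using ab by (auto simp: t_def divide_le_0_iff mult_le_0_iff)
  hence "vec2_norm ?w = 0" by (simp add: a_def vec2_norm_def)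
  thus ?thesis using vec2_norm_eq_0_iff[OF w] by simp
qed

lemma trace_commute:
  fixes B C :: "real mat"
  assumes "B \<in> carrier_mat n n" "C \<in> carrier_mat n n"
  shows "(\<Sum>i<n. (B * C) $$ (i, i)) = (\<Sum>i<n. (C * B) $$ (i, i))"
proof -
  have "(\<Sum>i<n. (B * C) $$ (i, i)) = (\<Sum>i<n. \<Sum>j\<in>{0..<n}. B $$ (i, j) * C $$ (j, i))"
    using assms by (intro sum.cong) (auto simp: scalar_prod_def)
  also have "\<dots> = (\<Sum>j<n. \<Sum>i<n. B $$ (i, j) * C $$ (j, i))"
    unfolding atLeast0LessThan by (rule sum.swap)
  also have "\<dots> = (\<Sum>j<n. (C * B) $$ (j, j))"
    using assms by (intro sum.cong) (auto simp: scalar_prod_def atLeast0LessThan mult.commute)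
  finally show ?thesis .
qed

text \<open>The difference \<open>D\<close> of two square roots satisfies \<open>X D = - D Y\<close>. Hence the traces of \<open>D X D\<close> and \<open>D Y D\<close>,
  which are sums of values of the two nonnegative forms at the columns of \<open>D\<close>, add up to zero. Then \<open>X\<close>
  annihilates every column of \<open>D\<close>, and so does \<open>X\<^sup>2\<close>, which is positive definite.\<close>

lemma psd_sqrt_unique:
  assumes X: "X \<in> carrier_mat n n" "sym_psd X" and Y: "Y \<in> carrier_mat n n" "sym_psd Y"
    and eq: "X * X = Y * Y"
    and low: "\<And>v. v \<in> carrier_vec n \<Longrightarrow> v \<bullet> v \<le> v \<bullet> (X *\<^sub>v (X *\<^sub>v v))"
  shows "X = Y"
proof -
  define D where "D = X - Y"
  have D: "D \<in> carrier_mat n n" using X Y by (auto simp: D_def)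
  have DT: "D\<^sup>T = D" using X Y sym_psdD(1) transpose_minus[of X n n Y] by (auto simp: D_def)
  have XY: "X * Y \<in> carrier_mat n n" "Y * Y \<in> carrier_mat n n" using X Y by auto
  have expand: "X * D = X * X - X * Y" "D * Y = X * Y - Y * Y"
    unfolding D_def using mult_minus_distrib_mat[OF X(1) X(1) Y(1)] minus_mult_distrib_mat[OF X(1) Y(1) Y(1)]
    by simp_all
  have "R - S = - (S - R)" if "R \<in> carrier_mat n n" "S \<in> carrier_mat n n" for R S :: "real mat"
    using that by (intro eq_matI) auto
  from this[OF XY(2,1)] have XD: "X * D = - (D * Y)" by (simp only: expand eq)
  have diag: "(D * (Z * D)) $$ (i, i) = col D i \<bullet> (Z *\<^sub>v col D i)"
    if Z: "Z \<in> carrier_mat n n" and i: "i < n" for Z i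
  proof -
    have "row D i = col D i" using DT D i by (metis carrier_matD(1) col_transpose)
    thus ?thesis using D Z i col_mult2[OF Z D i] by simp
  qed
  have col: "col D i \<in> carrier_vec n" if "i < n" for i using D that by auto
  have "(\<Sum>i<n. col D i \<bullet> (X *\<^sub>v col D i)) = (\<Sum>i<n. (D * (X * D)) $$ (i, i))"
    using diag[OF X(1)] by (intro sum.cong) auto
  also have "\<dots> = (\<Sum>i<n. - (D * (D * Y)) $$ (i, i))"
    unfolding XD using D Y by (intro sum.cong) auto
  also have "\<dots> = - (\<Sum>i<n. ((D * Y) * D) $$ (i, i))"
    using trace_commute[OF D, of "D * Y"] D Y by (simp add: sum_negf)
  also have "(D * Y) * D = D * (Y * D)" using assoc_mult_mat[OF D Y(1) D] .
  also have "(\<Sum>i<n. (D * (Y * D)) $$ (i, i)) = (\<Sum>i<n. col D i \<bullet> (Y *\<^sub>v col D i))"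
    using diag[OF Y(1)] by (intro sum.cong) auto
  finally have "(\<Sum>i<n. col D i \<bullet> (X *\<^sub>v col D i)) \<le> 0"
    using sum_nonneg[of "{..<n}" "\<lambda>i. col D i \<bullet> (Y *\<^sub>v col D i)"] sym_psdD(2)[OF Y(2,1) col] by simp
  moreover have "0 \<le> col D i \<bullet> (X *\<^sub>v col D i)" if "i < n" for i
    by (rule sym_psdD(2)[OF X(2,1) col[OF that]])
  ultimately have zero: "col D i \<bullet> (X *\<^sub>v col D i) = 0" if "i < n" for i
    using that sum_nonneg_eq_0_iff[of "{..<n}" "\<lambda>i. col D i \<bullet> (X *\<^sub>v col D i)"]
      sum_nonneg[of "{..<n}" "\<lambda>i. col D i \<bullet> (X *\<^sub>v col D i)"] by force
  have "col D i = 0\<^sub>v n" if i: "i < n" for i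
  proof -
    have "X *\<^sub>v col D i = 0\<^sub>v n" by (rule psd_form_zero_imp_kernel[OF X col[OF i] zero[OF i]])
    hence "(vec2_norm (col D i))\<^sup>2 \<le> 0"
      using low[OF col[OF i]] scalar_prod_transpose(1)[OF X(1), of "0\<^sub>v n" "col D i"]
        scalar_prod_transpose(2)[OF X(1), of "col D i" "0\<^sub>v n"] X col[OF i] sym_psdD(1)[OF X(2,1)]
      by (simp add: vec2_norm_square)
    hence "vec2_norm (col D i) = 0" by simp
    thus ?thesis using vec2_norm_eq_0_iff[OF col[OF i]] by simp
  qed
  hence D0: "D $$ (i, j) = 0" if "i < n" "j < n" for i j
    using that D by (metis carrier_matD col_def index_vec index_zero_vec(1))
  show ?thesis
  proof (rule eq_matI)
    fix i j assume "i < dim_row Y" "j < dim_col Y"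
    thus "X $$ (i, j) = Y $$ (i, j)" using D0[of i j] X Y by (simp add: D_def)
  qed (use X Y in auto)
qed

lemma mat_sqrt_pos_def:
  assumes M: "M \<in> carrier_mat n n" "M\<^sup>T = M"
    and low: "\<And>v. v \<in> carrier_vec n \<Longrightarrow> v \<bullet> v \<le> v \<bullet> (M *\<^sub>v v)"
  shows "mat_sqrt M \<in> carrier_mat n n" "(mat_sqrt M)\<^sup>T = mat_sqrt M" "mat_sqrt M * mat_sqrt M = M"
proof -
  obtain X where X: "X \<in> carrier_mat n n" "sym_psd X" "X * X = M"
    using pos_def_sqrt_exists[OF M low] by blast
  have "mat_sqrt M = X" unfolding mat_sqrt_def
  proof (rule the_equality)
    fix Y assume Y: "Y \<in> carrier_mat (dim_row M) (dim_row M) \<and> sym_psd Y \<and> Y * Y = M"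
    hence Y': "Y \<in> carrier_mat n n" using M by auto
    have "v \<bullet> v \<le> v \<bullet> (X *\<^sub>v (X *\<^sub>v v))" if v: "v \<in> carrier_vec n" for v
      using low[OF v] assoc_mult_mat_vec[OF X(1) X(1) v] X(3) by simp
    thus "Y = X" using psd_sqrt_unique[OF X(1,2) Y'] Y X(3) by auto
  qed (use M X in auto)
  with X show "mat_sqrt M \<in> carrier_mat n n" "(mat_sqrt M)\<^sup>T = mat_sqrt M" "mat_sqrt M * mat_sqrt M = M"
    by (auto simp: sym_psd_def)
qed

section \<open>Ritz values\<close>

lemma vec2_norm_mono:
  assumes "v \<in> carrier_vec n" "w \<in> carrier_vec n" "\<And>i. i < n \<Longrightarrow> \<bar>v $ i\<bar> \<le> \<bar>w $ i\<bar>"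
  shows "vec2_norm v \<le> vec2_norm w"
proof -
  have "(\<Sum>i\<in>{0..<n}. (v $ i)\<^sup>2) \<le> (\<Sum>i\<in>{0..<n}. (w $ i)\<^sup>2)"
    using assms(3) by (intro sum_mono) (simp add: abs_le_square_iff)
  thus ?thesis using assms(1,2) by (simp add: vec2_norm_L2_set L2_set_def)
qed

lemma mat_diag_mult_vec_index:
  fixes f :: "nat \<Rightarrow> real"
  assumes "v \<in> carrier_vec n" "i < n"
  shows "(mat_diag n f *\<^sub>v v) $ i = f i * v $ i"
proof -
  have "(mat_diag n f *\<^sub>v v) $ i = (\<Sum>j\<in>{0..<n}. (if i = j then f j else 0) * v $ j)"
    using assms by (simp add: mat_diag_def scalar_prod_def)
  also have "\<dots> = (\<Sum>j\<in>{0..<n}. if i = j then f j * v $ j else 0)" by (intro sum.cong) auto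
  finally show ?thesis using assms(2) by simp
qed

lemma mat_diag_mult_vec_le:
  fixes f :: "nat \<Rightarrow> real"
  assumes v: "v \<in> carrier_vec n" and t: "0 \<le> t"
    and le: "\<And>i. i < n \<Longrightarrow> v $ i \<noteq> 0 \<Longrightarrow> \<bar>f i\<bar> \<le> t"
  shows "vec2_norm (mat_diag n f *\<^sub>v v) \<le> t * vec2_norm v"
proof -
  have "vec2_norm (mat_diag n f *\<^sub>v v) \<le> vec2_norm (t \<cdot>\<^sub>v v)"
  proof (rule vec2_norm_mono)
    fix i assume i: "i < n"
    show "\<bar>(mat_diag n f *\<^sub>v v) $ i\<bar> \<le> \<bar>(t \<cdot>\<^sub>v v) $ i\<bar>"
      using le[OF i] t v i
      by (cases "v $ i = 0") (auto simp: mat_diag_mult_vec_index[OF v i] abs_mult intro: mult_right_mono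
          simp del: index_mult_mat_vec)
  qed (use v mult_mat_vec_carrier[OF mat_diag_dim v] in auto)
  thus ?thesis using t by simp
qed

lemma le_mat_diag_mult_vec:
  fixes f :: "nat \<Rightarrow> real"
  assumes v: "v \<in> carrier_vec n" and t: "0 \<le> t"
    and le: "\<And>i. i < n \<Longrightarrow> v $ i \<noteq> 0 \<Longrightarrow> t \<le> \<bar>f i\<bar>"
  shows "t * vec2_norm v \<le> vec2_norm (mat_diag n f *\<^sub>v v)"
proof -
  have "vec2_norm (t \<cdot>\<^sub>v v) \<le> vec2_norm (mat_diag n f *\<^sub>v v)"
  proof (rule vec2_norm_mono)
    fix i assume i: "i < n"
    show "\<bar>(t \<cdot>\<^sub>v v) $ i\<bar> \<le> \<bar>(mat_diag n f *\<^sub>v v) $ i\<bar>"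
      using le[OF i] t v i
      by (cases "v $ i = 0") (auto simp: mat_diag_mult_vec_index[OF v i] abs_mult intro: mult_right_mono
          simp del: index_mult_mat_vec)
  qed (use v mult_mat_vec_carrier[OF mat_diag_dim v] in auto)
  thus ?thesis using t by simp
qed

lemma square_svd_mult_vec_norm:
  assumes svd: "is_svd p p B U s V" and x: "x \<in> carrier_vec p"
  shows "vec2_norm (B *\<^sub>v x) = vec2_norm (mat_diag p s *\<^sub>v (V\<^sup>T *\<^sub>v x))"
proof -
  have U: "orthonormal_cols p p U" and V: "orthonormal_cols p p V"
    and B: "B = U * (mat_diag p s @\<^sub>r 0\<^sub>m 0 p) * V\<^sup>T"
    using svd by (auto simp: is_svd_def)
  have diag: "mat_diag p s @\<^sub>r 0\<^sub>m 0 p = mat_diag p s"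
    by (intro eq_matI) (auto simp: append_rows_def mat_diag_def)
  have Vx: "V\<^sup>T *\<^sub>v x \<in> carrier_vec p" using orthonormal_colsD[OF V] x by auto
  have Dx: "mat_diag p s *\<^sub>v (V\<^sup>T *\<^sub>v x) \<in> carrier_vec p" by (rule mult_mat_vec_carrier[OF mat_diag_dim Vx])
  have "B *\<^sub>v x = (U * mat_diag p s) *\<^sub>v (V\<^sup>T *\<^sub>v x)"
    unfolding B diag using orthonormal_colsD(1)[OF U] orthonormal_colsD(3)[OF V] x
    by (intro assoc_mult_mat_vec[of _ p p _ p]) auto
  also have "\<dots> = U *\<^sub>v (mat_diag p s *\<^sub>v (V\<^sup>T *\<^sub>v x))"
    using orthonormal_colsD(1)[OF U] Vx by (intro assoc_mult_mat_vec[of _ p p _ p]) auto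
  finally show ?thesis using vec2_norm_orthonormal[OF U Dx] by simp
qed

lemma nonzero_vec_orthogonal_to_fewer:
  fixes c :: "nat \<Rightarrow> real vec"
  assumes c: "\<And>i. i < n \<Longrightarrow> c i \<in> carrier_vec n" and k: "k < n"
  obtains x where "x \<in> carrier_vec n" "x \<noteq> 0\<^sub>v n" "\<And>i. i < n \<Longrightarrow> i \<noteq> k \<Longrightarrow> c i \<bullet> x = 0"
proof -
  let ?c = "\<lambda>i. if i = k then 0\<^sub>v n else c i"
  let ?M = "mat\<^sub>r n n ?c"
  have M: "?M \<in> carrier_mat n n" by simp
  have "det ?M = 0" by (rule det_row_0[OF k]) (use c in auto)
  then obtain x where x: "x \<in> carrier_vec n" "x \<noteq> 0\<^sub>v n" "?M *\<^sub>v x = 0\<^sub>v n"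
    using det_0_iff_vec_prod_zero_field[OF M] by blast
  have "c i \<bullet> x = 0" if i: "i < n" "i \<noteq> k" for i
  proof -
    have "row ?M i = c i" using i c by (simp add: row_mat_of_row_fun)
    thus ?thesis using arg_cong[OF x(3), of "\<lambda>v. v $ i"] i by simp
  qed
  thus ?thesis using that x by blast
qed

text \<open>The dimension count behind the Courant--Fischer principle, for two coordinate systems \<open>G\<close> and \<open>H\<close>:
  \<open>G x\<close> vanishes at the positions \<open>\<tau> j\<close> with \<open>j > i\<close> and \<open>H x\<close> at those with \<open>j < i\<close>. These are \<open>p - 1\<close>
  linear conditions on \<open>p\<close> unknowns, whatever \<open>G\<close> and \<open>H\<close> are.\<close>

lemma courant_fischer_vector:
  fixes G H :: "real mat"
  assumes G: "G \<in> carrier_mat p p" and H: "H \<in> carrier_mat p p"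
    and \<tau>: "\<tau> permutes {..<p}" and i: "i < p"
  obtains x where "x \<in> carrier_vec p" "x \<noteq> 0\<^sub>v p"
    "\<And>l. l < p \<Longrightarrow> (G *\<^sub>v x) $ l \<noteq> 0 \<Longrightarrow> \<exists>j\<le>i. l = \<tau> j"
    "\<And>l. l < p \<Longrightarrow> (H *\<^sub>v x) $ l \<noteq> 0 \<Longrightarrow> \<exists>j. i \<le> j \<and> j < p \<and> l = \<tau> j"
proof -
  let ?c = "\<lambda>j. if j < i then row H (\<tau> j) else row G (\<tau> j)"
  have mem: "\<tau> j < p" if "j < p" for j using permutes_in_image[OF \<tau>] that by auto
  obtain x where x: "x \<in> carrier_vec p" "x \<noteq> 0\<^sub>v p" "\<And>j. j < p \<Longrightarrow> j \<noteq> i \<Longrightarrow> ?c j \<bullet> x = 0"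
    using nonzero_vec_orthogonal_to_fewer[of p ?c i] mem G H i
    by (metis carrier_matD(2) row_carrier)
  have preimage: "\<exists>j<p. l = \<tau> j" if "l < p" for l
    using permutes_image[OF \<tau>] that by (metis imageE lessThan_iff)
  show ?thesis
  proof (rule that[OF x(1,2)])
    fix l assume l: "l < p" "(G *\<^sub>v x) $ l \<noteq> 0"
    then obtain j where j: "j < p" "l = \<tau> j" using preimage by blast
    have "row G l \<bullet> x \<noteq> 0" using l G by simp
    hence "j \<le> i" using x(3)[OF j(1)] j(2) by (cases "j \<le> i") auto
    thus "\<exists>j\<le>i. l = \<tau> j" using j by blast
  next
    fix l assume l: "l < p" "(H *\<^sub>v x) $ l \<noteq> 0"
    then obtain j where j: "j < p" "l = \<tau> j" using preimage by blast
    have "row H l \<bullet> x \<noteq> 0" using l H by simp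
    hence "i \<le> j" using x(3)[OF j(1)] j(2) by (cases "i \<le> j") auto
    thus "\<exists>j. i \<le> j \<and> j < p \<and> l = \<tau> j" using j by blast
  qed
qed

text \<open>Compressed to approximate singular subspaces, \<open>A\<close> acts as \<open>\<Sigma>\<close> in the coordinates \<open>Vp\<^sup>T Q1\<close> and
  \<open>Q2\<^sup>T Up\<close> up to an error of second order. The part \<open>e\<close> of \<open>Q1 x\<close> outside the span of \<open>Vp\<close> has norm at
  most \<open>\<delta> \<parallel>x\<parallel>\<close>, and \<open>A e\<close> is orthogonal to the span of \<open>Up\<close>, which the span of \<open>Q2\<close> leaves only by
  \<open>\<delta>\<close>. This gives the second factor \<open>\<delta>\<close>.\<close>

lemma ritz_matrix_decomposition:
  fixes A Vp Up Q1 Q2 :: "real mat"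
  assumes A: "A \<in> carrier_mat m n"
    and Vp: "orthonormal_cols n p Vp" and Up: "orthonormal_cols m p Up"
    and Q1: "orthonormal_cols n p Q1" and Q2: "orthonormal_cols m p Q2"
    and AV: "A * Vp = Up * mat_diag p \<sigma>" and AU: "A\<^sup>T * Up = Vp * mat_diag p \<sigma>"
    and res1: "\<And>x. x \<in> carrier_vec p \<Longrightarrow>
      vec2_norm (Q1 *\<^sub>v x - Vp *\<^sub>v (Vp\<^sup>T *\<^sub>v (Q1 *\<^sub>v x))) \<le> \<delta> * vec2_norm x"
    and res2: "\<And>x. x \<in> carrier_vec p \<Longrightarrow>
      vec2_norm (Q2 *\<^sub>v x - Up *\<^sub>v (Up\<^sup>T *\<^sub>v (Q2 *\<^sub>v x))) \<le> \<delta> * vec2_norm x"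
    and d: "0 \<le> \<delta>" and x: "x \<in> carrier_vec p"
  shows "vec2_norm ((Q2\<^sup>T * A * Q1) *\<^sub>v x
      - Q2\<^sup>T *\<^sub>v (Up *\<^sub>v (mat_diag p \<sigma> *\<^sub>v (Vp\<^sup>T *\<^sub>v (Q1 *\<^sub>v x))))) \<le> mat2_norm A * \<delta>\<^sup>2 * vec2_norm x"
proof -
  note VD = orthonormal_colsD[OF Vp] and UD = orthonormal_colsD[OF Up]
    and Q1D = orthonormal_colsD[OF Q1] and Q2D = orthonormal_colsD[OF Q2]
  define z where "z = Q1 *\<^sub>v x"
  define c where "c = Vp\<^sup>T *\<^sub>v z"
  define e where "e = z - Vp *\<^sub>v c"
  define g where "g = A *\<^sub>v e"
  define y where "y = Q2\<^sup>T *\<^sub>v g"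
  have z: "z \<in> carrier_vec n" using Q1D x by (auto simp: z_def)
  have c: "c \<in> carrier_vec p" using VD z by (auto simp: c_def)
  have Vc: "Vp *\<^sub>v c \<in> carrier_vec n" using VD c by auto
  have e: "e \<in> carrier_vec n" using z Vc by (auto simp: e_def)
  have g: "g \<in> carrier_vec m" using A e by (auto simp: g_def)
  have y: "y \<in> carrier_vec p" using Q2D g by (auto simp: y_def)
  have diag: "mat_diag p \<sigma> *\<^sub>v u \<in> carrier_vec p" if "u \<in> carrier_vec p" for u
    using mult_mat_vec_carrier[OF mat_diag_dim that] .
  have AVc: "A *\<^sub>v (Vp *\<^sub>v u) = Up *\<^sub>v (mat_diag p \<sigma> *\<^sub>v u)"
    and AUc: "A\<^sup>T *\<^sub>v (Up *\<^sub>v u) = Vp *\<^sub>v (mat_diag p \<sigma> *\<^sub>v u)" if u: "u \<in> carrier_vec p" for u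
    using A VD UD u mat_diag_dim[of p \<sigma>]
      arg_cong[OF AV, of "\<lambda>X. X *\<^sub>v u"] arg_cong[OF AU, of "\<lambda>X. X *\<^sub>v u"]
      assoc_mult_mat_vec[OF A VD(1) u] assoc_mult_mat_vec[OF UD(1) mat_diag_dim u]
      assoc_mult_mat_vec[OF transpose_carrier_mat[THEN iffD2, OF A] UD(1) u]
      assoc_mult_mat_vec[OF VD(1) mat_diag_dim u] by simp_all
  have QAQ: "(Q2\<^sup>T * A * Q1) *\<^sub>v x = Q2\<^sup>T *\<^sub>v (A *\<^sub>v z)"
  proof -
    have "Q2\<^sup>T * A \<in> carrier_mat p n" using Q2D A by auto
    thus ?thesis using assoc_mult_mat_vec[of "Q2\<^sup>T * A" p n Q1 p x] assoc_mult_mat_vec[OF Q2D(3) A z]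
        Q1D(1) x by (simp add: z_def)
  qed
  have "A *\<^sub>v z - Up *\<^sub>v (mat_diag p \<sigma> *\<^sub>v c) = g"
    using mult_minus_distrib_mat_vec[OF A z Vc] AVc[OF c] by (simp add: g_def e_def)
  moreover have "Q2\<^sup>T *\<^sub>v (A *\<^sub>v z) - Q2\<^sup>T *\<^sub>v (Up *\<^sub>v (mat_diag p \<sigma> *\<^sub>v c))
      = Q2\<^sup>T *\<^sub>v (A *\<^sub>v z - Up *\<^sub>v (mat_diag p \<sigma> *\<^sub>v c))"
    using Q2D A z UD diag[OF c]
    by (intro mult_minus_distrib_mat_vec[symmetric, of _ p m]) auto
  ultimately have rest: "(Q2\<^sup>T * A * Q1) *\<^sub>v x - Q2\<^sup>T *\<^sub>v (Up *\<^sub>v (mat_diag p \<sigma> *\<^sub>v c)) = y"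
    unfolding QAQ by (simp add: y_def)
  have Ve: "Vp\<^sup>T *\<^sub>v e = 0\<^sub>v p"
    using mult_minus_distrib_mat_vec[OF VD(3) z Vc] orthonormal_transpose_mult_vec[OF Vp c] c
    by (simp add: e_def c_def)
  have Ug: "(Up *\<^sub>v u) \<bullet> g = 0" if u: "u \<in> carrier_vec p" for u
  proof -
    have Uu: "Up *\<^sub>v u \<in> carrier_vec m" using UD u by auto
    have "(Up *\<^sub>v u) \<bullet> g = (Vp *\<^sub>v (mat_diag p \<sigma> *\<^sub>v u)) \<bullet> e"
      using scalar_prod_transpose(1)[OF A e Uu] AUc[OF u] by (simp add: g_def)
    also have "\<dots> = 0"
      using scalar_prod_transpose(2)[OF VD(1) diag[OF u] e] Ve diag[OF u] by simp
    finally show ?thesis .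
  qed
  have "vec2_norm g \<le> mat2_norm A * (\<delta> * vec2_norm x)"
  proof -
    have "vec2_norm e \<le> \<delta> * vec2_norm x"
      using res1[OF x] by (simp add: e_def c_def z_def)
    hence "mat2_norm A * vec2_norm e \<le> mat2_norm A * (\<delta> * vec2_norm x)"
      by (intro mult_left_mono mat2_norm_ge_0)
    thus ?thesis using mat2_norm_upper[OF A e] by (simp add: g_def)
  qed
  moreover have "vec2_norm y \<le> \<delta> * vec2_norm g"
  proof (rule vec2_norm_le_of_square_le)
    let ?u = "Up\<^sup>T *\<^sub>v (Q2 *\<^sub>v y)"
    let ?r = "Q2 *\<^sub>v y - Up *\<^sub>v ?u"
    have Qy: "Q2 *\<^sub>v y \<in> carrier_vec m" using Q2D y by auto
    have u: "?u \<in> carrier_vec p" using UD Qy by auto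
    have Uu: "Up *\<^sub>v ?u \<in> carrier_vec m" using UD u by auto
    have r: "?r \<in> carrier_vec m" using Qy Uu by auto
    have "(vec2_norm y)\<^sup>2 = (Q2 *\<^sub>v y) \<bullet> g"
      using scalar_prod_transpose(2)[OF Q2D(1) y g] by (simp add: y_def vec2_norm_square)
    also have "\<dots> = ?r \<bullet> g" using minus_scalar_prod_distrib[OF Qy Uu g] Ug[OF u] by simp
    also have "\<dots> \<le> vec2_norm ?r * vec2_norm g" using scalar_prod_le_vec2_norm[OF r g] by simp
    also have "\<dots> \<le> (\<delta> * vec2_norm y) * vec2_norm g" by (intro mult_right_mono res2 y) simp
    finally show "(vec2_norm y)\<^sup>2 \<le> (\<delta> * vec2_norm g) * vec2_norm y" by (simp add: ac_simps)
  qed (use d in simp)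
  ultimately have "vec2_norm y \<le> \<delta> * (mat2_norm A * (\<delta> * vec2_norm x))"
    using mult_left_mono[OF _ d] order_trans by blast
  thus ?thesis using rest by (simp add: c_def z_def power2_eq_square ac_simps)
qed

text \<open>A min-max comparison of \<open>Q2\<^sup>T A Q1\<close> with \<open>\<Sigma>\<close>. The vector \<open>x\<close> from the dimension count has
  coordinates \<open>Vb\<^sup>T x\<close> and \<open>Vp\<^sup>T Q1 x\<close> of which one is supported on leading and the other one on trailing
  positions. The coordinate maps \<open>Vp\<^sup>T Q1\<close> and \<open>Q2\<^sup>T Up\<close> do not increase norms, which bounds a Ritz value
  by \<open>\<sigma> + \<parallel>A\<parallel> \<delta>\<^sup>2\<close> from above. They decrease squared norms at most by the factor \<open>1 - \<delta>\<^sup>2\<close>, and the two of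
  them together cost \<open>\<delta>\<^sup>2 \<sigma> \<le> \<delta>\<^sup>2 \<parallel>A\<parallel>\<close> in the lower bound.\<close>

lemma ritz_value_error:
  fixes A Vp Up Q1 Q2 :: "real mat"
  assumes A: "A \<in> carrier_mat m n"
    and Vp: "orthonormal_cols n p Vp" and Up: "orthonormal_cols m p Up"
    and Q1: "orthonormal_cols n p Q1" and Q2: "orthonormal_cols m p Q2"
    and AV: "A * Vp = Up * mat_diag p \<sigma>" and AU: "A\<^sup>T * Up = Vp * mat_diag p \<sigma>"
    and nonneg: "\<And>i. i < p \<Longrightarrow> 0 \<le> \<sigma> i"
    and res1: "\<And>x. x \<in> carrier_vec p \<Longrightarrow>
      vec2_norm (Q1 *\<^sub>v x - Vp *\<^sub>v (Vp\<^sup>T *\<^sub>v (Q1 *\<^sub>v x))) \<le> \<delta> * vec2_norm x"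
    and res2: "\<And>x. x \<in> carrier_vec p \<Longrightarrow>
      vec2_norm (Q2 *\<^sub>v x - Up *\<^sub>v (Up\<^sup>T *\<^sub>v (Q2 *\<^sub>v x))) \<le> \<delta> * vec2_norm x"
    and res3: "\<And>x. x \<in> carrier_vec p \<Longrightarrow>
      vec2_norm (Up *\<^sub>v x - Q2 *\<^sub>v (Q2\<^sup>T *\<^sub>v (Up *\<^sub>v x))) \<le> \<delta> * vec2_norm x"
    and d: "0 \<le> \<delta>"
    and svd: "is_svd p p (Q2\<^sup>T * A * Q1) Ub st Vb" and order: "same_order p \<sigma> st" and l: "l < p"
  shows "\<bar>st l - \<sigma> l\<bar> \<le> 2 * mat2_norm A * \<delta>\<^sup>2"
proof -
  note VD = orthonormal_colsD[OF Vp] and UD = orthonormal_colsD[OF Up]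
    and Q1D = orthonormal_colsD[OF Q1] and Q2D = orthonormal_colsD[OF Q2]
  let ?B = "Q2\<^sup>T * A * Q1" and ?C = "Vp\<^sup>T * Q1" and ?\<alpha> = "mat2_norm A"
  have Vb: "orthonormal_cols p p Vb" and st: "\<And>i. i < p \<Longrightarrow> 0 \<le> st i"
    using svd by (auto simp: is_svd_def)
  note VbD = orthonormal_colsD[OF Vb]
  have C: "?C \<in> carrier_mat p p" using VD Q1D by auto
  have VbT: "Vb\<^sup>T \<in> carrier_mat p p" using VbD by auto
  have B: "?B \<in> carrier_mat p p" using Q2D A Q1D by auto
  obtain \<tau> where \<tau>: "\<tau> permutes {..<p}"
    and sorted: "\<And>i j. i \<le> j \<Longrightarrow> j < p \<Longrightarrow> \<sigma> (\<tau> j) \<le> \<sigma> (\<tau> i) \<and> st (\<tau> j) \<le> st (\<tau> i)"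
    using order unfolding same_order_def by (metis le_eq_less_or_eq order_refl)
  have "l \<in> \<tau> ` {..<p}" using permutes_image[OF \<tau>] l by simp
  then obtain i where i: "i < p" "l = \<tau> i" by auto
  have mem: "\<tau> j < p" if "j < p" for j using permutes_in_image[OF \<tau>] that by auto
  define \<Sigma> where "\<Sigma> = mat_diag p \<sigma>"
  have \<Sigma>c: "\<Sigma> *\<^sub>v u \<in> carrier_vec p" if "u \<in> carrier_vec p" for u
    unfolding \<Sigma>_def using mult_mat_vec_carrier[OF mat_diag_dim that] .
  have dec: "vec2_norm (?B *\<^sub>v x - Q2\<^sup>T *\<^sub>v (Up *\<^sub>v (\<Sigma> *\<^sub>v (?C *\<^sub>v x)))) \<le> ?\<alpha> * \<delta>\<^sup>2 * vec2_norm x"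
    if x: "x \<in> carrier_vec p" for x
    using ritz_matrix_decomposition[OF A Vp Up Q1 Q2 AV AU res1 res2 d x]
      assoc_mult_mat_vec[OF VD(3) Q1D(1) x] by (simp add: \<Sigma>_def)
  have main_carrier: "Q2\<^sup>T *\<^sub>v (Up *\<^sub>v (\<Sigma> *\<^sub>v (?C *\<^sub>v x))) \<in> carrier_vec p"
    if "x \<in> carrier_vec p" for x
    using Q2D(3) UD(1) \<Sigma>c[OF mult_mat_vec_carrier[OF C that]] by (meson mult_mat_vec_carrier)
  have Bx: "?B *\<^sub>v x \<in> carrier_vec p" if "x \<in> carrier_vec p" for x
    using mult_mat_vec_carrier[OF B that] .
  have C_norm: "vec2_norm (?C *\<^sub>v x) \<le> vec2_norm x" if x: "x \<in> carrier_vec p" for x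
    using vec2_norm_transpose_orthonormal_le[OF Vp, of "Q1 *\<^sub>v x"] vec2_norm_orthonormal[OF Q1 x]
      assoc_mult_mat_vec[OF VD(3) Q1D(1) x] Q1D x by auto
  have Vb_norm: "vec2_norm (Vb\<^sup>T *\<^sub>v x) = vec2_norm x" if x: "x \<in> carrier_vec p" for x
  proof -
    have "orthonormal_cols p p (Vb\<^sup>T)"
      using mat_mult_left_right_inverse[OF VbT VbD(1) VbD(2)] VbD(1) by (simp add: orthonormal_cols_def)
    thus ?thesis using vec2_norm_orthonormal x by blast
  qed
  have pos: "0 < vec2_norm x" if "x \<in> carrier_vec p" "x \<noteq> 0\<^sub>v p" for x
    using vec2_norm_eq_0_iff[OF that(1)] that(2) vec2_norm_ge_0[of x] by linarith
  have upper: "st l \<le> \<sigma> l + ?\<alpha> * \<delta>\<^sup>2"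
  proof -
    obtain x where x: "x \<in> carrier_vec p" "x \<noteq> 0\<^sub>v p"
      "\<And>k. k < p \<Longrightarrow> (Vb\<^sup>T *\<^sub>v x) $ k \<noteq> 0 \<Longrightarrow> \<exists>j\<le>i. k = \<tau> j"
      "\<And>k. k < p \<Longrightarrow> (?C *\<^sub>v x) $ k \<noteq> 0 \<Longrightarrow> \<exists>j. i \<le> j \<and> j < p \<and> k = \<tau> j"
      using courant_fischer_vector[OF VbT C \<tau> i(1)] by metis
    have Vx: "Vb\<^sup>T *\<^sub>v x \<in> carrier_vec p" and Cx: "?C *\<^sub>v x \<in> carrier_vec p"
      using mult_mat_vec_carrier[OF VbT x(1)] mult_mat_vec_carrier[OF C x(1)] by auto
    have "st l * vec2_norm x \<le> vec2_norm (?B *\<^sub>v x)"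
    proof -
      have "st l \<le> \<bar>st k\<bar>" if k: "k < p" "(Vb\<^sup>T *\<^sub>v x) $ k \<noteq> 0" for k
      proof -
        obtain j where "j \<le> i" "k = \<tau> j" using x(3)[OF k] by blast
        thus ?thesis using sorted[of j i] i by force
      qed
      from le_mat_diag_mult_vec[OF Vx st[OF l] this] show ?thesis
        using square_svd_mult_vec_norm[OF svd x(1)] Vb_norm[OF x(1)] by simp
    qed
    also have "\<dots> \<le> ?\<alpha> * \<delta>\<^sup>2 * vec2_norm x + vec2_norm (Q2\<^sup>T *\<^sub>v (Up *\<^sub>v (\<Sigma> *\<^sub>v (?C *\<^sub>v x))))"
      using vec2_norm_triangle_minus[OF Bx main_carrier, of x x] dec[OF x(1)] x(1) by linarith
    also have "vec2_norm (Q2\<^sup>T *\<^sub>v (Up *\<^sub>v (\<Sigma> *\<^sub>v (?C *\<^sub>v x)))) \<le> vec2_norm (\<Sigma> *\<^sub>v (?C *\<^sub>v x))"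
      using vec2_norm_transpose_orthonormal_le[OF Q2 mult_mat_vec_carrier[OF UD(1) \<Sigma>c[OF Cx]]]
        vec2_norm_orthonormal[OF Up \<Sigma>c[OF Cx]] by simp
    also have "\<dots> \<le> \<sigma> l * vec2_norm (?C *\<^sub>v x)"
      unfolding \<Sigma>_def
    proof (rule mat_diag_mult_vec_le[OF Cx nonneg[OF l]])
      fix k assume k: "k < p" "(?C *\<^sub>v x) $ k \<noteq> 0"
      then obtain j where "i \<le> j" "j < p" "k = \<tau> j" using x(4) by blast
      thus "\<bar>\<sigma> k\<bar> \<le> \<sigma> l" using sorted[of i j] i nonneg[OF k(1)] by force
    qed
    also have "\<dots> \<le> \<sigma> l * vec2_norm x" by (intro mult_left_mono C_norm x(1) nonneg l)
    finally have "st l * vec2_norm x \<le> (\<sigma> l + ?\<alpha> * \<delta>\<^sup>2) * vec2_norm x" by (simp add: algebra_simps)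
    thus ?thesis using pos[OF x(1,2)] by simp
  qed
  have lower: "(1 - \<delta>\<^sup>2) * \<sigma> l - ?\<alpha> * \<delta>\<^sup>2 \<le> st l"
  proof (cases "\<delta> \<le> 1")
    case False
    hence "1 - \<delta>\<^sup>2 \<le> 0" by simp
    hence "(1 - \<delta>\<^sup>2) * \<sigma> l \<le> 0" using nonneg[OF l] by (rule mult_nonpos_nonneg)
    moreover have "0 \<le> ?\<alpha> * \<delta>\<^sup>2" using mat2_norm_ge_0 by simp
    ultimately show ?thesis using st[OF l] by linarith
  next
    case True
    have q: "0 \<le> 1 - \<delta>\<^sup>2" using True d by (simp add: abs_square_le_1)
    have shrink: "(1 - \<delta>\<^sup>2) * (vec2_norm u)\<^sup>2 \<le> (vec2_norm (X\<^sup>T *\<^sub>v (Y *\<^sub>v u)))\<^sup>2"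
      if X: "orthonormal_cols N p X" and Y: "orthonormal_cols N p Y" and u: "u \<in> carrier_vec p"
        and le: "vec2_norm (Y *\<^sub>v u - X *\<^sub>v (X\<^sup>T *\<^sub>v (Y *\<^sub>v u))) \<le> \<delta> * vec2_norm u" for N X Y u
    proof -
      have Yu: "Y *\<^sub>v u \<in> carrier_vec N" using orthonormal_colsD[OF Y] u by auto
      have "(vec2_norm u)\<^sup>2 - (vec2_norm (X\<^sup>T *\<^sub>v (Y *\<^sub>v u)))\<^sup>2 \<le> (\<delta> * vec2_norm u)\<^sup>2"
        using power_mono[OF le, of 2] orthonormal_pythagoras[OF X Yu] vec2_norm_orthonormal[OF Y u]
        by simp
      thus ?thesis by (simp add: algebra_simps power_mult_distrib)
    qed
    obtain x where x: "x \<in> carrier_vec p" "x \<noteq> 0\<^sub>v p"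
      "\<And>k. k < p \<Longrightarrow> (?C *\<^sub>v x) $ k \<noteq> 0 \<Longrightarrow> \<exists>j\<le>i. k = \<tau> j"
      "\<And>k. k < p \<Longrightarrow> (Vb\<^sup>T *\<^sub>v x) $ k \<noteq> 0 \<Longrightarrow> \<exists>j. i \<le> j \<and> j < p \<and> k = \<tau> j"
      using courant_fischer_vector[OF C VbT \<tau> i(1)] by metis
    have Vx: "Vb\<^sup>T *\<^sub>v x \<in> carrier_vec p" and Cx: "?C *\<^sub>v x \<in> carrier_vec p"
      using mult_mat_vec_carrier[OF VbT x(1)] mult_mat_vec_carrier[OF C x(1)] by auto
    let ?w = "\<Sigma> *\<^sub>v (?C *\<^sub>v x)"
    have B_le: "vec2_norm (?B *\<^sub>v x) \<le> st l * vec2_norm x"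
    proof -
      have "\<bar>st k\<bar> \<le> st l" if k: "k < p" "(Vb\<^sup>T *\<^sub>v x) $ k \<noteq> 0" for k
      proof -
        obtain j where "i \<le> j" "j < p" "k = \<tau> j" using x(4)[OF k] by blast
        thus ?thesis using sorted[of i j] i st[OF k(1)] by force
      qed
      from mat_diag_mult_vec_le[OF Vx st[OF l] this] show ?thesis
        using square_svd_mult_vec_norm[OF svd x(1)] Vb_norm[OF x(1)] by simp
    qed
    have "(1 - \<delta>\<^sup>2) * \<sigma> l * vec2_norm x \<le> vec2_norm (Q2\<^sup>T *\<^sub>v (Up *\<^sub>v ?w))"
    proof (rule power2_le_imp_le)
      have "\<sigma> l * vec2_norm (?C *\<^sub>v x) \<le> vec2_norm ?w"
        unfolding \<Sigma>_def
      proof (rule le_mat_diag_mult_vec[OF Cx nonneg[OF l]])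
        fix k assume k: "k < p" "(?C *\<^sub>v x) $ k \<noteq> 0"
        then obtain j where "j \<le> i" "k = \<tau> j" using x(3) by blast
        thus "\<sigma> l \<le> \<bar>\<sigma> k\<bar>" using sorted[of j i] i by force
      qed
      hence w: "(\<sigma> l * vec2_norm (?C *\<^sub>v x))\<^sup>2 \<le> (vec2_norm ?w)\<^sup>2"
        using nonneg[OF l] by (intro power_mono) auto
      have "((1 - \<delta>\<^sup>2) * \<sigma> l * vec2_norm x)\<^sup>2
          = (1 - \<delta>\<^sup>2) * (\<sigma> l)\<^sup>2 * ((1 - \<delta>\<^sup>2) * (vec2_norm x)\<^sup>2)"
        by (simp add: power2_eq_square)
      also have "\<dots> \<le> (1 - \<delta>\<^sup>2) * (\<sigma> l)\<^sup>2 * (vec2_norm (?C *\<^sub>v x))\<^sup>2"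
        using shrink[OF Vp Q1 x(1) res1[OF x(1)]] assoc_mult_mat_vec[OF VD(3) Q1D(1) x(1)] q
        by (intro mult_left_mono) auto
      also have "\<dots> = (1 - \<delta>\<^sup>2) * (\<sigma> l * vec2_norm (?C *\<^sub>v x))\<^sup>2" by (simp add: power_mult_distrib)
      also have "\<dots> \<le> (1 - \<delta>\<^sup>2) * (vec2_norm ?w)\<^sup>2" by (rule mult_left_mono[OF w q])
      also have "\<dots> \<le> (vec2_norm (Q2\<^sup>T *\<^sub>v (Up *\<^sub>v ?w)))\<^sup>2"
        using shrink[OF Q2 Up \<Sigma>c[OF Cx] res3[OF \<Sigma>c[OF Cx]]] .
      finally show "((1 - \<delta>\<^sup>2) * \<sigma> l * vec2_norm x)\<^sup>2 \<le> (vec2_norm (Q2\<^sup>T *\<^sub>v (Up *\<^sub>v ?w)))\<^sup>2" .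
    qed simp
    also have "\<dots> \<le> vec2_norm (Q2\<^sup>T *\<^sub>v (Up *\<^sub>v ?w) - ?B *\<^sub>v x) + vec2_norm (?B *\<^sub>v x)"
      by (rule vec2_norm_triangle_minus[OF main_carrier[OF x(1)] Bx[OF x(1)]])
    also have "vec2_norm (Q2\<^sup>T *\<^sub>v (Up *\<^sub>v ?w) - ?B *\<^sub>v x) \<le> ?\<alpha> * \<delta>\<^sup>2 * vec2_norm x"
      using dec[OF x(1)] vec2_norm_minus_commute[OF main_carrier[OF x(1)] Bx[OF x(1)]] by simp
    also note B_le
    finally have "((1 - \<delta>\<^sup>2) * \<sigma> l - ?\<alpha> * \<delta>\<^sup>2) * vec2_norm x \<le> st l * vec2_norm x"
      by (simp add: algebra_simps)
    thus ?thesis using pos[OF x(1,2)] by simp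
  qed
  have "\<sigma> l \<le> ?\<alpha>"
  proof -
    let ?u = "unit_vec p l"
    have "mat_diag p \<sigma> *\<^sub>v ?u = \<sigma> l \<cdot>\<^sub>v ?u"
      using mat_diag_mult_vec_index[of ?u p _ \<sigma>] l by (intro eq_vecI) (auto simp: mat_diag_def simp del: index_mult_mat_vec)
    moreover have "A *\<^sub>v (Vp *\<^sub>v ?u) = Up *\<^sub>v (mat_diag p \<sigma> *\<^sub>v ?u)"
      using assoc_mult_mat_vec[OF A VD(1), of ?u] assoc_mult_mat_vec[OF UD(1) mat_diag_dim, of ?u \<sigma>] AV
      by simp
    moreover have "\<sigma> l \<cdot>\<^sub>v ?u \<in> carrier_vec p" by simp
    ultimately have "vec2_norm (A *\<^sub>v (Vp *\<^sub>v ?u)) = \<sigma> l"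
      using vec2_norm_orthonormal[OF Up, of "\<sigma> l \<cdot>\<^sub>v ?u"] nonneg[OF l] l by (simp add: vec2_norm_unit_vec)
    thus ?thesis
      using mat2_norm_upper[OF A, of "Vp *\<^sub>v ?u"] vec2_norm_orthonormal[OF Vp, of ?u] VD l
      by (simp add: vec2_norm_unit_vec)
  qed
  hence "\<delta>\<^sup>2 * \<sigma> l \<le> \<delta>\<^sup>2 * ?\<alpha>" by (intro mult_left_mono) auto
  moreover have "0 \<le> ?\<alpha> * \<delta>\<^sup>2" using mat2_norm_ge_0 by simp
  ultimately show ?thesis using upper lower by (simp add: algebra_simps abs_le_iff)
qed

section \<open>Columns of block matrices\<close>

lemma col_hcat:
  assumes "B \<in> carrier_mat nr nc1" "C \<in> carrier_mat nr nc2" "j < nc1 + nc2"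
  shows "col (hcat B C) j = (if j < nc1 then col B j else col C (j - nc1))"
  using assms by (intro eq_vecI) (auto simp: hcat_def)

lemma hcat_carrier:
  assumes "B \<in> carrier_mat nr nc1" "C \<in> carrier_mat nr nc2"
  shows "hcat B C \<in> carrier_mat nr (nc1 + nc2)"
  using assms by (auto simp: hcat_def)

lemma col_append_rows:
  assumes "B \<in> carrier_mat nr1 nc" "C \<in> carrier_mat nr2 nc" "j < nc"
  shows "col (B @\<^sub>r C) j = col B j @\<^sub>v col C j"
  using assms by (intro eq_vecI) (auto simp: append_rows_def)

lemma sel_cols_carrier: "M \<in> carrier_mat nr nc \<Longrightarrow> sel_cols M js \<in> carrier_mat nr (length js)"
  by (auto simp: sel_cols_def)

lemma col_sel_cols:
  assumes "M \<in> carrier_mat nr nc" "k < length js"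
  shows "col (sel_cols M js) k = col M (js ! k)"
  using assms unfolding sel_cols_def by (subst col_mat_of_cols) auto

lemma orthonormal_cols_iff:
  assumes "X \<in> carrier_mat N p"
  shows "orthonormal_cols N p X \<longleftrightarrow>
    (\<forall>i<p. \<forall>j<p. col X i \<bullet> col X j = (if i = j then 1 else 0))"
proof -
  have entry: "(X\<^sup>T * X) $$ (i, j) = col X i \<bullet> col X j" if "i < p" "j < p" for i j
    using assms that by simp
  have "X\<^sup>T * X = 1\<^sub>m p \<longleftrightarrow> (\<forall>i<p. \<forall>j<p. col X i \<bullet> col X j = (if i = j then 1 else 0))"
  proof
    assume "X\<^sup>T * X = 1\<^sub>m p"
    thus "\<forall>i<p. \<forall>j<p. col X i \<bullet> col X j = (if i = j then 1 else 0)"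
      using entry by (metis index_one_mat(1))
  next
    assume "\<forall>i<p. \<forall>j<p. col X i \<bullet> col X j = (if i = j then 1 else 0)"
    thus "X\<^sup>T * X = 1\<^sub>m p"
      using assms entry by (intro eq_matI) (auto simp del: index_mult_mat(1))
  qed
  thus ?thesis using assms by (simp add: orthonormal_cols_def)
qed

lemma orthonormal_sel_cols:
  assumes X: "orthonormal_cols N q X" and js: "distinct js" "set js \<subseteq> {..<q}"
  shows "orthonormal_cols N (length js) (sel_cols X js)"
proof -
  note XD = orthonormal_colsD(1)[OF X]
  have "js ! i < q" if "i < length js" for i using js(2) nth_mem[OF that] by auto
  thus ?thesis
    using X nth_eq_iff_index_eq[OF js(1)]
    unfolding orthonormal_cols_iff[OF sel_cols_carrier[OF XD]] orthonormal_cols_iff[OF XD]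
    by (auto simp: col_sel_cols[OF XD])
qed

lemma mult_eq_mult_mat_diagI:
  fixes B F G :: "real mat"
  assumes B: "B \<in> carrier_mat nr nc" and F: "F \<in> carrier_mat nc p" and G: "G \<in> carrier_mat nr p"
    and cols: "\<And>i. i < p \<Longrightarrow> B *\<^sub>v col F i = f i \<cdot>\<^sub>v col G i"
  shows "B * F = G * mat_diag p f"
proof (rule mat_col_eqI)
  fix i assume "i < dim_col (G * mat_diag p f)"
  hence i: "i < p" by (simp add: mat_diag_def)
  have "col (mat_diag p f) i = f i \<cdot>\<^sub>v unit_vec p i"
    using i by (intro eq_vecI) (auto simp: mat_diag_def)
  hence "col (G * mat_diag p f) i = f i \<cdot>\<^sub>v col G i"
    using col_mult2[OF G mat_diag_dim i] mult_mat_vec[OF G, of "unit_vec p i"] mult_mat_unit_vec[OF G i] by simp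
  thus "col (B * F) i = col (G * mat_diag p f) i" using col_mult2[OF B F i] cols[OF i] by simp
qed (use B F G in \<open>auto simp: mat_diag_def\<close>)

section \<open>The augmented matrix\<close>

lemma svd_mult_right_singular:
  assumes svd: "is_svd m n A U s V" and A: "A \<in> carrier_mat m n" and mn: "n \<le> m" and j: "j < n"
  shows "A *\<^sub>v col V j = s j \<cdot>\<^sub>v col U j"
proof -
  define D where "D = mat_diag n s @\<^sub>r 0\<^sub>m (m - n) n"
  have U: "orthonormal_cols m m U" and V: "orthonormal_cols n n V" and A_eq: "A = U * D * V\<^sup>T"
    using svd by (auto simp: is_svd_def D_def)
  note UD = orthonormal_colsD[OF U] and VD = orthonormal_colsD[OF V]
  have D: "D \<in> carrier_mat m n" unfolding D_def using mn
    by (metis carrier_append_rows le_add_diff_inverse mat_diag_dim zero_carrier_mat)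
  have "col V j = V *\<^sub>v unit_vec n j" using mult_mat_unit_vec[OF VD(1) j] by simp
  hence Vj: "V\<^sup>T *\<^sub>v col V j = unit_vec n j" using orthonormal_transpose_mult_vec[OF V, of "unit_vec n j"] by simp
  have "A *\<^sub>v col V j = (U * D) *\<^sub>v unit_vec n j"
    unfolding A_eq using UD(1) D VD j Vj
    by (subst assoc_mult_mat_vec[of "U * D" m n "V\<^sup>T" n]) auto
  also have "\<dots> = U *\<^sub>v col D j"
    using mult_mat_unit_vec[OF D j] assoc_mult_mat_vec[OF UD(1) D, of "unit_vec n j"] by simp
  also have "col D j = s j \<cdot>\<^sub>v unit_vec m j"
    using mn j by (intro eq_vecI) (auto simp: D_def append_rows_def mat_diag_def)
  also have "U *\<^sub>v (s j \<cdot>\<^sub>v unit_vec m j) = s j \<cdot>\<^sub>v col U j"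
    using mult_mat_vec[OF UD(1), of "unit_vec m j"] mult_mat_unit_vec[OF UD(1), of j] j mn by simp
  finally show ?thesis .
qed

lemma svd_mult_left_singular:
  assumes svd: "is_svd m n A U s V" and A: "A \<in> carrier_mat m n" and mn: "n \<le> m" and i: "i < m"
  shows "A\<^sup>T *\<^sub>v col U i = (if i < n then s i \<cdot>\<^sub>v col V i else 0\<^sub>v n)"
proof -
  define D where "D = mat_diag n s @\<^sub>r 0\<^sub>m (m - n) n"
  have U: "orthonormal_cols m m U" and V: "orthonormal_cols n n V" and A_eq: "A = U * D * V\<^sup>T"
    using svd by (auto simp: is_svd_def D_def)
  note UD = orthonormal_colsD[OF U] and VD = orthonormal_colsD[OF V]
  have D: "D \<in> carrier_mat m n" unfolding D_def using mn
    by (metis carrier_append_rows le_add_diff_inverse mat_diag_dim zero_carrier_mat)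
  have DT: "D\<^sup>T \<in> carrier_mat n m" using D by simp
  have "col U i = U *\<^sub>v unit_vec m i" using mult_mat_unit_vec[OF UD(1) i] by simp
  hence Ui: "U\<^sup>T *\<^sub>v col U i = unit_vec m i" using orthonormal_transpose_mult_vec[OF U, of "unit_vec m i"] by simp
  have colU: "col U i \<in> carrier_vec m" using UD i by auto
  have "A\<^sup>T = V * (U * D)\<^sup>T"
    unfolding A_eq using transpose_mult[OF mult_carrier_mat[OF UD(1) D] VD(3)] by simp
  also have "\<dots> = V * (D\<^sup>T * U\<^sup>T)" using transpose_mult[OF UD(1) D] by simp
  finally have "A\<^sup>T *\<^sub>v col U i = V *\<^sub>v ((D\<^sup>T * U\<^sup>T) *\<^sub>v col U i)"
    using assoc_mult_mat_vec[OF VD(1) mult_carrier_mat[OF DT UD(3)] colU] by simp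
  also have "(D\<^sup>T * U\<^sup>T) *\<^sub>v col U i = col D\<^sup>T i"
    using assoc_mult_mat_vec[OF DT UD(3) colU] Ui mult_mat_unit_vec[OF DT i] by simp
  also have "col D\<^sup>T i = (if i < n then s i \<cdot>\<^sub>v unit_vec n i else 0\<^sub>v n)"
    using mn i by (intro eq_vecI) (auto simp: D_def append_rows_def mat_diag_def)
  also have "V *\<^sub>v (if i < n then s i \<cdot>\<^sub>v unit_vec n i else 0\<^sub>v n)
      = (if i < n then s i \<cdot>\<^sub>v col V i else 0\<^sub>v n)"
  proof (cases "i < n")
    case True
    thus ?thesis using mult_mat_vec[OF VD(1), of "unit_vec n i"] mult_mat_unit_vec[OF VD(1), of i] by simp
  next
    case False
    have "V *\<^sub>v 0\<^sub>v n = 0\<^sub>v n" using VD(1) by (intro eq_vecI) auto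
    thus ?thesis using False by simp
  qed
  finally show ?thesis .
qed

lemma aug_eigvecs_carrier:
  assumes "U \<in> carrier_mat m m" "V \<in> carrier_mat n n" "n \<le> m"
  shows "aug_eigvecs m n U V \<in> carrier_mat (n + m) (n + m)"
proof -
  have "hcat V (hcat V (0\<^sub>m n (m - n))) \<in> carrier_mat n (n + (n + (m - n)))"
    using assms by (intro hcat_carrier) auto
  moreover have "hcat (sel_cols U [0..<n]) (hcat (- sel_cols U [0..<n]) (sqrt 2 \<cdot>\<^sub>m sel_cols U [n..<m]))
      \<in> carrier_mat m (n + (n + (m - n)))"
    using sel_cols_carrier[OF assms(1), of "[0..<n]"] sel_cols_carrier[OF assms(1), of "[n..<m]"]
    by (intro hcat_carrier) auto
  ultimately show ?thesis using assms(3) unfolding aug_eigvecs_def Let_def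
    by (metis carrier_append_rows le_add_diff_inverse smult_carrier_mat)
qed

lemma col_aug_eigvecs:
  assumes U: "U \<in> carrier_mat m m" and V: "V \<in> carrier_mat n n" and mn: "n \<le> m" and j: "j < n + m"
  shows "col (aug_eigvecs m n U V) j = (1 / sqrt 2) \<cdot>\<^sub>v
    ((if j < n then col V j else if j < 2 * n then col V (j - n) else 0\<^sub>v n) @\<^sub>v
     (if j < n then col U j else if j < 2 * n then - col U (j - n) else sqrt 2 \<cdot>\<^sub>v col U (j - n)))"
proof -
  let ?U1 = "sel_cols U [0..<n]" and ?U2 = "sel_cols U [n..<m]"
  let ?T = "hcat V (hcat V (0\<^sub>m n (m - n)))" and ?B = "hcat ?U1 (hcat (- ?U1) (sqrt 2 \<cdot>\<^sub>m ?U2))"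
  have U1: "?U1 \<in> carrier_mat m n" and U2: "?U2 \<in> carrier_mat m (m - n)"
    using sel_cols_carrier[OF U, of "[0..<n]"] sel_cols_carrier[OF U, of "[n..<m]"] by simp_all
  have T2: "hcat V (0\<^sub>m n (m - n)) \<in> carrier_mat n (n + (m - n))"
    using V by (intro hcat_carrier) auto
  have B2: "hcat (- ?U1) (sqrt 2 \<cdot>\<^sub>m ?U2) \<in> carrier_mat m (n + (m - n))"
    using U1 U2 by (intro hcat_carrier) auto
  have T: "?T \<in> carrier_mat n (n + m)" and B: "?B \<in> carrier_mat m (n + m)"
    using hcat_carrier[OF V T2] hcat_carrier[OF U1 B2] mn by simp_all
  have "col (aug_eigvecs m n U V) j = (1 / sqrt 2) \<cdot>\<^sub>v (col ?T j @\<^sub>v col ?B j)"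
    using col_append_rows[OF T B j] carrier_append_rows[OF T B] j
    by (simp add: aug_eigvecs_def Let_def)
  also have "col ?T j = (if j < n then col V j else if j < 2 * n then col V (j - n) else 0\<^sub>v n)"
    using col_hcat[OF V T2, of j] col_hcat[OF V zero_carrier_mat[of n "m - n"], of "j - n"] mn j by auto
  also have "col ?B j = (if j < n then col U j else if j < 2 * n then - col U (j - n) else sqrt 2 \<cdot>\<^sub>v col U (j - n))"
  proof -
    have mU1: "- ?U1 \<in> carrier_mat m n" and sU2: "sqrt 2 \<cdot>\<^sub>m ?U2 \<in> carrier_mat m (m - n)"
      using U1 U2 by auto
    have c1: "col ?U1 k = col U k" if "k < n" for k using col_sel_cols[OF U, of k "[0..<n]"] that by simp
    have c2: "col (- ?U1) k = - col U k" if "k < n" for k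
      using c1[OF that] U1 that by (metis carrier_matD(2) col_uminus)
    have c3: "col (sqrt 2 \<cdot>\<^sub>m ?U2) k = sqrt 2 \<cdot>\<^sub>v col U (n + k)" if "k < m - n" for k
      using col_sel_cols[OF U, of k "[n..<m]"] U2 that by simp
    show ?thesis
      using col_hcat[OF U1 B2, of j] col_hcat[OF mU1 sU2, of "j - n"] c1[of j] c2[of "j - n"]
        c3[of "j - 2 * n"] mn j
      by (auto simp: mult_2)
  qed
  finally show ?thesis .
qed

lemma aug_mat_mult_append:
  assumes A: "A \<in> carrier_mat m n" and x: "x \<in> carrier_vec n" and y: "y \<in> carrier_vec m"
  shows "aug_mat m n A *\<^sub>v (x @\<^sub>v y) = (A\<^sup>T *\<^sub>v y) @\<^sub>v (A *\<^sub>v x)"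
proof -
  have "0\<^sub>m n n *\<^sub>v x = 0\<^sub>v n" "0\<^sub>m m m *\<^sub>v y = 0\<^sub>v m" using x y by (auto intro!: eq_vecI)
  moreover have "A\<^sup>T *\<^sub>v y \<in> carrier_vec n" "A *\<^sub>v x \<in> carrier_vec m" using A x y by auto
  ultimately show ?thesis
    unfolding aug_mat_def using A x y
      four_block_mat_mult_vec[of "0\<^sub>m n n" n n "A\<^sup>T" m A m "0\<^sub>m m m" x y] by simp
qed

lemma smult_append_vec: "c \<cdot>\<^sub>v (x @\<^sub>v y) = (c \<cdot>\<^sub>v x) @\<^sub>v (c \<cdot>\<^sub>v (y :: real vec))"
  by (intro eq_vecI) auto

text \<open>The columns of \<open>aug_eigvecs\<close> pair the singular vectors as \<open>(v, u)\<close> and \<open>(v, - u)\<close>. The augmented matrix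
  swaps the two blocks up to the factor \<open>s\<close>, which turns the sign into the sign of the eigenvalue. The
  left singular vectors beyond the first \<open>n\<close> are annihilated by \<open>A\<^sup>T\<close>.\<close>

lemma aug_mat_eigenvector:
  assumes svd: "is_svd m n A U s V" and A: "A \<in> carrier_mat m n" and mn: "n \<le> m" and j: "j < n + m"
  shows "aug_mat m n A *\<^sub>v col (aug_eigvecs m n U V) j
    = aug_eigval n s j \<cdot>\<^sub>v col (aug_eigvecs m n U V) j"
proof -
  have U: "U \<in> carrier_mat m m" and V: "V \<in> carrier_mat n n"
    using svd orthonormal_colsD(1) by (auto simp: is_svd_def)
  have SA: "aug_mat m n A \<in> carrier_mat (n + m) (n + m)" using A by (simp add: aug_mat_def)
  define x where "x = (if j < n then col V j else if j < 2 * n then col V (j - n) else 0\<^sub>v n)"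
  define y where "y = (if j < n then col U j else if j < 2 * n then - col U (j - n) else sqrt 2 \<cdot>\<^sub>v col U (j - n))"
  have x: "x \<in> carrier_vec n" and y: "y \<in> carrier_vec m" using U V mn j by (auto simp: x_def y_def)
  have col_eq: "col (aug_eigvecs m n U V) j = (1 / sqrt 2) \<cdot>\<^sub>v (x @\<^sub>v y)"
    using col_aug_eigvecs[OF U V mn j] by (simp add: x_def y_def)
  have cV: "col V k \<in> carrier_vec n" if "k < n" for k using V that by auto
  have cU: "col U k \<in> carrier_vec m" if "k < m" for k using U that by auto
  have Ax: "A *\<^sub>v x = aug_eigval n s j \<cdot>\<^sub>v y"
  proof -
    have "A *\<^sub>v 0\<^sub>v n = 0\<^sub>v m" using A by (intro eq_vecI) auto
    moreover have "0 \<cdot>\<^sub>v (sqrt 2 \<cdot>\<^sub>v col U (j - n)) = 0\<^sub>v m" if "\<not> j < 2 * n"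
      using U by (intro eq_vecI) auto
    moreover have "t \<cdot>\<^sub>v v = - t \<cdot>\<^sub>v (- v)" for t :: real and v by (intro eq_vecI) auto
    ultimately show ?thesis
      using svd_mult_right_singular[OF svd A mn, of j] svd_mult_right_singular[OF svd A mn, of "j - n"]
      by (auto simp: x_def y_def aug_eigval_def)
  qed
  have Ay: "A\<^sup>T *\<^sub>v y = aug_eigval n s j \<cdot>\<^sub>v x"
  proof -
    have AT: "A\<^sup>T \<in> carrier_mat n m" using A by simp
    have neg: "A\<^sup>T *\<^sub>v (- v) = - (A\<^sup>T *\<^sub>v v)" "A\<^sup>T *\<^sub>v (c \<cdot>\<^sub>v v) = c \<cdot>\<^sub>v (A\<^sup>T *\<^sub>v v)"
      if "v \<in> carrier_vec m" for v c
    proof -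
      show smult: "A\<^sup>T *\<^sub>v (c \<cdot>\<^sub>v v) = c \<cdot>\<^sub>v (A\<^sup>T *\<^sub>v v)" for c by (rule mult_mat_vec[OF AT that])
      have "- w = (-1) \<cdot>\<^sub>v w" for w :: "real vec" by (intro eq_vecI) auto
      thus "A\<^sup>T *\<^sub>v (- v) = - (A\<^sup>T *\<^sub>v v)" using smult[of "-1"] by simp
    qed
    have "- (t \<cdot>\<^sub>v v) = - t \<cdot>\<^sub>v v" for t :: real and v by (intro eq_vecI) auto
    moreover have "c \<cdot>\<^sub>v 0\<^sub>v n = 0\<^sub>v n" for c :: real by (intro eq_vecI) auto
    moreover have "0 \<cdot>\<^sub>v 0\<^sub>v n = (0\<^sub>v n :: real vec)" by (intro eq_vecI) auto
    ultimately show ?thesis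
      using svd_mult_left_singular[OF svd A mn, of j] svd_mult_left_singular[OF svd A mn, of "j - n"]
        neg[OF cU[of "j - n"]] j mn
      by (auto simp: x_def y_def aug_eigval_def)
  qed
  have xy: "x @\<^sub>v y \<in> carrier_vec (n + m)" using x y by auto
  have "aug_mat m n A *\<^sub>v (x @\<^sub>v y) = aug_eigval n s j \<cdot>\<^sub>v (x @\<^sub>v y)"
    using aug_mat_mult_append[OF A x y] Ax Ay by (simp add: smult_append_vec)
  thus ?thesis unfolding col_eq using mult_mat_vec[OF SA xy] by (simp add: smult_smult_assoc mult.commute)
qed

lemma orthonormal_aug_eigvecs:
  assumes U: "orthonormal_cols m m U" and V: "orthonormal_cols n n V" and mn: "n \<le> m"
  shows "orthonormal_cols (n + m) (n + m) (aug_eigvecs m n U V)"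
proof -
  note UD = orthonormal_colsD(1)[OF U] and VD = orthonormal_colsD(1)[OF V]
  let ?x = "\<lambda>j. if j < n then col V j else if j < 2 * n then col V (j - n) else 0\<^sub>v n"
  let ?y = "\<lambda>j. if j < n then col U j else if j < 2 * n then - col U (j - n) else sqrt 2 \<cdot>\<^sub>v col U (j - n)"
  have VV: "col V i \<bullet> col V j = (if i = j then 1 else 0)" if "i < n" "j < n" for i j
    using V that unfolding orthonormal_cols_iff[OF VD] by blast
  have UU: "col U i \<bullet> col U j = (if i = j then 1 else 0)" if "i < m" "j < m" for i j
    using U that unfolding orthonormal_cols_iff[OF UD] by blast
  have cV: "col V k \<in> carrier_vec n" for k using VD by (metis carrier_matD(1) col_dim)
  have cU: "col U k \<in> carrier_vec m" for k using UD by (metis carrier_matD(1) col_dim)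
  have x: "?x j \<in> carrier_vec n" and y: "?y j \<in> carrier_vec m" for j using cV cU by auto
  have dU: "dim_vec (col U k) = m" and dV: "dim_vec (col V k) = n" for k using UD VD by auto
  have prod: "?x i \<bullet> ?x j + ?y i \<bullet> ?y j = (if i = j then 2 else 0)" if ij: "i < n + m" "j < n + m" for i j
  proof -
    consider "i < n" | "n \<le> i" "i < 2 * n" | "2 * n \<le> i" by linarith
    thus ?thesis
    proof cases
      case 1
      consider "j < n" | "n \<le> j" "j < 2 * n" | "2 * n \<le> j" by linarith
      thus ?thesis using 1 ij mn by cases (auto simp: VV UU dU dV scalar_prod_right_zero[OF cV])
    next
      case 2
      consider "j < n" | "n \<le> j" "j < 2 * n" | "2 * n \<le> j" by linarith
      thus ?thesis using 2 ij mn by cases (auto simp: VV UU dU dV scalar_prod_right_zero[OF cV])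
    next
      case 3
      consider "j < n" | "n \<le> j" "j < 2 * n" | "2 * n \<le> j" by linarith
      thus ?thesis using 3 ij mn by cases (auto simp: VV UU dU dV scalar_prod_left_zero[OF cV])
    qed
  qed
  show ?thesis unfolding orthonormal_cols_iff[OF aug_eigvecs_carrier[OF UD VD mn]]
  proof (intro allI impI)
    fix i j assume ij: "i < n + m" "j < n + m"
    have half: "((1 / sqrt 2) \<cdot>\<^sub>v v) \<bullet> ((1 / sqrt 2) \<cdot>\<^sub>v w) = 1 / 2 * (v \<bullet> w)"
      if "v \<in> carrier_vec (n + m)" "w \<in> carrier_vec (n + m)" for v w :: "real vec"
      using that by simp
    have "col (aug_eigvecs m n U V) i \<bullet> col (aug_eigvecs m n U V) j
        = 1 / 2 * ((?x i @\<^sub>v ?y i) \<bullet> (?x j @\<^sub>v ?y j))"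
      unfolding col_aug_eigvecs[OF UD VD mn ij(1)] col_aug_eigvecs[OF UD VD mn ij(2)]
      by (rule half[OF append_carrier_vec[OF x y] append_carrier_vec[OF x y]])
    also have "(?x i @\<^sub>v ?y i) \<bullet> (?x j @\<^sub>v ?y j) = (if i = j then 2 else 0)"
      using scalar_prod_append[OF x y x y] prod[OF ij] by simp
    finally show "col (aug_eigvecs m n U V) i \<bullet> col (aug_eigvecs m n U V) j = (if i = j then 1 else 0)"
      by auto
  qed
qed

lemma pow_mat_eigenvector:
  fixes B :: "real mat"
  assumes B: "B \<in> carrier_mat N N" and v: "v \<in> carrier_vec N" and eig: "B *\<^sub>v v = \<mu> \<cdot>\<^sub>v v"
  shows "(B ^\<^sub>m l) *\<^sub>v v = \<mu> ^ l \<cdot>\<^sub>v v"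
proof (induction l)
  case 0
  show ?case using B v by simp
next
  case (Suc l)
  have "(B ^\<^sub>m Suc l) *\<^sub>v v = (B ^\<^sub>m l) *\<^sub>v (\<mu> \<cdot>\<^sub>v v)"
    using assoc_mult_mat_vec[OF pow_carrier_mat[OF B] B v] eig by simp
  also have "\<dots> = \<mu> \<cdot>\<^sub>v (\<mu> ^ l \<cdot>\<^sub>v v)" using mult_mat_vec[OF pow_carrier_mat[OF B] v] Suc by simp
  finally show ?case by (simp add: smult_smult_assoc)
qed

text \<open>A polynomial of a matrix keeps its eigenvectors. The filter enters the convergence theory only through
  this fact and the resulting eigenvalues.\<close>

lemma mat_poly_eval_eigenvector:
  assumes B: "B \<in> carrier_mat N N" and v: "v \<in> carrier_vec N" and eig: "B *\<^sub>v v = \<mu> \<cdot>\<^sub>v v"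
  shows "mat_poly_eval f B *\<^sub>v v = poly f \<mu> \<cdot>\<^sub>v v"
proof (rule eq_vecI)
  fix i assume "i < dim_vec (poly f \<mu> \<cdot>\<^sub>v v)"
  hence i: "i < N" using v by simp
  have pow: "(\<Sum>j\<in>{0..<N}. (B ^\<^sub>m l) $$ (i, j) * v $ j) = \<mu> ^ l * v $ i" for l
  proof -
    have "(\<Sum>j\<in>{0..<N}. C $$ (i, j) * v $ j) = (C *\<^sub>v v) $ i" if "C \<in> carrier_mat N N" for C
      using that v i by (simp add: scalar_prod_def)
    from this[OF pow_carrier_mat[OF B]] show ?thesis using pow_mat_eigenvector[OF B v eig, of l] v i by simp
  qed
  have "(mat_poly_eval f B *\<^sub>v v) $ i
      = (\<Sum>j\<in>{0..<N}. (\<Sum>l\<le>degree f. coeff f l * (B ^\<^sub>m l) $$ (i, j)) * v $ j)"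
    using B v i by (simp add: mat_poly_eval_def scalar_prod_def)
  also have "\<dots> = (\<Sum>l\<le>degree f. \<Sum>j\<in>{0..<N}. coeff f l * ((B ^\<^sub>m l) $$ (i, j) * v $ j))"
    unfolding sum_distrib_right by (subst sum.swap) (simp add: mult.assoc)
  also have "\<dots> = (\<Sum>l\<le>degree f. coeff f l * (\<mu> ^ l * v $ i))"
    by (simp flip: sum_distrib_left add: pow)
  also have "\<dots> = poly f \<mu> * v $ i" by (simp add: poly_altdef sum_distrib_right mult.assoc)
  finally show "(mat_poly_eval f B *\<^sub>v v) $ i = (poly f \<mu> \<cdot>\<^sub>v v) $ i" using v i by simp
qed (use B v in \<open>simp add: mat_poly_eval_def\<close>)

section \<open>Subspace iteration\<close>

lemma mat_eq_by_vec:
  fixes B C :: "real mat"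
  assumes B: "B \<in> carrier_mat nr nc" and C: "C \<in> carrier_mat nr nc"
    and eq: "\<And>v. v \<in> carrier_vec nc \<Longrightarrow> B *\<^sub>v v = C *\<^sub>v v"
  shows "B = C"
proof (rule mat_col_eqI)
  fix j assume "j < dim_col C"
  hence j: "j < nc" using C by simp
  show "col B j = col C j"
    using eq[of "unit_vec nc j"] mult_mat_unit_vec[OF B j] mult_mat_unit_vec[OF C j] by simp
qed (use B C in auto)

lemma sel_cols_gram_entry:
  assumes "M \<in> carrier_mat N q" "i < N" "j < N" "\<And>k. k < length js \<Longrightarrow> js ! k < q"
  shows "(sel_cols M js * (sel_cols M js)\<^sup>T) $$ (i, j)
    = (\<Sum>k\<in>{0..<length js}. M $$ (i, js ! k) * M $$ (j, js ! k))"
proof -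
  have "sel_cols M js $$ (i, k) = M $$ (i, js ! k)" if "i < N" "k < length js" for i k
    using assms(1) assms(4)[OF that(2)] that by (simp add: sel_cols_def mat_of_cols_index)
  thus ?thesis using sel_cols_carrier[OF assms(1), of js] assms(2,3) by (simp add: scalar_prod_def)
qed

text \<open>Splitting the columns of an orthogonal matrix in an arbitrary order gives two complementary orthonormal
  bases, the wanted and the unwanted part of the eigenvector basis.\<close>

lemma permuted_columns_complement:
  assumes Q: "orthonormal_cols N N Q" and \<pi>: "\<pi> permutes {..<N}" and p: "p \<le> N"
  defines "Qp \<equiv> sel_cols Q (map \<pi> [0..<p])" and "Qc \<equiv> sel_cols Q (map \<pi> [p..<N])"
  shows "orthonormal_cols N p Qp" "orthonormal_cols N (N - p) Qc"
    "Qp * Qp\<^sup>T + Qc * Qc\<^sup>T = 1\<^sub>m N" "Qp\<^sup>T * Qc = 0\<^sub>m p (N - p)"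
proof -
  note QD = orthonormal_colsD[OF Q]
  have mem: "\<pi> k < N" if "k < N" for k using permutes_in_image[OF \<pi>] that by auto
  have inj: "inj_on \<pi> S" for S using permutes_inj_on[OF \<pi>] .
  have sub: "\<pi> ` {0..<p} \<subseteq> {..<N}" "\<pi> ` {p..<N} \<subseteq> {..<N}" using mem p by auto
  show Qp: "orthonormal_cols N p Qp"
    using orthonormal_sel_cols[OF Q, of "map \<pi> [0..<p]"] sub inj by (simp add: Qp_def distinct_map)
  show Qc: "orthonormal_cols N (N - p) Qc"
    using orthonormal_sel_cols[OF Q, of "map \<pi> [p..<N]"] sub inj by (simp add: Qc_def distinct_map)
  note QpD = orthonormal_colsD[OF Qp] and QcD = orthonormal_colsD[OF Qc]
  show "Qp * Qp\<^sup>T + Qc * Qc\<^sup>T = 1\<^sub>m N"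
  proof (rule eq_matI)
    fix i j assume "i < dim_row (1\<^sub>m N :: real mat)" "j < dim_col (1\<^sub>m N :: real mat)"
    hence ij: "i < N" "j < N" by auto
    let ?f = "\<lambda>k. Q $$ (i, k) * Q $$ (j, k)"
    have "(Qp * Qp\<^sup>T) $$ (i, j) = (\<Sum>k\<in>{0..<p}. ?f (\<pi> k))"
      unfolding Qp_def using sel_cols_gram_entry[OF QD(1) ij, of "map \<pi> [0..<p]"] mem p by simp
    moreover have "(Qc * Qc\<^sup>T) $$ (i, j) = (\<Sum>k\<in>{p..<N}. ?f (\<pi> k))"
      unfolding Qc_def using sel_cols_gram_entry[OF QD(1) ij, of "map \<pi> [p..<N]"] mem p
      by (simp add: sum.atLeastLessThan_shift_0[of _ p N])
    ultimately have "(Qp * Qp\<^sup>T + Qc * Qc\<^sup>T) $$ (i, j) = (\<Sum>k\<in>{0..<N}. ?f (\<pi> k))"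
      using QpD QcD ij sum.atLeastLessThan_concat[of 0 p N "\<lambda>k. ?f (\<pi> k)"] p
      by (simp del: index_mult_mat(1))
    also have "\<dots> = (\<Sum>k\<in>{0..<N}. ?f k)"
      using sum.permute[OF \<pi>, of ?f] by (simp add: atLeast0LessThan o_def)
    also have "\<dots> = (Q * Q\<^sup>T) $$ (i, j)" using QD ij by (simp add: scalar_prod_def)
    also have "Q * Q\<^sup>T = 1\<^sub>m N" by (rule mat_mult_left_right_inverse[OF QD(3,1,2)])
    finally show "(Qp * Qp\<^sup>T + Qc * Qc\<^sup>T) $$ (i, j) = 1\<^sub>m N $$ (i, j)" .
  qed (use QpD QcD in auto)
  show "Qp\<^sup>T * Qc = 0\<^sub>m p (N - p)"
  proof (rule eq_matI)
    fix i j assume "i < dim_row (0\<^sub>m p (N - p) :: real mat)" "j < dim_col (0\<^sub>m p (N - p) :: real mat)"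
    hence ij: "i < p" "j < N - p" by auto
    have "(Qp\<^sup>T * Qc) $$ (i, j) = col Qp i \<bullet> col Qc j" using QpD QcD ij by simp
    also have "\<dots> = col Q (\<pi> i) \<bullet> col Q (\<pi> (p + j))"
      using ij p by (simp add: Qp_def Qc_def col_sel_cols[OF QD(1)])
    also have "\<dots> = 0"
      using Q[unfolded orthonormal_cols_iff[OF QD(1)]] mem[of i] mem[of "p + j"] ij p
        inj_onD[OF inj[of UNIV], of i "p + j"] by auto
    finally show "(Qp\<^sup>T * Qc) $$ (i, j) = 0\<^sub>m p (N - p) $$ (i, j)" using ij by simp
  qed (use QpD QcD in auto)
qed

lemma complement_decomposition:
  assumes Qp: "orthonormal_cols N p Qp" and Qc: "orthonormal_cols N q Qc"
    and comp: "Qp * Qp\<^sup>T + Qc * Qc\<^sup>T = 1\<^sub>m N" and v: "v \<in> carrier_vec N"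
  shows "v = Qp *\<^sub>v (Qp\<^sup>T *\<^sub>v v) + Qc *\<^sub>v (Qc\<^sup>T *\<^sub>v v)"
    and "vec2_norm (v - Qp *\<^sub>v (Qp\<^sup>T *\<^sub>v v)) = vec2_norm (Qc\<^sup>T *\<^sub>v v)"
    and "(vec2_norm v)\<^sup>2 = (vec2_norm (Qp\<^sup>T *\<^sub>v v))\<^sup>2 + (vec2_norm (Qc\<^sup>T *\<^sub>v v))\<^sup>2"
proof -
  note QpD = orthonormal_colsD[OF Qp] and QcD = orthonormal_colsD[OF Qc]
  have x: "Qp\<^sup>T *\<^sub>v v \<in> carrier_vec p" and y: "Qc\<^sup>T *\<^sub>v v \<in> carrier_vec q" using QpD QcD v by auto
  have a: "Qp *\<^sub>v (Qp\<^sup>T *\<^sub>v v) \<in> carrier_vec N" and b: "Qc *\<^sub>v (Qc\<^sup>T *\<^sub>v v) \<in> carrier_vec N"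
    using QpD QcD x y by auto
  have "v = (Qp * Qp\<^sup>T + Qc * Qc\<^sup>T) *\<^sub>v v" using comp v by simp
  also have "\<dots> = (Qp * Qp\<^sup>T) *\<^sub>v v + (Qc * Qc\<^sup>T) *\<^sub>v v"
    using QpD QcD v by (intro add_mult_distrib_mat_vec[of _ N N]) auto
  finally show eq: "v = Qp *\<^sub>v (Qp\<^sup>T *\<^sub>v v) + Qc *\<^sub>v (Qc\<^sup>T *\<^sub>v v)" using QpD QcD v by simp
  have cancel: "s + t - s = t" if "s \<in> carrier_vec N" "t \<in> carrier_vec N" for s t :: "real vec"
    using that by (intro eq_vecI) auto
  have "v - Qp *\<^sub>v (Qp\<^sup>T *\<^sub>v v) = Qc *\<^sub>v (Qc\<^sup>T *\<^sub>v v)"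
    using cancel[OF a b] eq by simp
  thus res: "vec2_norm (v - Qp *\<^sub>v (Qp\<^sup>T *\<^sub>v v)) = vec2_norm (Qc\<^sup>T *\<^sub>v v)"
    using vec2_norm_orthonormal[OF Qc y] by simp
  show "(vec2_norm v)\<^sup>2 = (vec2_norm (Qp\<^sup>T *\<^sub>v v))\<^sup>2 + (vec2_norm (Qc\<^sup>T *\<^sub>v v))\<^sup>2"
    using orthonormal_pythagoras[OF Qp v] res by simp
qed

text \<open>In the coordinates \<open>X\<^sub>k = Qp\<^sup>T T\<^sub>k\<close>, \<open>Y\<^sub>k = Qc\<^sup>T T\<^sub>k\<close> one step multiplies \<open>X\<close> and \<open>Y\<close> by the two
  diagonal blocks of \<open>P\<close> and then changes the basis from the right by \<open>R\<^sup>-\<^sup>1\<close>. The slope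
  \<open>Y\<^sub>k X\<^sub>k\<^sup>-\<^sup>1\<close> does not depend on the basis, so it only picks up the diagonal blocks. By
  induction \<open>X\<^sub>k\<^sub>+\<^sub>1 R\<close> is a product of invertible matrices, so both factors are invertible.\<close>

lemma subspace_iteration_slope:
  fixes T R :: "nat \<Rightarrow> real mat"
  assumes Qp: "orthonormal_cols N p Qp" and Qc: "orthonormal_cols N q Qc"
    and comp: "Qp * Qp\<^sup>T + Qc * Qc\<^sup>T = 1\<^sub>m N" and cross: "Qp\<^sup>T * Qc = 0\<^sub>m p q"
    and P: "P \<in> carrier_mat N N"
    and PQp: "P * Qp = Qp * mat_diag p g" and PQc: "P * Qc = Qc * mat_diag q h"
    and g: "\<And>i. i < p \<Longrightarrow> g i \<noteq> 0"
    and T: "\<And>k. T k \<in> carrier_mat N p" and R: "\<And>k. R (Suc k) \<in> carrier_mat p p"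
    and step: "\<And>k. P * T k = T (Suc k) * R (Suc k)"
    and X0: "H0 \<in> carrier_mat p p" "(Qp\<^sup>T * T 0) * H0 = 1\<^sub>m p"
  shows "\<exists>H\<in>carrier_mat p p. (Qp\<^sup>T * T k) * H = 1\<^sub>m p \<and>
    Qc\<^sup>T * T k = mat q p (\<lambda>(i, j). h i ^ k * ((Qc\<^sup>T * T 0) * H0) $$ (i, j) * (1 / g j) ^ k) * (Qp\<^sup>T * T k)"
proof -
  note QpD = orthonormal_colsD[OF Qp] and QcD = orthonormal_colsD[OF Qc]
  define G where "G = mat_diag p g"
  define D where "D = mat_diag q h"
  have G: "G \<in> carrier_mat p p" and D: "D \<in> carrier_mat q q" by (simp_all add: G_def D_def)
  define X where "X k = Qp\<^sup>T * T k" for k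
  define Y where "Y k = Qc\<^sup>T * T k" for k
  define E0 where "E0 = Y 0 * H0"
  define E where "E k = mat q p (\<lambda>(i, j). h i ^ k * E0 $$ (i, j) * (1 / g j) ^ k)" for k
  have X: "X k \<in> carrier_mat p p" and Y: "Y k \<in> carrier_mat q p" for k
    unfolding X_def Y_def using mult_carrier_mat[OF QpD(3) T] mult_carrier_mat[OF QcD(3) T] by auto
  have E: "E k \<in> carrier_mat q p" for k by (simp add: E_def)
  have E0: "E0 \<in> carrier_mat q p" unfolding E0_def by (rule mult_carrier_mat[OF Y X0(1)])
  have cross': "Qc\<^sup>T * Qp = 0\<^sub>m q p"
    using arg_cong[OF cross, of transpose_mat] transpose_mult[OF QpD(3) QcD(1)] by simp
  have P_coord: "Qp\<^sup>T *\<^sub>v (P *\<^sub>v v) = G *\<^sub>v (Qp\<^sup>T *\<^sub>v v)" "Qc\<^sup>T *\<^sub>v (P *\<^sub>v v) = D *\<^sub>v (Qc\<^sup>T *\<^sub>v v)"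
    if v: "v \<in> carrier_vec N" for v
  proof -
    define x where "x = Qp\<^sup>T *\<^sub>v v"
    define y where "y = Qc\<^sup>T *\<^sub>v v"
    have x: "x \<in> carrier_vec p" and y: "y \<in> carrier_vec q" using QpD QcD v by (auto simp: x_def y_def)
    have Gx: "G *\<^sub>v x \<in> carrier_vec p" and Dy: "D *\<^sub>v y \<in> carrier_vec q"
      using mult_mat_vec_carrier[OF G x] mult_mat_vec_carrier[OF D y] by auto
    have Qx: "Qp *\<^sub>v x \<in> carrier_vec N" "Qc *\<^sub>v y \<in> carrier_vec N"
      "Qp *\<^sub>v (G *\<^sub>v x) \<in> carrier_vec N" "Qc *\<^sub>v (D *\<^sub>v y) \<in> carrier_vec N"
      using mult_mat_vec_carrier[OF QpD(1)] mult_mat_vec_carrier[OF QcD(1)] x y Gx Dy by auto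
    have "P *\<^sub>v v = P *\<^sub>v (Qp *\<^sub>v x) + P *\<^sub>v (Qc *\<^sub>v y)"
      using complement_decomposition(1)[OF Qp Qc comp v] mult_add_distrib_mat_vec[OF P Qx(1,2)]
      by (simp add: x_def y_def)
    also have "P *\<^sub>v (Qp *\<^sub>v x) = Qp *\<^sub>v (G *\<^sub>v x)"
      using assoc_mult_mat_vec[OF P QpD(1) x] PQp assoc_mult_mat_vec[OF QpD(1) G x] by (simp add: G_def)
    also have "P *\<^sub>v (Qc *\<^sub>v y) = Qc *\<^sub>v (D *\<^sub>v y)"
      using assoc_mult_mat_vec[OF P QcD(1) y] PQc assoc_mult_mat_vec[OF QcD(1) D y] by (simp add: D_def)
    finally have Pv: "P *\<^sub>v v = Qp *\<^sub>v (G *\<^sub>v x) + Qc *\<^sub>v (D *\<^sub>v y)" .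
    have zero: "0\<^sub>m a b *\<^sub>v u = 0\<^sub>v a" if "u \<in> carrier_vec b" for a b and u :: "real vec"
      using that by (intro eq_vecI) auto
    have "Qp\<^sup>T *\<^sub>v (P *\<^sub>v v) = Qp\<^sup>T *\<^sub>v (Qp *\<^sub>v (G *\<^sub>v x)) + Qp\<^sup>T *\<^sub>v (Qc *\<^sub>v (D *\<^sub>v y))"
      unfolding Pv by (rule mult_add_distrib_mat_vec[OF QpD(3) Qx(3,4)])
    also have "Qp\<^sup>T *\<^sub>v (Qc *\<^sub>v (D *\<^sub>v y)) = 0\<^sub>v p"
      using assoc_mult_mat_vec[OF QpD(3) QcD(1) Dy] cross zero[OF Dy] by simp
    finally show "Qp\<^sup>T *\<^sub>v (P *\<^sub>v v) = G *\<^sub>v (Qp\<^sup>T *\<^sub>v v)"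
      using orthonormal_transpose_mult_vec[OF Qp Gx] Gx by (simp add: x_def)
    have "Qc\<^sup>T *\<^sub>v (P *\<^sub>v v) = Qc\<^sup>T *\<^sub>v (Qp *\<^sub>v (G *\<^sub>v x)) + Qc\<^sup>T *\<^sub>v (Qc *\<^sub>v (D *\<^sub>v y))"
      unfolding Pv by (rule mult_add_distrib_mat_vec[OF QcD(3) Qx(3,4)])
    also have "Qc\<^sup>T *\<^sub>v (Qp *\<^sub>v (G *\<^sub>v x)) = 0\<^sub>v q"
      using assoc_mult_mat_vec[OF QcD(3) QpD(1) Gx] cross' zero[OF Gx] by simp
    finally show "Qc\<^sup>T *\<^sub>v (P *\<^sub>v v) = D *\<^sub>v (Qc\<^sup>T *\<^sub>v v)"
      using orthonormal_transpose_mult_vec[OF Qc Dy] Dy by (simp add: y_def)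
  qed
  have XR: "X (Suc k) *\<^sub>v (R (Suc k) *\<^sub>v w) = G *\<^sub>v (X k *\<^sub>v w)"
    and YR: "Y (Suc k) *\<^sub>v (R (Suc k) *\<^sub>v w) = D *\<^sub>v (Y k *\<^sub>v w)" if w: "w \<in> carrier_vec p" for k w
  proof -
    have Rw: "R (Suc k) *\<^sub>v w \<in> carrier_vec p" and Tw: "T k *\<^sub>v w \<in> carrier_vec N"
      using mult_mat_vec_carrier[OF R w] mult_mat_vec_carrier[OF T w] by auto
    have TR: "T (Suc k) *\<^sub>v (R (Suc k) *\<^sub>v w) = P *\<^sub>v (T k *\<^sub>v w)"
      using assoc_mult_mat_vec[OF T R w, of "Suc k" k] assoc_mult_mat_vec[OF P T w, of k] step[of k] by simp
    show "X (Suc k) *\<^sub>v (R (Suc k) *\<^sub>v w) = G *\<^sub>v (X k *\<^sub>v w)"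
      unfolding X_def using assoc_mult_mat_vec[OF QpD(3) T Rw, of "Suc k"] assoc_mult_mat_vec[OF QpD(3) T w, of k]
        TR P_coord(1)[OF Tw] by simp
    show "Y (Suc k) *\<^sub>v (R (Suc k) *\<^sub>v w) = D *\<^sub>v (Y k *\<^sub>v w)"
      unfolding Y_def using assoc_mult_mat_vec[OF QcD(3) T Rw, of "Suc k"] assoc_mult_mat_vec[OF QcD(3) T w, of k]
        TR P_coord(2)[OF Tw] by simp
  qed
  define Gi where "Gi = mat_diag p (\<lambda>i. 1 / g i)"
  have Gi: "Gi \<in> carrier_mat p p" by (simp add: Gi_def)
  have "G * Gi = mat_diag p (\<lambda>i. g i * (1 / g i))" by (simp add: G_def Gi_def)
  also have "\<dots> = 1\<^sub>m p" using g by (intro eq_matI) (auto simp: mat_diag_def)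
  finally have GGi: "G * Gi = 1\<^sub>m p" .
  have "\<exists>H\<in>carrier_mat p p. X k * H = 1\<^sub>m p \<and> Y k = E k * X k"
  proof (induction k)
    case 0
    have "E 0 = E0" using E0 by (intro eq_matI) (auto simp: E_def)
    moreover have "H0 * X 0 = 1\<^sub>m p" by (rule mat_mult_left_right_inverse[OF X X0(1)]) (use X0 X_def in simp)
    hence "E0 * X 0 = Y 0" using assoc_mult_mat[OF Y X0(1) X, of 0 0] right_mult_one_mat[OF Y]
      by (simp add: E0_def)
    ultimately show ?case using X0 by (auto simp: X_def)
  next
    case (Suc k)
    then obtain H where H: "H \<in> carrier_mat p p" "X k * H = 1\<^sub>m p" and Yk: "Y k = E k * X k" by blast
    let ?R = "R (Suc k)" and ?X = "X (Suc k)"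
    have HGi: "H * Gi \<in> carrier_mat p p" using H Gi by auto
    define H' where "H' = ?R * (H * Gi)"
    have H': "H' \<in> carrier_mat p p" unfolding H'_def by (rule mult_carrier_mat[OF R HGi])
    have XH: "?X * H' = 1\<^sub>m p"
    proof (rule mat_eq_by_vec[of _ p p])
      fix v :: "real vec" assume v: "v \<in> carrier_vec p"
      have Giv: "Gi *\<^sub>v v \<in> carrier_vec p" using Gi v by auto
      have HGv: "H *\<^sub>v (Gi *\<^sub>v v) \<in> carrier_vec p" using H Giv by auto
      have "(?X * H') *\<^sub>v v = ?X *\<^sub>v (?R *\<^sub>v (H *\<^sub>v (Gi *\<^sub>v v)))"
        unfolding H'_def using assoc_mult_mat_vec[OF X mult_carrier_mat[OF R HGi] v, of "Suc k" k]
          assoc_mult_mat_vec[OF R HGi v, of k] assoc_mult_mat_vec[OF H(1) Gi v] by simp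
      also have "\<dots> = G *\<^sub>v (X k *\<^sub>v (H *\<^sub>v (Gi *\<^sub>v v)))" by (rule XR[OF HGv])
      also have "\<dots> = G *\<^sub>v (Gi *\<^sub>v v)"
        using assoc_mult_mat_vec[OF X H(1) Giv, of k] H(2) Giv by simp
      also have "\<dots> = v" using assoc_mult_mat_vec[OF G Gi v] GGi v by simp
      finally show "(?X * H') *\<^sub>v v = 1\<^sub>m p *\<^sub>v v" using v by simp
    qed (use X H' in \<open>auto intro: mult_carrier_mat\<close>)
    have HX: "H' * ?X = 1\<^sub>m p" by (rule mat_mult_left_right_inverse[OF X H' XH])
    \<comment> \<open>the recursion of the slope: one more power on each side\<close>
    have EG: "E (Suc k) * G = D * E k"
      unfolding G_def D_def mat_diag_mult_right[OF E] mat_diag_mult_left[OF E]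
      using g by (intro eq_matI) (auto simp: E_def)
    have "Y (Suc k) = E (Suc k) * ?X"
    proof (rule mat_eq_by_vec[OF Y mult_carrier_mat[OF E X]])
      fix v :: "real vec" assume v: "v \<in> carrier_vec p"
      \<comment> \<open>the preimage of \<open>v\<close> under \<open>R\<close>\<close>
      define w where "w = (H * Gi) *\<^sub>v (?X *\<^sub>v v)"
      have Xv: "?X *\<^sub>v v \<in> carrier_vec p" using mult_mat_vec_carrier[OF X v] .
      have w: "w \<in> carrier_vec p" unfolding w_def using mult_mat_vec_carrier[OF HGi Xv] .
      have Xw: "X k *\<^sub>v w \<in> carrier_vec p" using mult_mat_vec_carrier[OF X w] .
      have v_eq: "v = ?R *\<^sub>v w"
        using assoc_mult_mat_vec[OF R HGi Xv, of k] assoc_mult_mat_vec[OF H' X v, of "Suc k"] HX v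
        by (simp add: w_def H'_def)
      have "Y (Suc k) *\<^sub>v v = D *\<^sub>v (E k *\<^sub>v (X k *\<^sub>v w))"
        using YR[OF w, of k] assoc_mult_mat_vec[OF E X w, of k k] by (simp add: v_eq Yk)
      also have "\<dots> = E (Suc k) *\<^sub>v (G *\<^sub>v (X k *\<^sub>v w))"
        using assoc_mult_mat_vec[OF D E Xw, of k] assoc_mult_mat_vec[OF E G Xw, of "Suc k"] EG by simp
      also have "\<dots> = (E (Suc k) * ?X) *\<^sub>v v"
        using XR[OF w, of k] assoc_mult_mat_vec[OF E X v, of "Suc k" "Suc k"] by (simp add: v_eq)
      finally show "Y (Suc k) *\<^sub>v v = (E (Suc k) * ?X) *\<^sub>v v" .
    qed
    thus ?case using H' XH by blast
  qed
  thus ?thesis by (simp add: E_def E0_def X_def Y_def)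
qed

section \<open>The slope after several steps\<close>

lemma mat_diag_pow:
  fixes f :: "nat \<Rightarrow> real"
  shows "mat_diag n f ^\<^sub>m k = mat_diag n (\<lambda>i. f i ^ k)"
proof (induction k)
  case 0
  show ?case by (intro eq_matI) (auto simp: mat_diag_def)
next
  case (Suc k)
  have "mat_diag n f ^\<^sub>m Suc k = mat_diag n (\<lambda>i. f i ^ k * f i)" using Suc by simp
  thus ?case by (simp add: mult.commute)
qed

lemma mat_inv_mat_diag:
  assumes "\<And>i. i < n \<Longrightarrow> f i \<noteq> 0"
  shows "mat_inv (mat_diag n f) = mat_diag n (\<lambda>i. 1 / f i)"
proof (rule mat_inv_eqI)
  have "mat_diag n f * mat_diag n (\<lambda>i. 1 / f i) = mat_diag n (\<lambda>i. f i * (1 / f i))" by simp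
  also have "\<dots> = 1\<^sub>m n" using assms by (intro eq_matI) (auto simp: mat_diag_def)
  finally show "mat_diag n f * mat_diag n (\<lambda>i. 1 / f i) = 1\<^sub>m n" .
qed auto

lemma mat2_norm_mat_diag_le:
  fixes f :: "nat \<Rightarrow> real"
  assumes "0 \<le> t" "\<And>i. i < n \<Longrightarrow> \<bar>f i\<bar> \<le> t"
  shows "mat2_norm (mat_diag n f) \<le> t"
  using assms by (intro mat2_norm_least[OF mat_diag_dim] mat_diag_mult_vec_le) auto

lemma slope_power_form:
  fixes g h :: "nat \<Rightarrow> real"
  assumes Y: "Y \<in> carrier_mat q p" and H: "H \<in> carrier_mat p p" and g: "\<And>i. i < p \<Longrightarrow> g i \<noteq> 0"
  shows "mat_diag q h ^\<^sub>m k * Y * H * (mat_inv (mat_diag p g) ^\<^sub>m k)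
      = mat q p (\<lambda>(i, j). h i ^ k * (Y * H) $$ (i, j) * (1 / g j) ^ k)"
    and "mat_diag q h ^\<^sub>m k * Y * H * (mat_inv (mat_diag p g) ^\<^sub>m k)
      = mat_diag q (\<lambda>i. h i ^ k) * (Y * H) * mat_diag p (\<lambda>i. (1 / g i) ^ k)"
proof -
  have YH: "Y * H \<in> carrier_mat q p" by (rule mult_carrier_mat[OF Y H])
  have "mat_diag q h ^\<^sub>m k * Y * H = mat_diag q (\<lambda>i. h i ^ k) * (Y * H)"
    unfolding mat_diag_pow by (rule assoc_mult_mat[OF mat_diag_dim Y H])
  thus eq: "mat_diag q h ^\<^sub>m k * Y * H * (mat_inv (mat_diag p g) ^\<^sub>m k)
      = mat_diag q (\<lambda>i. h i ^ k) * (Y * H) * mat_diag p (\<lambda>i. (1 / g i) ^ k)"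
    using mat_inv_mat_diag[of p g] g by (simp add: mat_diag_pow)
  show "mat_diag q h ^\<^sub>m k * Y * H * (mat_inv (mat_diag p g) ^\<^sub>m k)
      = mat q p (\<lambda>(i, j). h i ^ k * (Y * H) $$ (i, j) * (1 / g j) ^ k)"
    unfolding eq mat_diag_mult_left[OF YH]
    by (subst mat_diag_mult_right[of _ q]) (auto intro!: eq_matI)
qed

text \<open>The slope is damped from the left by the unwanted eigenvalues and amplified from the right by the
  reciprocals of the wanted ones. This is the linear convergence rate of the iteration.\<close>

lemma slope_norm_le:
  fixes g h :: "nat \<Rightarrow> real"
  assumes Y: "Y \<in> carrier_mat q p" and H: "H \<in> carrier_mat p p"
    and t: "0 < t" "\<And>i. i < p \<Longrightarrow> t \<le> g i" and u: "\<And>i. i < q \<Longrightarrow> 0 \<le> h i \<and> h i \<le> u" "0 \<le> u"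
  shows "mat2_norm (mat_diag q h ^\<^sub>m k * Y * H * (mat_inv (mat_diag p g) ^\<^sub>m k))
    \<le> (u / t) ^ k * mat2_norm (Y * H)"
proof -
  have g: "0 < g i" if "i < p" for i using t(1) t(2)[OF that] by simp
  have YH: "Y * H \<in> carrier_mat q p" by (rule mult_carrier_mat[OF Y H])
  let ?D = "mat_diag q (\<lambda>i. h i ^ k)" and ?G = "mat_diag p (\<lambda>i. (1 / g i) ^ k)"
  have "mat2_norm (?D * (Y * H) * ?G) \<le> mat2_norm (?D * (Y * H)) * mat2_norm ?G"
    by (rule mat2_norm_mult_le[OF mult_carrier_mat[OF mat_diag_dim YH] mat_diag_dim])
  also have "\<dots> \<le> (mat2_norm ?D * mat2_norm (Y * H)) * mat2_norm ?G"
    by (intro mult_right_mono mat2_norm_mult_le[OF mat_diag_dim YH] mat2_norm_ge_0)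
  also have "\<dots> \<le> (u ^ k * mat2_norm (Y * H)) * (1 / t) ^ k"
  proof (intro mult_mono mat2_norm_ge_0 mult_nonneg_nonneg zero_le_power)
    show "mat2_norm ?D \<le> u ^ k"
      using u by (intro mat2_norm_mat_diag_le) (auto intro: power_mono)
    have "(1 / g i) ^ k \<le> (1 / t) ^ k" if "i < p" for i
      using t(1) t(2)[OF that] by (intro power_mono divide_left_mono) auto
    thus "mat2_norm ?G \<le> (1 / t) ^ k"
      using t(1) g by (intro mat2_norm_mat_diag_le) (auto simp: less_imp_le abs_of_nonneg)
  qed (use u t in auto)
  finally have "mat2_norm (?D * (Y * H) * ?G) \<le> (u / t) ^ k * mat2_norm (Y * H)"
    by (simp add: power_divide)
  thus ?thesis using slope_power_form(2)[OF Y H, of g h k] g by (simp add: less_imp_neq[symmetric])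
qed

section \<open>Subspaces given by a slope\<close>

text \<open>With \<open>X = Qp\<^sup>T T\<close> and \<open>Qc\<^sup>T T = E X\<close> one has \<open>T = (Qp + Qc E) X\<close>, and orthonormality of the
  columns of \<open>T\<close> reads \<open>X\<^sup>T (1 + E\<^sup>T E) X = 1\<close>. Hence \<open>W = (1 + E\<^sup>T E)\<^sup>1\<^sup>/\<^sup>2 X\<close> is orthogonal.\<close>

lemma slope_representation:
  assumes Qp: "orthonormal_cols N p Qp" and Qc: "orthonormal_cols N q Qc"
    and comp: "Qp * Qp\<^sup>T + Qc * Qc\<^sup>T = 1\<^sub>m N" and T: "orthonormal_cols N p T"
    and E: "E \<in> carrier_mat q p" and Y: "Qc\<^sup>T * T = E * (Qp\<^sup>T * T)"
  shows "\<exists>W. orthonormal_cols p p W \<and>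
    T = (Qp + Qc * E) * mat_inv (mat_sqrt (1\<^sub>m p + E\<^sup>T * E)) * W"
proof -
  note QpD = orthonormal_colsD[OF Qp] and QcD = orthonormal_colsD[OF Qc] and TD = orthonormal_colsD[OF T]
  define X where "X = Qp\<^sup>T * T"
  define M where "M = 1\<^sub>m p + E\<^sup>T * E"
  define S where "S = mat_sqrt M"
  have X: "X \<in> carrier_mat p p" unfolding X_def by (rule mult_carrier_mat[OF QpD(3) TD(1)])
  have ET: "E\<^sup>T \<in> carrier_mat p q" using E by simp
  have EE: "E\<^sup>T * E \<in> carrier_mat p p" by (rule mult_carrier_mat[OF ET E])
  have M: "M \<in> carrier_mat p p" unfolding M_def using EE by simp
  have MT: "M\<^sup>T = M" unfolding M_def
    using transpose_add[OF one_carrier_mat EE] transpose_mult[OF ET E] by simp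
  have Mv: "M *\<^sub>v v = v + E\<^sup>T *\<^sub>v (E *\<^sub>v v)" if v: "v \<in> carrier_vec p" for v
    unfolding M_def using add_mult_distrib_mat_vec[OF one_carrier_mat EE v] assoc_mult_mat_vec[OF ET E v] v by simp
  have "v \<bullet> v \<le> v \<bullet> (M *\<^sub>v v)" if v: "v \<in> carrier_vec p" for v
  proof -
    have Ev: "E *\<^sub>v v \<in> carrier_vec q" and EEv: "E\<^sup>T *\<^sub>v (E *\<^sub>v v) \<in> carrier_vec p" using E v by auto
    have "v \<bullet> (M *\<^sub>v v) = v \<bullet> v + (E *\<^sub>v v) \<bullet> (E *\<^sub>v v)"
      unfolding Mv[OF v] using scalar_prod_add_distrib[OF v v EEv] scalar_prod_transpose(2)[OF E v Ev] by simp
    thus ?thesis using scalar_prod_self_ge_0[of "E *\<^sub>v v"] by simp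
  qed
  from mat_sqrt_pos_def[OF M MT this]
  have S: "S \<in> carrier_mat p p" "S\<^sup>T = S" "S * S = M" by (auto simp: S_def)
  define W where "W = S * X"
  have W: "W \<in> carrier_mat p p" unfolding W_def by (rule mult_carrier_mat[OF S(1) X])
  have Yv: "Qc\<^sup>T *\<^sub>v (T *\<^sub>v v) = E *\<^sub>v (X *\<^sub>v v)" and Xv: "Qp\<^sup>T *\<^sub>v (T *\<^sub>v v) = X *\<^sub>v v"
    if v: "v \<in> carrier_vec p" for v
    using assoc_mult_mat_vec[OF QcD(3) TD(1) v] Y assoc_mult_mat_vec[OF E X v]
      assoc_mult_mat_vec[OF QpD(3) TD(1) v] by (simp_all add: X_def)
  have XT: "X\<^sup>T \<in> carrier_mat p p" and WT: "W\<^sup>T = X\<^sup>T * S"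
    using X transpose_mult[OF S(1) X] S(2) by (simp_all add: W_def)
  have ortho: "W\<^sup>T * W = 1\<^sub>m p"
  proof (rule mat_eq_by_vec[of _ p p])
    fix v :: "real vec" assume v: "v \<in> carrier_vec p"
    define x where "x = X *\<^sub>v v"
    have x: "x \<in> carrier_vec p" using X v by (auto simp: x_def)
    have Sx: "S *\<^sub>v x \<in> carrier_vec p" using S x by auto
    have Ex: "E *\<^sub>v x \<in> carrier_vec q" and EEx: "E\<^sup>T *\<^sub>v (E *\<^sub>v x) \<in> carrier_vec p" using E x by auto
    have Tv: "T *\<^sub>v v \<in> carrier_vec N" using TD v by auto
    have Qx: "Qp *\<^sub>v x \<in> carrier_vec N" "Qc *\<^sub>v (E *\<^sub>v x) \<in> carrier_vec N"
      using mult_mat_vec_carrier[OF QpD(1) x] mult_mat_vec_carrier[OF QcD(1) Ex] by auto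
    have "(W\<^sup>T * W) *\<^sub>v v = W\<^sup>T *\<^sub>v (W *\<^sub>v v)" using W v by simp
    also have "W *\<^sub>v v = S *\<^sub>v x" using S X v by (simp add: W_def x_def)
    also have "W\<^sup>T *\<^sub>v (S *\<^sub>v x) = X\<^sup>T *\<^sub>v (S *\<^sub>v (S *\<^sub>v x))"
      unfolding WT by (rule assoc_mult_mat_vec[OF XT S(1) Sx])
    also have "S *\<^sub>v (S *\<^sub>v x) = x + E\<^sup>T *\<^sub>v (E *\<^sub>v x)"
      using assoc_mult_mat_vec[OF S(1) S(1) x] S(3) Mv[OF x] by simp
    also have "X\<^sup>T *\<^sub>v (x + E\<^sup>T *\<^sub>v (E *\<^sub>v x)) = X\<^sup>T *\<^sub>v x + X\<^sup>T *\<^sub>v (E\<^sup>T *\<^sub>v (E *\<^sub>v x))"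
      by (rule mult_add_distrib_mat_vec[OF XT x EEx])
    also have "X\<^sup>T *\<^sub>v x = T\<^sup>T *\<^sub>v (Qp *\<^sub>v x)"
      unfolding X_def using transpose_mult[OF QpD(3) TD(1)] assoc_mult_mat_vec[OF TD(3) QpD(1) x] by simp
    also have "X\<^sup>T *\<^sub>v (E\<^sup>T *\<^sub>v (E *\<^sub>v x)) = T\<^sup>T *\<^sub>v (Qc *\<^sub>v (E *\<^sub>v x))"
    proof -
      have "X\<^sup>T * E\<^sup>T = (E * X)\<^sup>T" using transpose_mult[OF E X] by simp
      also have "\<dots> = T\<^sup>T * Qc" using Y transpose_mult[OF QcD(3) TD(1)] by (simp add: X_def)
      finally show ?thesis
        using assoc_mult_mat_vec[OF XT ET Ex] assoc_mult_mat_vec[OF TD(3) QcD(1) Ex] by simp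
    qed
    also have "T\<^sup>T *\<^sub>v (Qp *\<^sub>v x) + T\<^sup>T *\<^sub>v (Qc *\<^sub>v (E *\<^sub>v x)) = T\<^sup>T *\<^sub>v (T *\<^sub>v v)"
      using mult_add_distrib_mat_vec[OF TD(3) Qx] complement_decomposition(1)[OF Qp Qc comp Tv]
        Yv[OF v] Xv[OF v] by (simp add: x_def)
    also have "\<dots> = v" by (rule orthonormal_transpose_mult_vec[OF T v])
    finally show "(W\<^sup>T * W) *\<^sub>v v = 1\<^sub>m p *\<^sub>v v" using v by simp
  qed (use W in \<open>auto intro: mult_carrier_mat\<close>)
  have WTc: "W\<^sup>T \<in> carrier_mat p p" using W by simp
  have WW: "W * W\<^sup>T = 1\<^sub>m p" by (rule mat_mult_left_right_inverse[OF WTc W ortho])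
  have XWT: "X * W\<^sup>T \<in> carrier_mat p p" by (rule mult_carrier_mat[OF X WTc])
  have "S * (X * W\<^sup>T) = 1\<^sub>m p" using assoc_mult_mat[OF S(1) X WTc] WW by (simp add: W_def)
  hence inv: "mat_inv S = X * W\<^sup>T" by (rule mat_inv_eqI[OF S(1) XWT])
  have F: "Qp + Qc * E \<in> carrier_mat N p" using mult_carrier_mat[OF QcD(1) E] by simp
  have FS: "(Qp + Qc * E) * (X * W\<^sup>T) \<in> carrier_mat N p" by (rule mult_carrier_mat[OF F XWT])
  have "T = (Qp + Qc * E) * mat_inv S * W" unfolding inv
  proof (rule mat_eq_by_vec[OF TD(1) mult_carrier_mat[OF FS W]])
    fix v :: "real vec" assume v: "v \<in> carrier_vec p"
    have Tv: "T *\<^sub>v v \<in> carrier_vec N" using TD v by auto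
    have Wv: "W *\<^sub>v v \<in> carrier_vec p" using W v by auto
    have x: "X *\<^sub>v v \<in> carrier_vec p" using X v by auto
    have "((Qp + Qc * E) * (X * W\<^sup>T) * W) *\<^sub>v v = (Qp + Qc * E) *\<^sub>v (X *\<^sub>v (W\<^sup>T *\<^sub>v (W *\<^sub>v v)))"
      using assoc_mult_mat_vec[OF FS W v] assoc_mult_mat_vec[OF F XWT Wv] assoc_mult_mat_vec[OF X WTc Wv] by simp
    also have "W\<^sup>T *\<^sub>v (W *\<^sub>v v) = v" using assoc_mult_mat_vec[OF WTc W v] ortho v by simp
    also have "(Qp + Qc * E) *\<^sub>v (X *\<^sub>v v) = Qp *\<^sub>v (X *\<^sub>v v) + Qc *\<^sub>v (E *\<^sub>v (X *\<^sub>v v))"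
      using add_mult_distrib_mat_vec[OF QpD(1) mult_carrier_mat[OF QcD(1) E] x]
        assoc_mult_mat_vec[OF QcD(1) E x] by simp
    also have "\<dots> = T *\<^sub>v v"
      using complement_decomposition(1)[OF Qp Qc comp Tv] Yv[OF v] Xv[OF v] by simp
    finally show "T *\<^sub>v v = ((Qp + Qc * E) * (X * W\<^sup>T) * W) *\<^sub>v v" by simp
  qed
  moreover have "orthonormal_cols p p W" using W ortho by (simp add: orthonormal_cols_def)
  ultimately show ?thesis unfolding S_def M_def by blast
qed

text \<open>A unit vector of the subspace has components \<open>x\<close> and \<open>E x\<close> with \<open>\<parallel>x\<parallel>\<^sup>2 + \<parallel>E x\<parallel>\<^sup>2 = 1\<close>, and \<open>E x\<close> is its residual
  with respect to \<open>Qp\<close>. Maximizing the residual turns the largest tangent \<open>\<parallel>E\<parallel>\<close> into the largest sine.\<close>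

lemma slope_subspace_dist:
  assumes Qp: "orthonormal_cols N p Qp" and Qc: "orthonormal_cols N q Qc"
    and comp: "Qp * Qp\<^sup>T + Qc * Qc\<^sup>T = 1\<^sub>m N" and T: "orthonormal_cols N p T"
    and E: "E \<in> carrier_mat q p" and Y: "Qc\<^sup>T * T = E * (Qp\<^sup>T * T)"
    and H: "H \<in> carrier_mat p p" "(Qp\<^sup>T * T) * H = 1\<^sub>m p"
  shows "subspace_dist N (column_space T) (column_space Qp) = mat2_norm E / sqrt (1 + (mat2_norm E)\<^sup>2)"
proof -
  note QpD = orthonormal_colsD[OF Qp] and QcD = orthonormal_colsD[OF Qc] and TD = orthonormal_colsD[OF T]
  define X where "X = Qp\<^sup>T * T"
  define e where "e = mat2_norm E"
  define c where "c = e / sqrt (1 + e\<^sup>2)"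
  define \<epsilon> where "\<epsilon> = subspace_dist N (column_space T) (column_space Qp)"
  have e: "0 \<le> e" by (simp add: e_def mat2_norm_ge_0)
  have pos: "0 < 1 + e\<^sup>2" by (simp add: add_pos_nonneg)
  have c: "0 \<le> c" "c\<^sup>2 = e\<^sup>2 / (1 + e\<^sup>2)" using e pos by (auto simp: c_def power_divide)
  have c1: "c\<^sup>2 < 1" unfolding c(2) using pos by simp
  have X: "X \<in> carrier_mat p p" unfolding X_def by (rule mult_carrier_mat[OF QpD(3) TD(1)])
  have Yv: "Qc\<^sup>T *\<^sub>v (T *\<^sub>v v) = E *\<^sub>v (X *\<^sub>v v)" and Xv: "Qp\<^sup>T *\<^sub>v (T *\<^sub>v v) = X *\<^sub>v v"
    if v: "v \<in> carrier_vec p" for v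
    using assoc_mult_mat_vec[OF QcD(3) TD(1) v] Y assoc_mult_mat_vec[OF E X v]
      assoc_mult_mat_vec[OF QpD(3) TD(1) v] by (simp_all add: X_def)
  have Tc: "T *\<^sub>v v \<in> carrier_vec N" if "v \<in> carrier_vec p" for v using TD that by auto
  have res: "vec2_norm (T *\<^sub>v v - Qp *\<^sub>v (Qp\<^sup>T *\<^sub>v (T *\<^sub>v v))) = vec2_norm (E *\<^sub>v (X *\<^sub>v v))"
    if v: "v \<in> carrier_vec p" for v
    using complement_decomposition(2)[OF Qp Qc comp Tc[OF v]] Yv[OF v] by simp
  have pyth: "(vec2_norm v)\<^sup>2 = (vec2_norm (X *\<^sub>v v))\<^sup>2 + (vec2_norm (E *\<^sub>v (X *\<^sub>v v)))\<^sup>2"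
    if v: "v \<in> carrier_vec p" for v
    using complement_decomposition(3)[OF Qp Qc comp Tc[OF v]] Yv[OF v] Xv[OF v]
      vec2_norm_orthonormal[OF T v] by simp
  have le: "\<epsilon> \<le> c" unfolding \<epsilon>_def
  proof (rule subspace_dist_le[OF Qp T c(1)])
    fix v :: "real vec" assume v: "v \<in> carrier_vec p"
    let ?x = "X *\<^sub>v v"
    have x: "?x \<in> carrier_vec p" using X v by auto
    have "vec2_norm (E *\<^sub>v ?x) \<le> e * vec2_norm ?x" unfolding e_def by (rule mat2_norm_upper[OF E x])
    hence "(vec2_norm (E *\<^sub>v ?x))\<^sup>2 \<le> e\<^sup>2 * (vec2_norm ?x)\<^sup>2"
      by (metis power_mono power_mult_distrib vec2_norm_ge_0)
    hence "(vec2_norm (E *\<^sub>v ?x))\<^sup>2 * (1 + e\<^sup>2) \<le> e\<^sup>2 * (vec2_norm v)\<^sup>2"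
      unfolding pyth[OF v] by (simp add: algebra_simps)
    hence "(vec2_norm (E *\<^sub>v ?x))\<^sup>2 \<le> (c * vec2_norm v)\<^sup>2"
      using pos by (simp add: power_mult_distrib c(2) field_simps)
    thus "vec2_norm (T *\<^sub>v v - Qp *\<^sub>v (Qp\<^sup>T *\<^sub>v (T *\<^sub>v v))) \<le> c * vec2_norm v"
      unfolding res[OF v] by (rule power2_le_imp_le) (use c in simp)
  qed
  have \<epsilon>0: "0 \<le> \<epsilon>" unfolding \<epsilon>_def subspace_dist_def by (rule mat2_norm_ge_0)
  have \<epsilon>1: "0 < 1 - \<epsilon>\<^sup>2" using power_mono[OF le \<epsilon>0, of 2] c1 by linarith
  have "e \<le> \<epsilon> / sqrt (1 - \<epsilon>\<^sup>2)" unfolding e_def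
  proof (rule mat2_norm_least[OF E])
    fix u :: "real vec" assume u: "u \<in> carrier_vec p"
    define v where "v = H *\<^sub>v u"
    have v: "v \<in> carrier_vec p" "X *\<^sub>v v = u"
      using H u X by (auto simp: v_def X_def simp flip: assoc_mult_mat_vec)
    have "vec2_norm (E *\<^sub>v u) \<le> \<epsilon> * vec2_norm v"
      using residual_le_subspace_dist(1)[OF Qp T v(1)] res[OF v(1)] v(2) by (simp add: \<epsilon>_def)
    hence "(vec2_norm (E *\<^sub>v u))\<^sup>2 \<le> \<epsilon>\<^sup>2 * (vec2_norm v)\<^sup>2"
      by (metis power_mono power_mult_distrib vec2_norm_ge_0)
    hence "(vec2_norm (E *\<^sub>v u))\<^sup>2 * (1 - \<epsilon>\<^sup>2) \<le> \<epsilon>\<^sup>2 * (vec2_norm u)\<^sup>2"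
      unfolding pyth[OF v(1)] v(2) by (simp add: algebra_simps)
    hence "(vec2_norm (E *\<^sub>v u))\<^sup>2 \<le> (\<epsilon> / sqrt (1 - \<epsilon>\<^sup>2) * vec2_norm u)\<^sup>2"
      using \<epsilon>1 by (simp add: power_mult_distrib power_divide field_simps)
    thus "vec2_norm (E *\<^sub>v u) \<le> \<epsilon> / sqrt (1 - \<epsilon>\<^sup>2) * vec2_norm u"
      by (rule power2_le_imp_le) (use \<epsilon>0 \<epsilon>1 in simp)
  qed (use \<epsilon>0 \<epsilon>1 in simp)
  hence "e\<^sup>2 \<le> (\<epsilon> / sqrt (1 - \<epsilon>\<^sup>2))\<^sup>2" by (rule power_mono[OF _ e])
  hence "e\<^sup>2 \<le> \<epsilon>\<^sup>2 / (1 - \<epsilon>\<^sup>2)" using \<epsilon>1 by (simp add: power_divide)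
  hence "c\<^sup>2 \<le> \<epsilon>\<^sup>2" unfolding c(2) using \<epsilon>1 pos by (simp add: field_simps)
  hence "c \<le> \<epsilon>" by (rule power2_le_imp_le) (rule \<epsilon>0)
  with le show ?thesis by (simp add: c_def e_def \<epsilon>_def)
qed

section \<open>Projecting the subspace to one block\<close>

text \<open>The residual does not change when an element of the subspace is subtracted from \<open>v\<close>.\<close>

lemma orthogonal_projection_nearest:
  assumes X: "orthonormal_cols N p X" and v: "v \<in> carrier_vec N" and u: "u \<in> carrier_vec p"
  shows "vec2_norm (v - X *\<^sub>v (X\<^sup>T *\<^sub>v v)) \<le> vec2_norm (v - X *\<^sub>v u)"
proof (rule power2_le_imp_le)
  note XD = orthonormal_colsD[OF X]
  let ?d = "v - X *\<^sub>v u"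
  have Xu: "X *\<^sub>v u \<in> carrier_vec N" using XD u by auto
  have d: "?d \<in> carrier_vec N" using v Xu by auto
  have w: "X\<^sup>T *\<^sub>v v \<in> carrier_vec p" using XD v by auto
  have Xw: "X *\<^sub>v (X\<^sup>T *\<^sub>v v) \<in> carrier_vec N" using mult_mat_vec_carrier[OF XD(1) w] .
  have "X\<^sup>T *\<^sub>v ?d = X\<^sup>T *\<^sub>v v - u"
    using mult_minus_distrib_mat_vec[OF XD(3) v Xu] orthonormal_transpose_mult_vec[OF X u] by simp
  hence "X *\<^sub>v (X\<^sup>T *\<^sub>v ?d) = X *\<^sub>v (X\<^sup>T *\<^sub>v v) - X *\<^sub>v u"
    using mult_minus_distrib_mat_vec[OF XD(1) w u] by simp
  moreover have "(a - b) - (s - b) = a - s"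
    if "a \<in> carrier_vec N" "b \<in> carrier_vec N" "s \<in> carrier_vec N" for a b s :: "real vec"
    using that by (intro eq_vecI) auto
  ultimately have "?d - X *\<^sub>v (X\<^sup>T *\<^sub>v ?d) = v - X *\<^sub>v (X\<^sup>T *\<^sub>v v)" using v Xu Xw by simp
  thus "(vec2_norm (v - X *\<^sub>v (X\<^sup>T *\<^sub>v v)))\<^sup>2 \<le> (vec2_norm ?d)\<^sup>2"
    using orthonormal_pythagoras[OF X d] by simp
qed simp

text \<open>The matrices \<open>[I, 0]\<close> and \<open>[0, I]\<close> of the iteration, as transposes of matrices with orthonormal
  columns. In particular they do not increase norms.\<close>

lemma block_selector:
  fixes N a c :: nat
  assumes B: "B \<in> carrier_mat a N" and row: "\<And>i. i < a \<Longrightarrow> row B i = unit_vec N (c + i)" and le: "c + a \<le> N"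
  shows "orthonormal_cols N a (B\<^sup>T)"
    and "w \<in> carrier_vec N \<Longrightarrow> i < a \<Longrightarrow> (B *\<^sub>v w) $ i = w $ (c + i)"
proof -
  have BT: "B\<^sup>T \<in> carrier_mat N a" using B by simp
  show "orthonormal_cols N a (B\<^sup>T)"
    unfolding orthonormal_cols_iff[OF BT] using B row le by auto
  show "(B *\<^sub>v w) $ i = w $ (c + i)" if "w \<in> carrier_vec N" "i < a" using that B row le by simp
qed

text \<open>The blocks of the eigenvectors are singular vectors scaled by \<open>1 / \<surd>2\<close>. Applying \<open>J\<^sup>T\<close> to a vector of
  the span of \<open>T\<close> near \<open>Qp z\<close> gives a vector of the span of \<open>X\<close> near \<open>F z / \<surd>2\<close>, and undoing the scaling
  magnifies the distance by \<open>\<surd>2\<close>.\<close>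

lemma block_subspace_dist:
  assumes J: "orthonormal_cols N n' J" and Qp: "orthonormal_cols N p Qp" and T: "orthonormal_cols N p T"
    and F: "orthonormal_cols n' p F" and X: "orthonormal_cols n' p X" and R: "R \<in> carrier_mat p p"
    and JQ: "J\<^sup>T * Qp = (1 / sqrt 2) \<cdot>\<^sub>m F" and JT: "J\<^sup>T * T = X * R"
  shows "subspace_dist n' (column_space F) (column_space X)
    \<le> sqrt 2 * subspace_dist N (column_space T) (column_space Qp)"
proof (rule subspace_dist_le[OF X F])
  note JD = orthonormal_colsD[OF J] and QpD = orthonormal_colsD[OF Qp] and TD = orthonormal_colsD[OF T]
    and FD = orthonormal_colsD[OF F] and XD = orthonormal_colsD[OF X]
  let ?\<epsilon> = "subspace_dist N (column_space T) (column_space Qp)"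
  show "0 \<le> sqrt 2 * ?\<epsilon>" by (simp add: subspace_dist_def mat2_norm_ge_0)
  fix z :: "real vec" assume z: "z \<in> carrier_vec p"
  define t where "t = T\<^sup>T *\<^sub>v (Qp *\<^sub>v z)"
  define u where "u = R *\<^sub>v (sqrt 2 \<cdot>\<^sub>v t)"
  define r where "r = Qp *\<^sub>v z - T *\<^sub>v t"
  have Qz: "Qp *\<^sub>v z \<in> carrier_vec N" using QpD z by auto
  have t: "t \<in> carrier_vec p" using mult_mat_vec_carrier[OF TD(3) Qz] by (simp add: t_def)
  have st: "sqrt 2 \<cdot>\<^sub>v t \<in> carrier_vec p" using t by simp
  have Tt: "T *\<^sub>v t \<in> carrier_vec N" using mult_mat_vec_carrier[OF TD(1) t] .
  have u: "u \<in> carrier_vec p" using mult_mat_vec_carrier[OF R st] by (simp add: u_def)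
  have r: "r \<in> carrier_vec N" using Qz Tt by (simp add: r_def)
  have Fz: "F *\<^sub>v z \<in> carrier_vec n'" using FD z by auto
  have "J\<^sup>T *\<^sub>v (Qp *\<^sub>v z) = (1 / sqrt 2) \<cdot>\<^sub>v (F *\<^sub>v z)"
    using assoc_mult_mat_vec[OF JD(3) QpD(1) z] JQ smult_mat_mult_vec[OF FD(1) z] by simp
  hence F_eq: "F *\<^sub>v z = sqrt 2 \<cdot>\<^sub>v (J\<^sup>T *\<^sub>v (Qp *\<^sub>v z))" by (simp add: smult_smult_assoc)
  have "X *\<^sub>v u = (X * R) *\<^sub>v (sqrt 2 \<cdot>\<^sub>v t)" using assoc_mult_mat_vec[OF XD(1) R st] by (simp add: u_def)
  also have "\<dots> = J\<^sup>T *\<^sub>v (T *\<^sub>v (sqrt 2 \<cdot>\<^sub>v t))" using assoc_mult_mat_vec[OF JD(3) TD(1) st] JT by simp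
  also have "\<dots> = sqrt 2 \<cdot>\<^sub>v (J\<^sup>T *\<^sub>v (T *\<^sub>v t))"
    using mult_mat_vec[OF TD(1) t] mult_mat_vec[OF JD(3) Tt] by simp
  finally have X_eq: "X *\<^sub>v u = sqrt 2 \<cdot>\<^sub>v (J\<^sup>T *\<^sub>v (T *\<^sub>v t))" .
  have a: "J\<^sup>T *\<^sub>v (Qp *\<^sub>v z) \<in> carrier_vec n'" and b: "J\<^sup>T *\<^sub>v (T *\<^sub>v t) \<in> carrier_vec n'"
    using mult_mat_vec_carrier[OF JD(3) Qz] mult_mat_vec_carrier[OF JD(3) Tt] by auto
  have diff: "c \<cdot>\<^sub>v x - c \<cdot>\<^sub>v y = c \<cdot>\<^sub>v (x - y)" if "x \<in> carrier_vec n'" "y \<in> carrier_vec n'"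
    for c and x y :: "real vec" using that by (intro eq_vecI) (auto simp: algebra_simps)
  have "F *\<^sub>v z - X *\<^sub>v u = sqrt 2 \<cdot>\<^sub>v (J\<^sup>T *\<^sub>v r)"
    unfolding F_eq X_eq r_def using diff[OF a b] mult_minus_distrib_mat_vec[OF JD(3) Qz Tt] by simp
  hence "vec2_norm (F *\<^sub>v z - X *\<^sub>v u) = sqrt 2 * vec2_norm (J\<^sup>T *\<^sub>v r)" by simp
  also have "\<dots> \<le> sqrt 2 * (?\<epsilon> * vec2_norm z)"
    using vec2_norm_transpose_orthonormal_le[OF J r] residual_le_subspace_dist(2)[OF Qp T z]
    by (intro mult_left_mono) (auto simp: r_def t_def)
  finally show "vec2_norm (F *\<^sub>v z - X *\<^sub>v (X\<^sup>T *\<^sub>v (F *\<^sub>v z))) \<le> sqrt 2 * ?\<epsilon> * vec2_norm z"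
    using orthogonal_projection_nearest[OF X Fz u] by simp
qed

section \<open>Convergence of the subspaces and of the Ritz values\<close>

theorem theorem6p4:
  fixes m n p d nsv r :: nat
    and A U V SA P PSA Q Qp Qperp Gp Gperp Vp Up :: "real mat"
    and s lam \<gamma> :: "nat \<Rightarrow> real"
    and a b :: real
    and \<pi> :: "nat \<Rightarrow> nat"
    and Qt R Q1 R1 Q2 R2 E M :: "nat \<Rightarrow> real mat"
    and \<epsilon> \<epsilon>1 \<epsilon>2 :: "nat \<Rightarrow> real"
  assumes A: "A \<in> carrier_mat m n" and mn: "n \<le> m"
    and svd: "is_svd m n A U s V"
    and ab: "0 < a" "a < b" "Min (s ` {..<n}) \<le> a" "b \<le> mat2_norm A"
    and nsv: "nsv = card {j. j < n \<and> a \<le> s j \<and> s j \<le> b}"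
    and SA: "SA = aug_mat m n A"
    and Q: "Q = aug_eigvecs m n U V"
    and PSA: "PSA = spectral_projector m n U s V a b"
    and P: "P = mat_poly_eval (filter_poly d (a / mat2_norm A) (b / mat2_norm A))
                  ((1 / mat2_norm A) \<cdot>\<^sub>m SA)"
    \<comment> \<open>\<open>\<pi> i\<close> is the index of the column of \<open>Q\<close> that is labeled \<open>q\<^sub>i\<close>\<close>
    and perm: "\<pi> permutes {..<n + m}"
    and lam: "lam = (\<lambda>i. aug_eigval n s (\<pi> i))"
    and gam: "\<gamma> = (\<lambda>i. poly (filter_poly d (a / mat2_norm A) (b / mat2_norm A)) (lam i / mat2_norm A))"
    and gam_decr: "\<forall>i j. i \<le> j \<and> j < n + m \<longrightarrow> \<gamma> j \<le> \<gamma> i"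
    and gam_range: "\<forall>i < n + m. 0 \<le> \<gamma> i \<and> \<gamma> i \<le> 1"
    and proj_err: "mat2_norm (PSA - P) < 1 / 4"
    and wanted: "\<pi> ` {..<nsv} = {j. j < n \<and> a \<le> s j \<and> s j \<le> b}"
    and r: "r \<le> nsv" "\<forall>i<r. a < lam i \<and> lam i < b"
        "\<forall>i. r \<le> i \<and> i < nsv \<longrightarrow> lam i = a \<or> lam i = b"
    and gam_gaps: "\<forall>i<r. 3 / 4 < \<gamma> i"
        "\<forall>i. r \<le> i \<and> i < nsv \<longrightarrow> 1 / 4 < \<gamma> i \<and> \<gamma> i < 3 / 4"
        "\<forall>i. nsv \<le> i \<and> i < n + m \<longrightarrow> \<gamma> i < 1 / 4"
    and p: "1 \<le> p" "nsv \<le> p" "p \<le> n + m"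
    and lam_pos: "\<forall>i. nsv \<le> i \<and> i < p \<longrightarrow> 0 < lam i"
    and Qp: "Qp = sel_cols Q (map \<pi> [0..<p])"
    and Qperp: "Qperp = sel_cols Q (map \<pi> [p..<n + m])"
    and Gp: "Gp = mat_diag p \<gamma>"
    and Gperp: "Gperp = mat_diag (n + m - p) (\<lambda>i. \<gamma> (p + i))"
    and Vp: "Vp = sel_cols V (map \<pi> [0..<p])"
    and Up: "Up = sel_cols U (map \<pi> [0..<p])"
    and start: "orthonormal_cols (n + m) p (Qt 0)"
    and iter: "\<forall>k\<ge>1. is_qr (n + m) p (P * Qt (k - 1)) (Qt k) (R k)"
    and qrY: "\<forall>k\<ge>1. is_qr n p (hcat (1\<^sub>m n) (0\<^sub>m n m) * Qt k) (Q1 k) (R1 k)"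
    and qrZ: "\<forall>k\<ge>1. is_qr m p (hcat (0\<^sub>m m n) (1\<^sub>m m) * Qt k) (Q2 k) (R2 k)"
    and gap: "\<gamma> (p - 1) > \<gamma> p"
    and inv: "invertible_mat (transpose_mat Qp * Qt 0)"
    and E: "E = (\<lambda>k. Gperp ^\<^sub>m k * (transpose_mat Qperp * Qt 0)
                  * mat_inv (transpose_mat Qp * Qt 0) * (mat_inv Gp ^\<^sub>m k))"
    and M: "M = (\<lambda>k. 1\<^sub>m p + transpose_mat (E k) * E k)"
    and eps: "\<epsilon> = (\<lambda>k. subspace_dist (n + m) (column_space (Qt k)) (column_space Qp))"
    and eps1: "\<epsilon>1 = (\<lambda>k. subspace_dist n (column_space Vp) (column_space (Q1 k)))"
    and eps2: "\<epsilon>2 = (\<lambda>k. subspace_dist m (column_space Up) (column_space (Q2 k)))"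
  shows "\<forall>k\<ge>1.
      (\<exists>W. orthonormal_cols p p W \<and> Qt k = (Qp + Qperp * E k) * mat_inv (mat_sqrt (M k)) * W)
    \<and> mat2_norm (E k) \<le> (\<gamma> p / \<gamma> (p - 1)) ^ k
          * mat2_norm (transpose_mat Qperp * Qt 0 * mat_inv (transpose_mat Qp * Qt 0))
    \<and> \<epsilon> k = mat2_norm (E k) / sqrt (1 + (mat2_norm (E k))\<^sup>2)
    \<and> \<epsilon> k \<le> (\<gamma> p / \<gamma> (p - 1)) ^ k
          * mat2_norm (transpose_mat Qperp * Qt 0 * mat_inv (transpose_mat Qp * Qt 0))
    \<and> (invertible_mat (R1 k) \<and> invertible_mat (R2 k) \<longrightarrow>
          \<epsilon>1 k \<le> sqrt 2 * \<epsilon> k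
        \<and> \<epsilon>2 k \<le> sqrt 2 * \<epsilon> k
        \<and> (\<forall>st ut vt. ritz_approx p A (Q1 k) (Q2 k) st ut vt \<and> same_order p lam st \<longrightarrow>
              (\<forall>i<p. \<bar>st i - lam i\<bar> \<le> mat2_norm A * (6 * (\<epsilon> k)\<^sup>2 + 4 * (\<epsilon> k) ^ 4))))"
proof -
  let ?N = "n + m" and ?\<alpha> = "mat2_norm A" and ?Y = "transpose_mat Qperp * Qt 0"
    and ?X = "transpose_mat Qp * Qt 0"
  let ?f = "filter_poly d (a / ?\<alpha>) (b / ?\<alpha>)"
  have U: "orthonormal_cols m m U" and V: "orthonormal_cols n n V" and s0: "\<And>i. i < n \<Longrightarrow> 0 \<le> s i"
    using svd by (auto simp: is_svd_def)
  note UD = orthonormal_colsD(1)[OF U] and VD = orthonormal_colsD(1)[OF V]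
  \<comment> \<open>The first \<open>p\<close> eigenvalues are positive, so their eigenvectors are among the first \<open>n\<close> columns. This also
    forces \<open>p \<le> n\<close>, so that there is an eigenvalue number \<open>p + 1\<close>.\<close>
  have pin: "\<pi> i < n" if i: "i < p" for i
  proof (cases "i < nsv")
    case True
    thus ?thesis using wanted by auto
  next
    case False
    hence pos: "0 < aug_eigval n s (\<pi> i)" using lam_pos i by (simp add: lam)
    show ?thesis
    proof (rule ccontr)
      assume not_lt: "\<not> \<pi> i < n"
      hence "\<pi> i - n < n" if "\<pi> i < 2 * n" using that by linarith
      with not_lt show False using pos s0[of "\<pi> i - n"] by (auto simp: aug_eigval_def split: if_splits)
    qed
  qed
  have lam_eq: "lam i = s (\<pi> i)" and lam0: "0 \<le> lam i" if "i < p" for i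
    using pin[OF that] s0 by (auto simp: lam aug_eigval_def)
  have inj: "inj_on \<pi> S" for S using permutes_inj_on[OF perm] .
  have "card (\<pi> ` {..<p}) \<le> card {..<n}" using pin by (intro card_mono) auto
  hence pn: "p \<le> n" using card_image[OF inj] by simp
  have pN: "p < ?N" using pn p(1) mn by linarith
  have pm: "\<pi> i < ?N" if "i < ?N" for i using permutes_in_image[OF perm] that by auto
  have g_low: "\<gamma> (p - 1) \<le> \<gamma> i" if "i < p" for i
    using gam_decr[rule_format, of i "p - 1"] that pN by linarith
  have gp: "0 \<le> \<gamma> p" using gam_range pN by auto
  have g_pos: "0 < \<gamma> (p - 1)" using gap gp by linarith
  have g_ne: "\<gamma> i \<noteq> 0" if "i < p" for i using g_low[OF that] g_pos by linarith

  have Qo: "orthonormal_cols ?N ?N Q" unfolding Q by (rule orthonormal_aug_eigvecs[OF U V mn])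
  note QD = orthonormal_colsD(1)[OF Qo]
  note blocks = permuted_columns_complement[OF Qo perm less_imp_le[OF pN], folded Qp Qperp]
  note Qpo = blocks(1) and Qco = blocks(2) and comp = blocks(3) and cross = blocks(4)
  note QpD = orthonormal_colsD[OF Qpo] and QcD = orthonormal_colsD[OF Qco]
  have colQp: "col Qp i = col Q (\<pi> i)" if "i < p" for i
    unfolding Qp using col_sel_cols[OF QD, of i "map \<pi> [0..<p]"] that by simp
  have colQc: "col Qperp i = col Q (\<pi> (p + i))" if "i < ?N - p" for i
    unfolding Qperp using col_sel_cols[OF QD, of i "map \<pi> [p..<?N]"] that by simp

  have SAc: "SA \<in> carrier_mat ?N ?N" using A by (simp add: SA aug_mat_def)
  have Pc: "P \<in> carrier_mat ?N ?N" using SAc by (simp add: P mat_poly_eval_def)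
  have Peig: "P *\<^sub>v col Q (\<pi> i) = \<gamma> i \<cdot>\<^sub>v col Q (\<pi> i)" if i: "i < ?N" for i
  proof -
    have q: "col Q (\<pi> i) \<in> carrier_vec ?N" using QD pm[OF i] by auto
    have "SA *\<^sub>v col Q (\<pi> i) = lam i \<cdot>\<^sub>v col Q (\<pi> i)"
      unfolding SA Q lam by (rule aug_mat_eigenvector[OF svd A mn pm[OF i]])
    hence "((1 / ?\<alpha>) \<cdot>\<^sub>m SA) *\<^sub>v col Q (\<pi> i) = (lam i / ?\<alpha>) \<cdot>\<^sub>v col Q (\<pi> i)"
      using smult_mat_mult_vec[OF SAc q] by (simp add: smult_smult_assoc)
    from mat_poly_eval_eigenvector[OF smult_carrier_mat[OF SAc] q this]
    show ?thesis by (simp add: P gam)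
  qed
  have PQp: "P * Qp = Qp * mat_diag p \<gamma>"
    using pN by (intro mult_eq_mult_mat_diagI[OF Pc QpD(1) QpD(1)]) (simp add: colQp Peig)
  have PQc: "P * Qperp = Qperp * mat_diag (?N - p) (\<lambda>i. \<gamma> (p + i))"
    by (intro mult_eq_mult_mat_diagI[OF Pc QcD(1) QcD(1)]) (simp add: colQc Peig)

  have qr: "orthonormal_cols ?N p (Qt (Suc k))" "R (Suc k) \<in> carrier_mat p p"
    "P * Qt k = Qt (Suc k) * R (Suc k)" for k
    using iter[rule_format, of "Suc k"] by (auto simp: is_qr_def)
  have Qto: "orthonormal_cols ?N p (Qt k)" for k using start qr(1) by (cases k) auto
  have Qtc: "Qt k \<in> carrier_mat ?N p" for k by (rule orthonormal_colsD(1)[OF Qto])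
  have Xc: "?X \<in> carrier_mat p p" by (rule mult_carrier_mat[OF QpD(3) Qtc])
  have Yc: "?Y \<in> carrier_mat (?N - p) p" by (rule mult_carrier_mat[OF QcD(3) Qtc])
  note X0 = mat_inv_invertible(1,2)[OF inv Xc]

  show ?thesis
  proof (intro allI impI)
    fix k :: nat assume k: "1 \<le> k"
    have E_mat: "E k = mat (?N - p) p (\<lambda>(i, j). \<gamma> (p + i) ^ k * (?Y * mat_inv ?X) $$ (i, j) * (1 / \<gamma> j) ^ k)"
      unfolding E Gp Gperp by (rule slope_power_form(1)[OF Yc X0(1) g_ne])
    have Ec: "E k \<in> carrier_mat (?N - p) p" by (simp add: E_mat)
    obtain H where H: "H \<in> carrier_mat p p" "(transpose_mat Qp * Qt k) * H = 1\<^sub>m p"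
      and slope: "transpose_mat Qperp * Qt k = E k * (transpose_mat Qp * Qt k)"
      using subspace_iteration_slope[OF Qpo Qco comp cross Pc PQp PQc g_ne Qtc qr(2,3) X0, of k]
      unfolding E_mat by blast
    have rep: "\<exists>W. orthonormal_cols p p W \<and> Qt k = (Qp + Qperp * E k) * mat_inv (mat_sqrt (M k)) * W"
      unfolding M by (rule slope_representation[OF Qpo Qco comp Qto Ec slope])
    have bound: "mat2_norm (E k) \<le> (\<gamma> p / \<gamma> (p - 1)) ^ k * mat2_norm (?Y * mat_inv ?X)"
      unfolding E Gp Gperp
      by (rule slope_norm_le[OF Yc X0(1) g_pos g_low _ gp]) (use gam_range gam_decr in auto)
    have dist: "\<epsilon> k = mat2_norm (E k) / sqrt (1 + (mat2_norm (E k))\<^sup>2)"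
      unfolding eps by (rule slope_subspace_dist[OF Qpo Qco comp Qto Ec slope H])
    have "\<epsilon> k \<le> mat2_norm (E k) / 1"
      unfolding dist by (intro divide_left_mono mat2_norm_ge_0) (auto simp: add_pos_nonneg)
    hence dist_le: "\<epsilon> k \<le> (\<gamma> p / \<gamma> (p - 1)) ^ k * mat2_norm (?Y * mat_inv ?X)" using bound by simp

    have inj_p: "distinct (map \<pi> [0..<p])" using inj by (simp add: distinct_map)
    have Vpo: "orthonormal_cols n p Vp"
      unfolding Vp using orthonormal_sel_cols[OF V inj_p] pin by force
    have Upo: "orthonormal_cols m p Up"
      unfolding Up using orthonormal_sel_cols[OF U inj_p] pin mn by force
    note VpD = orthonormal_colsD[OF Vpo] and UpD = orthonormal_colsD[OF Upo]
    have colV: "col Vp i = col V (\<pi> i)" and colU: "col Up i = col U (\<pi> i)" if "i < p" for i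
      unfolding Vp Up using col_sel_cols[OF VD, of i "map \<pi> [0..<p]"]
        col_sel_cols[OF UD, of i "map \<pi> [0..<p]"] that by simp_all
    have colQ: "col Qp i = (1 / sqrt 2) \<cdot>\<^sub>v (col Vp i @\<^sub>v col Up i)" if i: "i < p" for i
      using colQp[OF i] col_aug_eigvecs[OF UD VD mn, of "\<pi> i"] pin[OF i] colV[OF i] colU[OF i]
      by (simp add: Q)

    let ?B1 = "hcat (1\<^sub>m n) (0\<^sub>m n m)" and ?B2 = "hcat (0\<^sub>m m n) (1\<^sub>m m)"
    have B1: "?B1 \<in> carrier_mat n ?N" and B2: "?B2 \<in> carrier_mat m ?N"
      by (rule hcat_carrier; simp)+
    have "row ?B1 i = unit_vec ?N (0 + i)" if "i < n" for i
      using that by (intro eq_vecI) (auto simp: hcat_def)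
    note sel1 = block_selector[OF B1 this]
    have "row ?B2 i = unit_vec ?N (n + i)" if "i < m" for i
      using that by (intro eq_vecI) (auto simp: hcat_def)
    note sel2 = block_selector[OF B2 this]
    have BQ1: "?B1 * Qp = (1 / sqrt 2) \<cdot>\<^sub>m Vp"
    proof (rule mat_col_eqI)
      fix j assume "j < dim_col ((1 / sqrt 2) \<cdot>\<^sub>m Vp)"
      hence j: "j < p" using VpD by simp
      have q: "col Qp j \<in> carrier_vec ?N" using QpD j by auto
      show "col (?B1 * Qp) j = col ((1 / sqrt 2) \<cdot>\<^sub>m Vp) j"
      proof (rule eq_vecI)
        fix i assume "i < dim_vec (col ((1 / sqrt 2) \<cdot>\<^sub>m Vp) j)"
        hence i: "i < n" using VpD by simp
        have "col (?B1 * Qp) j $ i = col Qp j $ (0 + i)"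
          unfolding col_mult2[OF B1 QpD(1) j] by (rule sel1(2)[OF _ _ q i]) auto
        thus "col (?B1 * Qp) j $ i = col ((1 / sqrt 2) \<cdot>\<^sub>m Vp) j $ i"
          using colQ[OF j] i j VpD UpD by simp
      qed (use VpD B1 in auto)
    qed (use VpD QpD B1 in auto)
    have BQ2: "?B2 * Qp = (1 / sqrt 2) \<cdot>\<^sub>m Up"
    proof (rule mat_col_eqI)
      fix j assume "j < dim_col ((1 / sqrt 2) \<cdot>\<^sub>m Up)"
      hence j: "j < p" using UpD by simp
      have q: "col Qp j \<in> carrier_vec ?N" using QpD j by auto
      show "col (?B2 * Qp) j = col ((1 / sqrt 2) \<cdot>\<^sub>m Up) j"
      proof (rule eq_vecI)
        fix i assume "i < dim_vec (col ((1 / sqrt 2) \<cdot>\<^sub>m Up) j)"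
        hence i: "i < m" using UpD by simp
        have "col (?B2 * Qp) j $ i = col Qp j $ (n + i)"
          unfolding col_mult2[OF B2 QpD(1) j] by (rule sel2(2)[OF _ _ q i]) auto
        thus "col (?B2 * Qp) j $ i = col ((1 / sqrt 2) \<cdot>\<^sub>m Up) j $ i"
          using colQ[OF j] i j VpD UpD by simp
      qed (use UpD B2 in auto)
    qed (use UpD QpD B2 in auto)
    have q1: "orthonormal_cols n p (Q1 k)" "R1 k \<in> carrier_mat p p" "?B1 * Qt k = Q1 k * R1 k"
      and q2: "orthonormal_cols m p (Q2 k)" "R2 k \<in> carrier_mat p p" "?B2 * Qt k = Q2 k * R2 k"
      using qrY[rule_format, OF k] qrZ[rule_format, OF k] by (auto simp: is_qr_def)
    have e1: "\<epsilon>1 k \<le> sqrt 2 * \<epsilon> k" unfolding eps1 eps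
      by (rule block_subspace_dist[OF sel1(1) Qpo Qto Vpo q1(1,2)]) (use BQ1 q1(3) in auto)
    have e2: "\<epsilon>2 k \<le> sqrt 2 * \<epsilon> k" unfolding eps2 eps
      by (rule block_subspace_dist[OF sel2(1) Qpo Qto Upo q2(1,2)]) (use BQ2 q2(3) in auto)

    have e0: "0 \<le> \<epsilon> k" unfolding eps subspace_dist_def by (rule mat2_norm_ge_0)
    define \<delta> where "\<delta> = sqrt 2 * \<epsilon> k"
    have d0: "0 \<le> \<delta>" using e0 by (simp add: \<delta>_def)
    have weaken: "x \<le> e * vec2_norm z \<Longrightarrow> e \<le> \<delta> \<Longrightarrow> x \<le> \<delta> * vec2_norm z" for x e z
      using mult_right_mono[of e \<delta> "vec2_norm z"] by simp
    have AV: "A * Vp = Up * mat_diag p lam"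
    proof (rule mult_eq_mult_mat_diagI[OF A VpD(1) UpD(1)])
      fix i assume i: "i < p"
      show "A *\<^sub>v col Vp i = lam i \<cdot>\<^sub>v col Up i"
        using svd_mult_right_singular[OF svd A mn pin[OF i]] colV[OF i] colU[OF i] lam_eq[OF i] by simp
    qed
    have AU: "transpose_mat A * Up = Vp * mat_diag p lam"
    proof (rule mult_eq_mult_mat_diagI[OF transpose_carrier_mat[THEN iffD2, OF A] UpD(1) VpD(1)])
      fix i assume i: "i < p"
      show "transpose_mat A *\<^sub>v col Up i = lam i \<cdot>\<^sub>v col Vp i"
        using svd_mult_left_singular[OF svd A mn, of "\<pi> i"] pin[OF i] mn colV[OF i] colU[OF i] lam_eq[OF i]
        by simp
    qed
    have ritz: "\<bar>st i - lam i\<bar> \<le> ?\<alpha> * (6 * (\<epsilon> k)\<^sup>2 + 4 * (\<epsilon> k) ^ 4)"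
      if approx: "ritz_approx p A (Q1 k) (Q2 k) st ut vt" and order: "same_order p lam st" and i: "i < p"
      for st ut vt i
    proof -
      obtain Ub Vb where sv: "is_svd p p (transpose_mat (Q2 k) * A * Q1 k) Ub st Vb"
        using approx by (auto simp: ritz_approx_def)
      have "\<bar>st i - lam i\<bar> \<le> 2 * ?\<alpha> * \<delta>\<^sup>2"
      proof (rule ritz_value_error[OF A Vpo Upo q1(1) q2(1) AV AU lam0 _ _ _ d0 sv order i])
        fix x :: "real vec" assume x: "x \<in> carrier_vec p"
        show "vec2_norm (Q1 k *\<^sub>v x - Vp *\<^sub>v (transpose_mat Vp *\<^sub>v (Q1 k *\<^sub>v x))) \<le> \<delta> * vec2_norm x"
          using weaken[OF residual_le_subspace_dist(2)[OF q1(1) Vpo x]] e1 by (simp add: eps1 \<delta>_def)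
        show "vec2_norm (Q2 k *\<^sub>v x - Up *\<^sub>v (transpose_mat Up *\<^sub>v (Q2 k *\<^sub>v x))) \<le> \<delta> * vec2_norm x"
          using weaken[OF residual_le_subspace_dist(2)[OF q2(1) Upo x]] e2 by (simp add: eps2 \<delta>_def)
        show "vec2_norm (Up *\<^sub>v x - Q2 k *\<^sub>v (transpose_mat (Q2 k) *\<^sub>v (Up *\<^sub>v x))) \<le> \<delta> * vec2_norm x"
          using weaken[OF residual_le_subspace_dist(1)[OF q2(1) Upo x]] e2 by (simp add: eps2 \<delta>_def)
      qed
      \<comment> \<open>the factor \<open>\<surd>2\<close> of the block distances turns \<open>2 \<delta>\<^sup>2\<close> into \<open>4 \<epsilon>\<^sup>2\<close>\<close>
      also have "\<dots> = ?\<alpha> * (4 * (\<epsilon> k)\<^sup>2)" by (simp add: \<delta>_def power_mult_distrib)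
      also have "\<dots> \<le> ?\<alpha> * (6 * (\<epsilon> k)\<^sup>2 + 4 * (\<epsilon> k) ^ 4)"
        by (intro mult_left_mono mat2_norm_ge_0) simp
      finally show ?thesis .
    qed
    show "(\<exists>W. orthonormal_cols p p W \<and> Qt k = (Qp + Qperp * E k) * mat_inv (mat_sqrt (M k)) * W)
      \<and> mat2_norm (E k) \<le> (\<gamma> p / \<gamma> (p - 1)) ^ k * mat2_norm (?Y * mat_inv ?X)
      \<and> \<epsilon> k = mat2_norm (E k) / sqrt (1 + (mat2_norm (E k))\<^sup>2)
      \<and> \<epsilon> k \<le> (\<gamma> p / \<gamma> (p - 1)) ^ k * mat2_norm (?Y * mat_inv ?X)
      \<and> (invertible_mat (R1 k) \<and> invertible_mat (R2 k) \<longrightarrow> \<epsilon>1 k \<le> sqrt 2 * \<epsilon> k \<and> \<epsilon>2 k \<le> sqrt 2 * \<epsilon> k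
        \<and> (\<forall>st ut vt. ritz_approx p A (Q1 k) (Q2 k) st ut vt \<and> same_order p lam st \<longrightarrow>
              (\<forall>i<p. \<bar>st i - lam i\<bar> \<le> ?\<alpha> * (6 * (\<epsilon> k)\<^sup>2 + 4 * (\<epsilon> k) ^ 4))))"
      using rep bound dist dist_le e1 e2 ritz by blast
  qed
qed

end
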